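(* Let $\boldsymbol{\mu}\colon\mathbb{N}\to\{-1,0,1\}$ be the Möbius function. Assume Sarnak's conjecture holds, i.e. for every topological dynamical system $(X,T)$ ($X$ a compact metric space, $T\colon X\to X$ continuous) of zero topological entropy, every $x\in X$ and every continuous $f\colon X\to\mathbb{C}$, $$\lim_{N\to\infty}\frac1N\sum_{n=1}^{N} f(T^n x)\,\boldsymbol{\mu}(n)=0.$$ Then there exists an increasing sequence $(N_i)$ of positive integers along which the Chowla conjecture holds: for every $k\ge 0$, every $1\le a_1<\dots<a_k$ and every choice of $j_0,j_1,\dots,j_k\in\{1,2\}$ not all equal to $2$, $$\lim_{i\to\infty}\frac1{N_i}\sum_{n\le N_i}\boldsymbol{\mu}^{j_0}(n)\,\boldsymbol{\mu}^{j_1}(n+a_1)\cdots\boldsymbol{\mu}^{j_k}(n+a_k)=0.$$ *)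

theory Defs
  imports "HOL-Analysis.Analysis" "HOL-Computational_Algebra.Squarefree"
    "HOL-Library.Liminf_Limsup"
begin

text \<open>The Moebius function (with the convention mu(0) = 0; only n >= 1 is used).\<close>
definition moebius :: "nat \<Rightarrow> real" where
  "moebius n = (if squarefree n then (-1) ^ card (prime_factors n) else 0)"

definition separated_set :: "'a metric \<Rightarrow> ('a \<Rightarrow> 'a) \<Rightarrow> nat \<Rightarrow> real \<Rightarrow> 'a set \<Rightarrow> bool" where
  "separated_set m T n \<epsilon> S \<longleftrightarrow> S \<subseteq> mspace m \<and> finite S \<and>
     (\<forall>x\<in>S. \<forall>y\<in>S. x \<noteq> y \<longrightarrow> (\<exists>i<n. mdist m ((T ^^ i) x) ((T ^^ i) y) > \<epsilon>))"

text \<open>Maximal cardinality of an (n,eps)-separated set (finite for compact spaces).\<close>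
definition max_separated :: "'a metric \<Rightarrow> ('a \<Rightarrow> 'a) \<Rightarrow> nat \<Rightarrow> real \<Rightarrow> nat" where
  "max_separated m T n \<epsilon> = Sup {card S | S. separated_set m T n \<epsilon> S}"

definition topological_entropy :: "'a metric \<Rightarrow> ('a \<Rightarrow> 'a) \<Rightarrow> ereal" where
  "topological_entropy m T =
     (SUP \<epsilon>\<in>{0<..}. limsup (\<lambda>n. ereal (ln (real (max_separated m T n \<epsilon>)) / real n)))"

definition tds :: "'a metric \<Rightarrow> ('a \<Rightarrow> 'a) \<Rightarrow> bool" where
  "tds m T \<longleftrightarrow> compact_space (mtopology_of m) \<and>
     continuous_map (mtopology_of m) (mtopology_of m) T"

text \<open>Sarnak's conjecture. Every compact metric space has cardinality at most
  that of the continuum, so (up to isometric copy) its points can be taken to be reals;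
  quantifying over metrics on subsets of the type real thus covers all compact metric spaces.\<close>
definition Sarnak_conjecture :: bool where
  "Sarnak_conjecture \<longleftrightarrow>
     (\<forall>(m :: real metric) T x (f :: real \<Rightarrow> complex).
        tds m T \<and> topological_entropy m T = 0 \<and> x \<in> mspace m \<and>
        continuous_map (mtopology_of m) euclidean f \<longrightarrow>
        (\<lambda>N. (\<Sum>n=1..N. f ((T ^^ n) x) * complex_of_real (moebius n)) / of_nat N)
          \<longlonglongrightarrow> 0)"

end

theory Submission
  imports Defs
begin

text \<open>Suppose that the logarithmic mean of a correlation \<open>g(n) = (\<Prod>s\<in>A. mu(n+s)^(e s))\<close> does not tend to \<open>0\<close>, and
  let \<open>L\<close> be an ultrafilter limit of logarithmic means with \<open>L g \<noteq> 0\<close>. By invariance of \<open>L\<close> under dilations and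
  shifts and by \<open>mu(p m) = - mu(m)\<close>, up to sign and a small error \<open>L g\<close> equals \<open>L (mu F)\<close>, where \<open>F(n)\<close> is the
  average, with total weight \<open>S\<close> the sum of \<open>1/p\<close> over the primes used, of the products
  \<open>mu(n+p(s-s0))^(e s)\<close>, \<open>s \<noteq> s0\<close>, over those primes \<open>p\<close> that divide \<open>n\<close>. The condition \<open>p dvd n\<close> is
  periodic, and replacing \<open>mu\<close> by its rescaled restriction to a sparse random set changes \<open>F\<close> little in mean
  square, because the variance is of order \<open>1/S\<close> and the sum of the reciprocals of the primes diverges. Hence
  the long blocks of \<open>F\<close> are covered by few words, and \<open>F\<close> has small entropy; no entropy decrement is needed.
  A convexity argument turns these functions, for larger and larger sets of primes, into a Cauchy sequence.
  Rounding its members to nested dictionaries of words and splicing the results gives a single sequence of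
  zero complexity which correlates with \<open>mu\<close>, contrary to Sarnak's conjecture for the subshift it generates.

  So all logarithmic correlations vanish in the limit. Applied to \<open>g(n+h) g(n+h')\<close>, this shows that short
  averages of \<open>g\<close> are small in logarithmic mean square, hence also in mean square up to arbitrarily large
  suitable \<open>x\<close>, and this simultaneously for finitely many \<open>g\<close>. A diagonal choice of the \<open>x\<close> finishes the proof.\<close>

section \<open>Logarithmic means and their limits along an ultrafilter\<close>

text \<open>Sarnak's conjecture speaks of entropy exactly zero, while each prime average
  \<open>F\<close> only has small positive entropy, and different sets of primes give unrelated
  functions \<open>F\<close>; hence the passage to a limit. Closeness in mean does not control
  entropy, so the limit is built from nested dictionaries, whose word counts survive all later
  stages. Sampling bounds entropy because \<open>F\<close> on a block of length H is recovered, up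
  to a small error, from \<open>mu\<close> on a random set of density 1/q, and the number of such
  restrictions is about exp(H (ln q) / q), up to a constant in the exponent. A product of k sampled
  values has to be rescaled by q^k, so the variance is really about q^k / S. Hence q is fixed first,
  by the wanted entropy, and S is made large afterwards. Not all exponents are even; a place
  \<open>s0\<close> with odd exponent supplies the factor \<open>mu(n)\<close> against which
  \<open>F\<close> is tested. Logarithmic weights are forced by the dilation n -> p n, which does
  not respect Cesaro means, and this is what restricts the conclusion to a subsequence.\<close>

lemma ex_ultrafilter:
  fixes F :: "'a filter"
  assumes "F \<noteq> bot"
  shows "\<exists>U\<le>F. U \<noteq> bot \<and> (\<forall>P. eventually P U \<or> eventually (\<lambda>x. \<not> P x) U)"
proof -
  define A where "A = {G. G \<le> F \<and> G \<noteq> bot}"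
  have "\<exists>M\<in>A. \<forall>G\<in>A. G \<le> M \<longrightarrow> G = M"
  proof (rule predicate_Zorn)
    show "partial_order_on A (relation_of (\<lambda>x y. y \<le> x) A)"
      by (auto simp: partial_order_on_def preorder_on_def refl_on_def trans_def antisym_def relation_of_def)
  next
    fix C assume C: "C \<in> Chains (relation_of (\<lambda>x y. y \<le> x) A)"
    have CA: "C \<subseteq> A" and tot: "\<And>G H. G \<in> C \<Longrightarrow> H \<in> C \<Longrightarrow> G \<le> H \<or> H \<le> G"
      using C by (auto simp: Chains_def relation_of_def)
    show "\<exists>u\<in>A. \<forall>a\<in>C. u \<le> a"
    proof (cases "C = {}")
      case True
      then show ?thesis using assms by (auto simp: A_def)
    next
      case False
      \<comment> \<open>A chain is directed, so what holds eventually in its infimum already holds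
        eventually in one member; hence the infimum is a proper filter.\<close>
      have "eventually P (Inf C) \<longleftrightarrow> (\<exists>b\<in>C. eventually P b)" for P
        by (rule eventually_Inf_base[OF False]) (use tot in \<open>metis inf.absorb_iff2 inf.commute order_refl\<close>)
      then have "Inf C \<noteq> bot"
        using CA by (auto simp: A_def trivial_limit_def)
      moreover have "Inf C \<le> F"
        using False CA by (auto simp: A_def intro: Inf_lower2)
      ultimately show ?thesis
        by (auto simp: A_def intro!: bexI[of _ "Inf C"] Inf_lower)
    qed
  qed
  then obtain M where M: "M \<le> F" "M \<noteq> bot" and max: "\<And>G. G \<le> M \<Longrightarrow> G \<noteq> bot \<Longrightarrow> G = M"
    by (auto simp: A_def dest: order_trans)
  have "eventually P M \<or> eventually (\<lambda>x. \<not> P x) M" for P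
  proof (rule disjCI)
    assume "\<not> eventually (\<lambda>x. \<not> P x) M"
    then have "inf M (principal {x. P x}) \<noteq> bot"
      by (auto simp: trivial_limit_def eventually_inf_principal)
    then have "inf M (principal {x. P x}) = M"
      by (intro max) auto
    moreover have "eventually P (inf M (principal {x. P x}))"
      by (simp add: eventually_inf_principal)
    ultimately show "eventually P M" by simp
  qed
  then show ?thesis using M by auto
qed

text \<open>Compactness of \<open>{-C..C}\<close> gives a cluster point; an ultrafilter converges to
  each of its cluster points, since it decides whether \<open>h\<close> lies in a given
  neighbourhood.\<close>

lemma ultrafilter_bounded_tendsto:
  fixes h :: "'a \<Rightarrow> real"
  assumes "U \<noteq> bot" and ultra: "\<And>P. eventually P U \<or> eventually (\<lambda>x. \<not> P x) U"
    and bd: "\<And>x. \<bar>h x\<bar> \<le> C"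
  shows "\<exists>l. (h \<longlongrightarrow> l) U"
proof -
  have "compact {-C..C}" by simp
  moreover have "filtermap h U \<noteq> bot" using assms(1) by (simp add: filtermap_bot_iff)
  moreover have "eventually (\<lambda>x. x \<in> {-C..C}) (filtermap h U)"
    using bd by (auto simp: eventually_filtermap abs_le_iff minus_le_iff intro!: always_eventually)
  ultimately obtain l where l: "inf (nhds l) (filtermap h U) \<noteq> bot"
    unfolding compact_filter by (metis le_principal)
  have "(h \<longlongrightarrow> l) U"
  proof (rule topological_tendstoI)
    fix S assume S: "open S" "l \<in> S"
    have "\<not> eventually (\<lambda>x. \<not> h x \<in> S) U"
    proof
      assume "eventually (\<lambda>x. \<not> h x \<in> S) U"
      then have "eventually (\<lambda>y. y \<notin> S) (filtermap h U)" by (simp add: eventually_filtermap)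
      moreover have "eventually (\<lambda>y. y \<in> S) (nhds l)" using S by (auto simp: eventually_nhds)
      ultimately have "eventually (\<lambda>y. False) (inf (nhds l) (filtermap h U))"
        unfolding eventually_inf by (intro exI conjI) (assumption, assumption, simp)
      then show False using l by (simp add: trivial_limit_def)
    qed
    then show "eventually (\<lambda>x. h x \<in> S) U" using ultra by blast
  qed
  then show ?thesis ..
qed

text \<open>The weights \<open>1 / n\<close> make the restriction to the multiples of
  \<open>p\<close> a copy of the full mean scaled by \<open>1 / p\<close>; \<open>harm N\<close> is
  the total weight.\<close>

definition logmean :: "(nat \<Rightarrow> real) \<Rightarrow> nat \<Rightarrow> real" where
  "logmean f N = (\<Sum>n=1..N. f n / real n) / harm N"

definition bdd_seq :: "(nat \<Rightarrow> real) \<Rightarrow> bool" where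
  "bdd_seq f \<longleftrightarrow> (\<exists>C. \<forall>n. \<bar>f n\<bar> \<le> C)"

lemma bdd_seqI: "(\<And>n. \<bar>f n\<bar> \<le> C) \<Longrightarrow> bdd_seq f"
  by (auto simp: bdd_seq_def)

lemma bdd_seqE:
  assumes "bdd_seq f"
  obtains C where "C \<ge> 0" "\<And>n. \<bar>f n\<bar> \<le> C"
  using assms unfolding bdd_seq_def by (metis abs_ge_zero order_trans)

lemma bdd_seq_const [simp, intro]: "bdd_seq (\<lambda>n. c)"
  by (rule bdd_seqI[of _ "\<bar>c\<bar>"]) simp

lemma bdd_seq_add [intro]: "bdd_seq f \<Longrightarrow> bdd_seq g \<Longrightarrow> bdd_seq (\<lambda>n. f n + g n)"
  unfolding bdd_seq_def by (metis abs_triangle_ineq add_mono order_trans)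

lemma bdd_seq_mult [intro]: "bdd_seq f \<Longrightarrow> bdd_seq g \<Longrightarrow> bdd_seq (\<lambda>n. f n * g n)"
proof -
  assume "bdd_seq f" "bdd_seq g"
  then obtain C D where "C \<ge> 0" "\<And>n. \<bar>f n\<bar> \<le> C" "\<And>n. \<bar>g n\<bar> \<le> D" by (metis bdd_seqE)
  then show ?thesis by (intro bdd_seqI[of _ "C * D"]) (simp add: abs_mult mult_mono)
qed

lemma bdd_seq_abs [intro]: "bdd_seq f \<Longrightarrow> bdd_seq (\<lambda>n. \<bar>f n\<bar>)"
  by (simp add: bdd_seq_def)

lemma bdd_seq_uminus [intro]: "bdd_seq f \<Longrightarrow> bdd_seq (\<lambda>n. - f n)"
  by (simp add: bdd_seq_def)

lemma bdd_seq_diff [intro]: "bdd_seq f \<Longrightarrow> bdd_seq g \<Longrightarrow> bdd_seq (\<lambda>n. f n - g n)"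
  using bdd_seq_add[of f "\<lambda>n. - g n"] by auto

lemma bdd_seq_sum [intro]: "(\<And>i. i \<in> I \<Longrightarrow> bdd_seq (f i)) \<Longrightarrow> bdd_seq (\<lambda>n. \<Sum>i\<in>I. f i n)"
  by (induction I rule: infinite_finite_induct) auto

lemma bdd_seq_comp: "bdd_seq f \<Longrightarrow> bdd_seq (\<lambda>n. f (h n))"
  by (auto simp: bdd_seq_def)

lemma bdd_seq_if [intro]: "bdd_seq f \<Longrightarrow> bdd_seq g \<Longrightarrow> bdd_seq (\<lambda>n. if P n then f n else g n)"
proof -
  assume "bdd_seq f" "bdd_seq g"
  then obtain C D where "\<And>n. \<bar>f n\<bar> \<le> C" "\<And>n. \<bar>g n\<bar> \<le> D" by (metis bdd_seqE)
  then show ?thesis by (intro bdd_seqI[of _ "max C D"]) (auto intro: max.coboundedI1 max.coboundedI2)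
qed

lemma bdd_seq_power [intro]: "bdd_seq f \<Longrightarrow> bdd_seq (\<lambda>n. f n ^ k)"
  by (induction k) auto

lemma logmean_abs_le:
  assumes "\<And>n. \<bar>f n\<bar> \<le> C"
  shows "\<bar>logmean f N\<bar> \<le> C"
proof (cases "N = 0")
  case True
  then show ?thesis using assms[of 0] by (simp add: logmean_def harm_def)
next
  case False
  have "\<bar>\<Sum>n=1..N. f n / real n\<bar> \<le> (\<Sum>n=1..N. C / real n)"
    by (rule order_trans[OF sum_abs sum_mono]) (auto simp: assms abs_divide divide_right_mono)
  also have "\<dots> = C * harm N"
    by (simp add: harm_def sum_distrib_left divide_inverse)
  finally show ?thesis using False
    by (simp add: logmean_def pos_divide_le_eq abs_divide)
qed

lemma logmean_add: "logmean (\<lambda>n. f n + g n) = (\<lambda>N. logmean f N + logmean g N)"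
  by (simp add: fun_eq_iff logmean_def add_divide_distrib sum.distrib)

lemma logmean_cmult: "logmean (\<lambda>n. c * f n) = (\<lambda>N. c * logmean f N)"
  by (simp add: fun_eq_iff logmean_def sum_distrib_left)

lemma logmean_diff: "logmean (\<lambda>n. f n - g n) = (\<lambda>N. logmean f N - logmean g N)"
  by (simp add: fun_eq_iff logmean_def diff_divide_distrib sum_subtractf)

lemma logmean_mono: "(\<And>n. n \<ge> 1 \<Longrightarrow> f n \<le> g n) \<Longrightarrow> logmean f N \<le> logmean g N"
  unfolding logmean_def by (intro divide_right_mono sum_mono) (auto simp: harm_nonneg divide_right_mono)

lemma logmean_const: "N > 0 \<Longrightarrow> logmean (\<lambda>n. c) N = c"
proof -
  have "(\<Sum>n=1..N. c / real n) = c * harm N"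
    by (simp add: harm_def sum_distrib_left divide_inverse)
  moreover have "harm N \<noteq> (0::real)" if "N > 0" by (metis harm_pos less_irrefl that)
  ultimately show "N > 0 \<Longrightarrow> ?thesis" by (simp add: logmean_def)
qed

lemma tendsto_zero_div_harm:
  fixes S :: "nat \<Rightarrow> real"
  assumes "\<And>N. \<bar>S N\<bar> \<le> C"
  shows "(\<lambda>N. S N / harm N) \<longlonglongrightarrow> 0"
proof (rule Lim_null_comparison)
  show "((\<lambda>N. C / harm N) \<longlongrightarrow> 0) sequentially"
    by (rule tendsto_divide_0[OF tendsto_const filterlim_at_top_imp_at_infinity[OF harm_at_top]])
  show "\<forall>\<^sub>F N in sequentially. norm (S N / harm N) \<le> C / harm N"
    using assms by (auto simp: abs_divide divide_right_mono harm_nonneg intro!: always_eventually)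
qed

text \<open>Summation by parts leaves two boundary terms and a series with the convergent weights
  \<open>1 / (n * (n + 1))\<close>, each at most \<open>C\<close>. A bound independent of
  \<open>N\<close> is negligible against \<open>harm N\<close>.\<close>

lemma shift_sum_bound:
  fixes f :: "nat \<Rightarrow> real"
  assumes "\<And>n. \<bar>f n\<bar> \<le> C"
  shows "\<bar>\<Sum>n=1..N. (f (Suc n) - f n) / real n\<bar> \<le> 3 * C"
proof -
  have C0: "C \<ge> 0" using assms[of 0] by linarith
  have eq: "(\<Sum>n=1..N. (f (Suc n) - f n) / real n) =
      f (Suc N) / real (Suc N) - f 1 + (\<Sum>n=1..N. f (Suc n) / (real n * real (Suc n)))"
  proof (induction N)
    case (Suc N)
    have "(x - y) / real (Suc N) = x / real (Suc (Suc N)) - y / real (Suc N) + x / (real (Suc N) * real (Suc (Suc N)))" for x y :: real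
      by (simp add: divide_simps) (simp add: algebra_simps)
    then show ?case using Suc by simp
  qed simp
  have tel: "(\<Sum>n=1..N. 1 / (real n * real (Suc n))) = 1 - 1 / real (Suc N)"
  proof (induction N)
    case (Suc N)
    have "1 / (real (Suc N) * real (Suc (Suc N))) = 1 / real (Suc N) - 1 / real (Suc (Suc N))"
      by (simp add: divide_simps)
    then show ?case using Suc by simp
  qed simp
  have "\<bar>\<Sum>n=1..N. f (Suc n) / (real n * real (Suc n))\<bar> \<le> (\<Sum>n=1..N. C * (1 / (real n * real (Suc n))))"
    by (rule order_trans[OF sum_abs sum_mono]) (auto simp: assms abs_divide abs_mult divide_right_mono)
  also have "\<dots> = C * (1 - 1 / real (Suc N))" by (simp only: sum_distrib_left [symmetric] tel)
  also have "\<dots> \<le> C * 1" using C0 by (intro mult_left_mono) auto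
  finally have 1: "\<bar>\<Sum>n=1..N. f (Suc n) / (real n * real (Suc n))\<bar> \<le> C" by simp
  have "\<bar>f (Suc N) / real (Suc N)\<bar> \<le> C"
  proof -
    have "\<bar>f (Suc N)\<bar> / real (Suc N) \<le> C / 1" using assms[of "Suc N"] C0 by (intro frac_le) auto
    then show ?thesis by (simp add: abs_divide)
  qed
  then show ?thesis using 1 assms[of 1] unfolding eq by linarith
qed

text \<open>Putting \<open>n = p * m\<close> turns the first sum into the second one truncated at
  \<open>N div p\<close>. In the missing range \<open>p * n > N\<close>, so each of at most
  \<open>N\<close> terms is at most \<open>C / N\<close>.\<close>

lemma dilate_sum_bound:
  fixes f :: "nat \<Rightarrow> real"
  assumes "\<And>n. \<bar>f n\<bar> \<le> C" and p: "p > 0"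
  shows "\<bar>(\<Sum>n=1..N. (if p dvd n then f (n div p) else 0) / real n) - (\<Sum>n=1..N. (f n / real p) / real n)\<bar> \<le> C"
proof -
  have C0: "C \<ge> 0" using assms(1)[of 0] by linarith
  have img: "{n\<in>{1..N}. p dvd n} = (\<lambda>m. p * m) ` {1..N div p}"
  proof (intro equalityI subsetI)
    fix n assume "n \<in> {n\<in>{1..N}. p dvd n}"
    then obtain m where "n = p * m" "1 \<le> p * m" "p * m \<le> N" by (auto simp: dvd_def)
    then show "n \<in> (\<lambda>m. p * m) ` {1..N div p}" using p
      by (auto simp: less_eq_div_iff_mult_less_eq mult.commute intro!: image_eqI[of _ _ m])
  next
    fix n assume "n \<in> (\<lambda>m. p * m) ` {1..N div p}"
    then show "n \<in> {n\<in>{1..N}. p dvd n}" using p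
      by (auto simp: less_eq_div_iff_mult_less_eq mult.commute)
  qed
  have "(\<Sum>n=1..N. (if p dvd n then f (n div p) else 0) / real n) = (\<Sum>n | n \<in> {1..N} \<and> p dvd n. f (n div p) / real n)"
    by (intro sum.mono_neutral_cong_right) auto
  also have "\<dots> = (\<Sum>m=1..N div p. (f m / real p) / real m)"
    unfolding img by (subst sum.reindex) (use p in \<open>auto simp: inj_on_def intro!: sum.cong\<close>)
  finally have 1: "(\<Sum>n=1..N. (if p dvd n then f (n div p) else 0) / real n) = (\<Sum>m=1..N div p. (f m / real p) / real m)" .
  have split: "{1..N} = {1..N div p} \<union> {N div p + 1..N}" using p by (auto intro: order_trans[OF _ div_le_dividend])
  have 2: "(\<Sum>n=1..N. (f n / real p) / real n) = (\<Sum>m=1..N div p. (f m / real p) / real m) + (\<Sum>n=N div p+1..N. (f n / real p) / real n)"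
    by (subst split, subst sum.union_disjoint) auto
  have "\<bar>\<Sum>n=N div p+1..N. (f n / real p) / real n\<bar> \<le> (\<Sum>n=N div p+1..N. C / real N)"
  proof (rule order_trans[OF sum_abs sum_mono])
    fix n assume n: "n \<in> {N div p+1..N}"
    have "N < p * (N div p + 1)" using p by (metis Suc_eq_plus1 dividend_less_times_div mult_Suc_right add.commute)
    also have "\<dots> \<le> p * n" using n by (intro mult_left_mono) auto
    finally have "real N \<le> real p * real n" by (metis less_imp_le of_nat_le_iff of_nat_mult)
    then show "\<bar>(f n / real p) / real n\<bar> \<le> C / real N"
      using assms(1)[of n] C0 n p by (auto simp: abs_divide intro!: frac_le)
  qed
  also have "\<dots> \<le> C"
  proof (cases "N = 0")
    case False
    have "real (N - N div p) * (C / real N) \<le> real N * (C / real N)"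
      using C0 by (intro mult_right_mono) auto
    then show ?thesis using False by simp
  qed (use C0 in simp)
  finally show ?thesis unfolding 1 2 by linarith
qed

text \<open>The ultrafilter enters through the last assumption, the existence of all limits; it
  makes \<open>L\<close> a positive linear functional on the bounded sequences.\<close>

locale log_limit =
  fixes U :: "nat filter" and L :: "(nat \<Rightarrow> real) \<Rightarrow> real"
  assumes U_nonbot: "U \<noteq> bot" and U_le: "U \<le> sequentially"
    and L_lim: "bdd_seq f \<Longrightarrow> (logmean f \<longlongrightarrow> L f) U"
begin

lemma L_unique: "bdd_seq f \<Longrightarrow> (logmean f \<longlongrightarrow> l) U \<Longrightarrow> L f = l"
  using tendsto_unique[OF U_nonbot L_lim] by blast

lemma L_add: "bdd_seq f \<Longrightarrow> bdd_seq g \<Longrightarrow> L (\<lambda>n. f n + g n) = L f + L g"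
  by (intro L_unique) (auto simp: logmean_add intro!: tendsto_add L_lim)

lemma L_diff: "bdd_seq f \<Longrightarrow> bdd_seq g \<Longrightarrow> L (\<lambda>n. f n - g n) = L f - L g"
  by (intro L_unique) (auto simp: logmean_diff intro!: tendsto_diff L_lim)

lemma L_cmult: "bdd_seq f \<Longrightarrow> L (\<lambda>n. c * f n) = c * L f"
  by (intro L_unique) (auto simp: logmean_cmult intro!: tendsto_mult_left L_lim)

lemma L_eventually: "eventually P sequentially \<Longrightarrow> eventually P U"
  using U_le by (simp add: le_filter_def)

lemma L_const: "L (\<lambda>n. c) = c"
proof (rule L_unique)
  show "(logmean (\<lambda>n. c) \<longlongrightarrow> c) U"
    by (rule tendsto_eventually, rule L_eventually)
      (auto simp: logmean_const intro: eventually_mono[OF eventually_gt_at_top[of 0]])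
qed simp

lemma L_mono: "bdd_seq f \<Longrightarrow> bdd_seq g \<Longrightarrow> (\<And>n. n \<ge> 1 \<Longrightarrow> f n \<le> g n) \<Longrightarrow> L f \<le> L g"
  by (rule tendsto_le[OF U_nonbot L_lim L_lim]) (auto intro!: always_eventually logmean_mono)

lemma L_nonneg: "bdd_seq f \<Longrightarrow> (\<And>n. n \<ge> 1 \<Longrightarrow> 0 \<le> f n) \<Longrightarrow> 0 \<le> L f"
  using L_mono[of "\<lambda>_. 0" f] by (simp add: L_const)

lemma L_sum: "(\<And>i. i \<in> I \<Longrightarrow> bdd_seq (f i)) \<Longrightarrow> L (\<lambda>n. \<Sum>i\<in>I. f i n) = (\<Sum>i\<in>I. L (f i))"
  by (induction I rule: infinite_finite_induct) (auto simp: L_const L_add bdd_seq_sum)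

lemma L_abs: "bdd_seq f \<Longrightarrow> \<bar>L f\<bar> \<le> L (\<lambda>n. \<bar>f n\<bar>)"
proof -
  assume f: "bdd_seq f"
  have "L f \<le> L (\<lambda>n. \<bar>f n\<bar>)" by (intro L_mono) (auto simp: f)
  moreover have "L (\<lambda>n. (-1) * f n) \<le> L (\<lambda>n. \<bar>f n\<bar>)" by (intro L_mono) (auto simp: f)
  ultimately show ?thesis using f by (simp only: L_cmult)
qed

lemma L_eqI:
  assumes "bdd_seq f" "bdd_seq g"
    and "\<And>N. \<bar>(\<Sum>n=1..N. f n / real n) - (\<Sum>n=1..N. g n / real n)\<bar> \<le> C"
  shows "L f = L g"
proof -
  have "(\<lambda>N. logmean f N - logmean g N) \<longlonglongrightarrow> 0"
    using tendsto_zero_div_harm[of "\<lambda>N. (\<Sum>n=1..N. f n / real n) - (\<Sum>n=1..N. g n / real n)" C] assms(3)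
    by (simp add: logmean_def diff_divide_distrib)
  then have "((\<lambda>N. logmean f N - logmean g N) \<longlongrightarrow> 0) U"
    by (rule tendsto_mono[OF U_le])
  from tendsto_unique[OF U_nonbot this tendsto_diff[OF L_lim L_lim]] assms show ?thesis by simp
qed

lemma L_shift: "bdd_seq f \<Longrightarrow> L (\<lambda>n. f (n + s)) = L f"
proof (induction s)
  case (Suc s)
  obtain C where C: "\<And>n. \<bar>f n\<bar> \<le> C" using Suc(2) by (auto simp: bdd_seq_def)
  have "L (\<lambda>n. f (n + Suc s)) = L (\<lambda>n. f (n + s))"
    using shift_sum_bound[of "\<lambda>n. f (n + s)" C, OF C] Suc(2)
    by (intro L_eqI[of _ _ "3 * C"]) (auto simp: diff_divide_distrib sum_subtractf intro: bdd_seq_comp)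
  then show ?case using Suc by simp
qed simp

lemma L_dilate:
  assumes "bdd_seq f" "p > 0"
  shows "L (\<lambda>n. if p dvd n then f (n div p) else 0) = L f / real p"
proof -
  obtain C where C: "\<And>n. \<bar>f n\<bar> \<le> C" using assms by (auto simp: bdd_seq_def)
  have "L (\<lambda>n. if p dvd n then f (n div p) else 0) = L (\<lambda>n. f n / real p)"
    using dilate_sum_bound[of f C p, OF C assms(2)] bdd_seq_mult[OF assms(1), of "\<lambda>_. 1 / real p"] assms
    by (intro L_eqI bdd_seq_if bdd_seq_const bdd_seq_comp[OF assms(1)]) auto
  also have "\<dots> = L (\<lambda>n. (1 / real p) * f n)" by simp
  also have "\<dots> = L f / real p" by (subst L_cmult) (auto simp: assms)
  finally show ?thesis .
qed

lemma L_dvd: "p > 0 \<Longrightarrow> L (\<lambda>n. if p dvd n then c else 0) = c / real p"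
  using L_dilate[of "\<lambda>_. c" p] by (simp add: L_const)

text \<open>Each residue class modulo \<open>H\<close> is moved by a shift onto the multiples of
  \<open>H\<close>, where the contributions of all classes add up to the sum over one aligned
  block.\<close>

lemma L_aligned_blocks:
  assumes u: "bdd_seq u" and H: "H > 0"
    and le: "\<And>q. (\<Sum>h<H. u (q * H + h)) \<le> \<delta> * real H"
  shows "L u \<le> \<delta>"
proof -
  define v where "v h n = (if H dvd n then u (n + h) else 0)" for h n
  have bv: "bdd_seq (v h)" for h unfolding v_def using u by (auto intro: bdd_seq_comp)
  define z where "z h n = (if n mod H = h then u n else 0)" for h n
  have bz: "bdd_seq (z h)" for h unfolding z_def using u by auto
  have vz: "L (v h) = L (z h)" if "h < H" for h
  proof -
    have "L (z h) = L (\<lambda>n. z h (n + h))" using L_shift[OF bz] by simp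
    also have "(\<lambda>n. z h (n + h)) = v h"
    proof
      fix n
      have "(n + h) mod H = h \<longleftrightarrow> H dvd n"
      proof
        assume "(n + h) mod H = h"
        then have "(n + h) mod H = (0 + h) mod H" using that by simp
        then show "H dvd n" by (metis add.commute add.left_neutral mod_add_cong cong_def add_left_cancel mod_eq_dvd_iff_nat diff_add_inverse2 le_add2 diff_zero)
      qed (use that in \<open>auto elim!: dvdE\<close>)
      then show "z h (n + h) = v h n" by (simp add: z_def v_def)
    qed
    finally show ?thesis by simp
  qed
  have "L u = L (\<lambda>n. \<Sum>h<H. z h n)" using H by (simp add: z_def sum.delta')
  also have "\<dots> = (\<Sum>h<H. L (z h))" by (intro L_sum bz)
  also have "\<dots> = (\<Sum>h<H. L (v h))" using vz by simp
  also have "\<dots> = L (\<lambda>n. \<Sum>h<H. v h n)" by (intro L_sum[symmetric] bv)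
  also have "\<dots> \<le> L (\<lambda>n. if H dvd n then \<delta> * real H else 0)"
  proof (rule L_mono)
    fix n
    show "(\<Sum>h<H. v h n) \<le> (if H dvd n then \<delta> * real H else 0)"
      using le[of "n div H"] by (auto simp: v_def)
  qed (auto intro!: bdd_seq_sum bv)
  also have "\<dots> = \<delta>" using H by (simp add: L_dvd)
  finally show ?thesis .
qed

end

text \<open>The ultrafilter is chosen to contain the set where \<open>P\<close> holds, so that a
  failure of convergence survives in \<open>L\<close>.\<close>

lemma ex_log_limit:
  assumes "frequently P sequentially"
  obtains U L where "log_limit U L" "eventually P U"
proof -
  have "inf sequentially (principal {n. P n}) \<noteq> bot"
    using assms by (auto simp: trivial_limit_def eventually_inf_principal frequently_def)
  then obtain U where U: "U \<le> inf sequentially (principal {n. P n})" "U \<noteq> bot"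
      "\<And>P. eventually P U \<or> eventually (\<lambda>x. \<not> P x) U"
    using ex_ultrafilter by metis
  define L where "L f = (SOME l. (logmean f \<longlongrightarrow> l) U)" for f
  have "(logmean f \<longlongrightarrow> L f) U" if f: "bdd_seq f" for f
  proof -
    obtain C where C: "\<And>n. \<bar>f n\<bar> \<le> C" using f by (auto simp: bdd_seq_def)
    show ?thesis unfolding L_def
      by (rule someI_ex, rule ultrafilter_bounded_tendsto[OF U(2,3)]) (rule logmean_abs_le[OF C])
  qed
  then have "log_limit U L" using U by unfold_locales auto
  moreover have "eventually P U"
    using U(1) by (simp add: le_filter_def eventually_inf_principal)
  ultimately show ?thesis by (rule that)
qed

section \<open>Correlations of the Moebius function and sums over prime dilations\<close>

lemmas bdd_intros = bdd_seq_add bdd_seq_mult bdd_seq_diff bdd_seq_sum bdd_seq_abs bdd_seq_power bdd_seq_const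

lemma abs_moebius_le_1: "\<bar>moebius n\<bar> \<le> 1"
  by (simp add: moebius_def power_abs)

lemma moebius_values: "moebius n \<in> {-1, 0, 1}"
  by (auto simp: moebius_def minus_one_power_iff)

lemma moebius_prime_mult:
  assumes p: "prime p" "\<not> p dvd m"
  shows "moebius (p * m) = - moebius m"
proof (cases "squarefree m")
  case True
  have m0: "m \<noteq> 0" using p by (metis dvd_0_right)
  have cop: "coprime p m" using p by (simp add: prime_imp_coprime)
  have "squarefree (p * m)"
    using squarefree_mult_coprime[OF cop] squarefree_prime[of p] True p by auto
  moreover have "prime_factors (p * m) = insert p (prime_factors m)"
    using p m0 by (simp add: prime_factors_product prime_prime_factors prime_gt_0_nat)
  moreover have "p \<notin> prime_factors m" using p by (auto simp: in_prime_factors_iff)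
  ultimately show ?thesis using True by (simp add: moebius_def)
next
  case False
  then have "\<not> squarefree (p * m)" by (metis squarefree_multD(2))
  then show ?thesis using False by (simp add: moebius_def)
qed

text \<open>Indexing by sets of shifts makes products of sufficiently distant translates again
  correlations.\<close>

definition corr :: "nat set \<Rightarrow> (nat \<Rightarrow> nat) \<Rightarrow> nat \<Rightarrow> real" where
  "corr A e n = (\<Prod>s\<in>A. moebius (n + s) ^ e s)"

lemma abs_prod_le_1:
  fixes f :: "'a \<Rightarrow> real"
  assumes "\<And>i. i \<in> A \<Longrightarrow> \<bar>f i\<bar> \<le> 1"
  shows "\<bar>\<Prod>i\<in>A. f i\<bar> \<le> 1"
  unfolding abs_prod using assms by (intro prod_le_1) auto

lemma abs_power_le_1: "\<bar>x\<bar> \<le> (1::real) \<Longrightarrow> \<bar>x ^ k\<bar> \<le> 1"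
  by (simp add: power_abs power_le_one)

lemma abs_corr_le_1: "\<bar>corr A e n\<bar> \<le> 1"
  unfolding corr_def by (intro abs_prod_le_1 abs_power_le_1 abs_moebius_le_1)

lemma bdd_seq_corr [intro]: "bdd_seq (corr A e)"
  by (rule bdd_seqI[of _ 1]) (rule abs_corr_le_1)

definition recip_sum :: "nat set \<Rightarrow> real" where
  "recip_sum P = (\<Sum>p\<in>P. 1 / real p)"

text \<open>Since \<open>p dvd n\<close> has density \<open>1 / p\<close>, division by
  \<open>recip_sum P\<close> gives total weight one. The function \<open>f\<close> is left open
  because the Moebius function, its translate to the start of a block and sparse restrictions of it
  are all inserted.\<close>

definition dilate_sum :: "nat set \<Rightarrow> 'i set \<Rightarrow> ('i \<Rightarrow> int) \<Rightarrow> ('i \<Rightarrow> nat) \<Rightarrow> (int \<Rightarrow> real) \<Rightarrow> int \<Rightarrow> real" where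
  "dilate_sum P I b e f z =
     (\<Sum>p\<in>P. if int p dvd z then \<Prod>i\<in>I. f (z + int p * b i) ^ e i else 0) / recip_sum P"

text \<open>Integer shifts are used because \<open>s - s0\<close> may be negative; \<open>nat\<close> sends negative arguments to \<open>0\<close>, where
  \<open>moebius\<close> vanishes.\<close>
definition dilated_corr :: "nat set \<Rightarrow> nat set \<Rightarrow> nat \<Rightarrow> (nat \<Rightarrow> nat) \<Rightarrow> nat \<Rightarrow> real" where
  "dilated_corr P A s0 e n = dilate_sum P (A - {s0}) (\<lambda>s. int s - int s0) e (\<lambda>z. moebius (nat z)) (int n)"

lemma recip_sum_nonneg: "recip_sum P \<ge> 0"
  by (simp add: recip_sum_def sum_nonneg)

lemma abs_dilated_corr_le: "\<bar>dilated_corr P A s0 e n\<bar> \<le> (\<Sum>p\<in>P. if p dvd n then 1 else 0) / recip_sum P"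
proof -
  have "\<bar>\<Sum>p\<in>P. if int p dvd int n then \<Prod>i\<in>A - {s0}. moebius (nat (int n + int p * (int i - int s0))) ^ e i else 0\<bar>
     \<le> (\<Sum>p\<in>P. if p dvd n then 1 else 0)"
    by (rule order_trans[OF sum_abs sum_mono]) (auto intro!: abs_prod_le_1 abs_power_le_1 abs_moebius_le_1)
  then show ?thesis
    by (simp add: dilated_corr_def dilate_sum_def divide_right_mono recip_sum_nonneg)
qed

lemma bdd_seq_dilated_corr [intro]: "bdd_seq (dilated_corr P A s0 e)"
proof (rule bdd_seqI)
  fix n
  have "(\<Sum>p\<in>P. if p dvd n then 1 else (0::real)) \<le> (\<Sum>p\<in>P. 1)" by (intro sum_mono) auto
  then show "\<bar>dilated_corr P A s0 e n\<bar> \<le> (\<Sum>p\<in>P. 1) / recip_sum P"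
    by (intro order_trans[OF abs_dilated_corr_le] divide_right_mono recip_sum_nonneg)
qed

context log_limit
begin

text \<open>For \<open>n = p * m\<close> the factor at \<open>p * s\<close> is
  \<open>moebius (p * (m + s))\<close>, which equals \<open>- moebius (m + s)\<close> unless
  \<open>p dvd m + s\<close>. These exceptions have density at most \<open>card A / p\<close> and
  cost at most 2; the restriction to multiples of \<open>p\<close> brings the second factor
  \<open>1 / p\<close>.\<close>

lemma L_corr_dilate:
  assumes p: "prime p" and A: "finite A"
  shows "\<bar>L (\<lambda>n. if p dvd n then corr ((*) p ` A) (\<lambda>s. e (s div p)) n else 0)
           - (-1) ^ (\<Sum>s\<in>A. e s) * L (corr A e) / real p\<bar> \<le> 2 * real (card A) / (real p)\<^sup>2"
proof -
  have p0: "p > 0" using p prime_gt_0_nat by blast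
  define h where "h m = (\<Prod>s\<in>A. moebius (p * (m + s)) ^ e s)" for m
  have bh: "bdd_seq h" unfolding h_def
    by (rule bdd_seqI[of _ 1]) (intro abs_prod_le_1 abs_power_le_1 abs_moebius_le_1)
  define \<sigma> :: real where "\<sigma> = (-1) ^ (\<Sum>s\<in>A. e s)"
  have eq: "(\<lambda>n. if p dvd n then corr ((*) p ` A) (\<lambda>s. e (s div p)) n else 0) = (\<lambda>n. if p dvd n then h (n div p) else 0)"
  proof
    fix n
    show "(if p dvd n then corr ((*) p ` A) (\<lambda>s. e (s div p)) n else 0) = (if p dvd n then h (n div p) else 0)"
      using p0 by (auto simp: corr_def h_def prod.reindex inj_on_def algebra_simps intro!: prod.cong)
  qed
  have pt: "\<bar>h m - \<sigma> * corr A e m\<bar> \<le> (\<Sum>s\<in>A. if p dvd (m + s) then 2 else 0)" for m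
  proof (cases "\<exists>s\<in>A. p dvd (m + s)")
    case False
    then have "h m = (\<Prod>s\<in>A. (-1) ^ e s * moebius (m + s) ^ e s)"
      unfolding h_def using p
      by (intro prod.cong) (auto simp: moebius_prime_mult power_minus[of "moebius _"])
    also have "\<dots> = \<sigma> * corr A e m"
      by (simp add: prod.distrib corr_def \<sigma>_def power_sum)
    finally show ?thesis by (simp add: sum_nonneg)
  next
    case True
    then obtain s where s: "s \<in> A" "p dvd (m + s)" by blast
    have "\<bar>h m\<bar> \<le> 1" unfolding h_def by (intro abs_prod_le_1 abs_power_le_1 abs_moebius_le_1)
    moreover have "\<bar>\<sigma> * corr A e m\<bar> \<le> 1"
      using abs_corr_le_1[of A e m] by (simp add: abs_mult \<sigma>_def power_abs)
    ultimately have "\<bar>h m - \<sigma> * corr A e m\<bar> \<le> 2" by linarith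
    also have "\<dots> \<le> (\<Sum>s\<in>A. if p dvd (m + s) then 2 else 0)"
      using member_le_sum[of s A "\<lambda>s. if p dvd (m + s) then 2 else (0::real)"] s A by auto
    finally show ?thesis .
  qed
  have bs: "bdd_seq (\<lambda>n. if p dvd (n + s) then 2 else 0)" for s by auto
  have "\<bar>L h - \<sigma> * L (corr A e)\<bar> = \<bar>L (\<lambda>m. h m - \<sigma> * corr A e m)\<bar>"
    by (subst L_diff) (auto simp: L_cmult bdd_seq_corr intro!: bdd_intros bh)
  also have "\<dots> \<le> L (\<lambda>m. \<bar>h m - \<sigma> * corr A e m\<bar>)" by (intro L_abs bdd_intros bh bdd_seq_corr)
  also have "\<dots> \<le> L (\<lambda>m. \<Sum>s\<in>A. if p dvd (m + s) then 2 else 0)"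
    by (intro L_mono pt bdd_intros bh bdd_seq_corr bs)
  also have "\<dots> = (\<Sum>s\<in>A. L (\<lambda>m. if p dvd (m + s) then 2 else 0))" by (intro L_sum bs)
  also have "\<dots> = (\<Sum>s\<in>A. 2 / real p)"
  proof (rule sum.cong[OF refl])
    fix s
    have "L (\<lambda>m. (\<lambda>n. if p dvd n then 2 else 0) (m + s)) = L (\<lambda>n. if p dvd n then 2 else 0)"
      by (rule L_shift) auto
    then show "L (\<lambda>m. if p dvd (m + s) then 2 else 0) = 2 / real p" using p0 by (simp add: L_dvd)
  qed
  finally have "\<bar>L h - \<sigma> * L (corr A e)\<bar> / real p \<le> (2 * real (card A) / real p) / real p"
    by (intro divide_right_mono) (auto simp: mult.commute)
  moreover have "\<bar>L h - \<sigma> * L (corr A e)\<bar> / real p = \<bar>L h / real p - \<sigma> * L (corr A e) / real p\<bar>"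
    using p0 by (simp add: diff_divide_distrib [symmetric] abs_divide)
  ultimately show ?thesis
    unfolding eq L_dilate[OF bh p0] \<sigma>_def by (simp add: power2_eq_square)
qed

text \<open>The preceding estimate is averaged over \<open>P\<close> with weights
  \<open>1 / p\<close>; its error for the prime \<open>p\<close> is at most
  \<open>2 * card A / K\<close> times the weight of \<open>p\<close>.\<close>

lemma L_moebius_dilated_corr:
  assumes A: "finite A" "s0 \<in> A" "odd (e s0)" and P: "finite P" "P \<noteq> {}"
    and prime: "\<And>p. p \<in> P \<Longrightarrow> prime p \<and> K \<le> real p" and K: "K > 0"
  shows "\<bar>L (\<lambda>n. moebius n * dilated_corr P A s0 e n) - (-1) ^ (\<Sum>s\<in>A. e s) * L (corr A e)\<bar> \<le> 2 * real (card A) / K"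
proof -
  define \<sigma> :: real where "\<sigma> = (-1) ^ (\<Sum>s\<in>A. e s)"
  define c where "c = L (corr A e)"
  have R: "recip_sum P > 0" unfolding recip_sum_def using P prime prime_gt_0_nat by (intro sum_pos) auto
  define t where "t p n = (if p dvd n then \<Prod>i\<in>A - {s0}. moebius (nat (int n + int p * (int i - int s0))) ^ e i else 0)" for p n
  have bt: "bdd_seq (t p)" for p unfolding t_def
    by (rule bdd_seqI[of _ 1]) (auto intro!: abs_prod_le_1 abs_power_le_1 abs_moebius_le_1)
  have bmu: "bdd_seq moebius" by (rule bdd_seqI[of _ 1]) (rule abs_moebius_le_1)
  have bm: "bdd_seq (\<lambda>n. moebius n * t p n)" for p by (intro bdd_seq_mult bmu bt)
  have one: "\<bar>L (\<lambda>n. moebius n * t p n) - \<sigma> * c / real p\<bar> \<le> 2 * real (card A) / K * (1 / real p)" if p: "p \<in> P" for p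
  proof -
    have pp: "prime p" "K \<le> real p" "p > 0" using prime[OF p] prime_gt_0_nat by auto
    \<comment> \<open>Odd powers of -1, 0 and 1 are the numbers themselves, so the factor at
      \<open>s0\<close> is \<open>moebius\<close> to the first power.\<close>
    have odd: "moebius n ^ e s0 = moebius n" for n
      using moebius_values[of n] A(3) by (auto simp: odd_pos)
    \<comment> \<open>The shift by \<open>p * s0\<close> undoes the centring at \<open>s0\<close>
      and leaves divisibility by \<open>p\<close> unchanged.\<close>
    have "L (\<lambda>n. moebius n * t p n) = L (\<lambda>n. moebius (n + p * s0) * t p (n + p * s0))"
      using L_shift[OF bm[of p], of "p * s0"] by simp
    also have "(\<lambda>n. moebius (n + p * s0) * t p (n + p * s0)) = (\<lambda>n. if p dvd n then corr ((*) p ` A) (\<lambda>s. e (s div p)) n else 0)"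
    proof
      fix n
      have "nat (int (n + p * s0) + int p * (int i - int s0)) = n + p * i" for i
        by (simp add: algebra_simps flip: of_nat_mult of_nat_add)
      moreover have "corr ((*) p ` A) (\<lambda>s. e (s div p)) n = moebius (n + p * s0) * (\<Prod>i\<in>A - {s0}. moebius (n + p * i) ^ e i)"
        using pp A odd by (simp add: corr_def prod.reindex inj_on_def prod.remove[of A s0])
      moreover have "p dvd n + p * s0 \<longleftrightarrow> p dvd n" by (rule dvd_add_left_iff) simp
      ultimately show "moebius (n + p * s0) * t p (n + p * s0) = (if p dvd n then corr ((*) p ` A) (\<lambda>s. e (s div p)) n else 0)"
        by (simp add: t_def)
    qed
    finally have "\<bar>L (\<lambda>n. moebius n * t p n) - \<sigma> * c / real p\<bar> \<le> 2 * real (card A) / (real p)\<^sup>2"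
      using L_corr_dilate[OF pp(1) A(1)] by (simp add: \<sigma>_def c_def)
    also have "\<dots> \<le> 2 * real (card A) / (K * real p)"
      using pp K by (intro divide_left_mono) (auto simp: power2_eq_square)
    finally show ?thesis by simp
  qed
  have "L (\<lambda>n. moebius n * dilated_corr P A s0 e n) = L (\<lambda>n. (1 / recip_sum P) * (\<Sum>p\<in>P. moebius n * t p n))"
    by (simp add: dilated_corr_def dilate_sum_def t_def sum_distrib_left sum_divide_distrib)
  also have "\<dots> = (1 / recip_sum P) * (\<Sum>p\<in>P. L (\<lambda>n. moebius n * t p n))"
    by (subst L_cmult) (auto simp: L_sum bm intro!: bdd_seq_sum bm)
  finally have 1: "L (\<lambda>n. moebius n * dilated_corr P A s0 e n) = (\<Sum>p\<in>P. L (\<lambda>n. moebius n * t p n)) / recip_sum P" by simp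
  have 2: "\<sigma> * c = (\<Sum>p\<in>P. \<sigma> * c / real p) / recip_sum P"
  proof -
    have "(\<Sum>p\<in>P. \<sigma> * c / real p) = \<sigma> * c * recip_sum P" by (simp add: recip_sum_def sum_distrib_left)
    then show ?thesis using R by simp
  qed
  have "\<bar>L (\<lambda>n. moebius n * dilated_corr P A s0 e n) - \<sigma> * c\<bar> = \<bar>\<Sum>p\<in>P. (L (\<lambda>n. moebius n * t p n) - \<sigma> * c / real p)\<bar> / recip_sum P"
    using R by (subst 2, subst 1) (simp add: sum_subtractf diff_divide_distrib [symmetric] abs_divide)
  also have "\<dots> \<le> (\<Sum>p\<in>P. 2 * real (card A) / K * (1 / real p)) / recip_sum P"
    using R by (intro divide_right_mono order_trans[OF sum_abs sum_mono] one) auto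
  also have "\<dots> = 2 * real (card A) / K"
    using R by (simp only: sum_distrib_left [symmetric] recip_sum_def [symmetric]) simp
  finally show ?thesis by (simp add: \<sigma>_def c_def)
qed

text \<open>As in the Turan-Kubilius inequality: for distinct primes the events
  \<open>p dvd n\<close> are independent under \<open>L\<close>, so the number of divisors from
  \<open>P\<close> has second moment at most \<open>(recip_sum P)\<^sup>2 + recip_sum P\<close>. The
  bound is uniform in \<open>P\<close>, as the convexity argument requires.\<close>

lemma L_dilated_corr_square:
  assumes P: "finite P" and prime: "\<And>p. p \<in> P \<Longrightarrow> prime p" and R: "recip_sum P \<ge> 1"
  shows "L (\<lambda>n. (dilated_corr P A s0 e n)\<^sup>2) \<le> 2"
proof -
  define d where "d p n = (if p dvd n then 1 else (0::real))" for p n :: nat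
  have bd: "bdd_seq (d p)" for p unfolding d_def by auto
  have "(dilated_corr P A s0 e n)\<^sup>2 \<le> (1 / (recip_sum P)\<^sup>2) * (\<Sum>p\<in>P. \<Sum>q\<in>P. d p n * d q n)" for n
  proof -
    have "(dilated_corr P A s0 e n)\<^sup>2 = \<bar>dilated_corr P A s0 e n\<bar>\<^sup>2" by simp
    also have "\<dots> \<le> ((\<Sum>p\<in>P. d p n) / recip_sum P)\<^sup>2"
      using abs_dilated_corr_le[of P A s0 e n] by (intro power_mono) (auto simp: d_def)
    also have "\<dots> = (1 / (recip_sum P)\<^sup>2) * (\<Sum>p\<in>P. \<Sum>q\<in>P. d p n * d q n)"
      by (simp add: power_divide power2_eq_square sum_product)
    finally show ?thesis .
  qed
  then have "L (\<lambda>n. (dilated_corr P A s0 e n)\<^sup>2) \<le> L (\<lambda>n. (1 / (recip_sum P)\<^sup>2) * (\<Sum>p\<in>P. \<Sum>q\<in>P. d p n * d q n))"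
    by (intro L_mono bdd_seq_power bdd_seq_dilated_corr bdd_seq_mult bdd_seq_sum bdd_seq_const bd)
  also have "\<dots> = (1 / (recip_sum P)\<^sup>2) * (\<Sum>p\<in>P. \<Sum>q\<in>P. L (\<lambda>n. d p n * d q n))"
    by (subst L_cmult) (auto simp: L_sum bd bdd_seq_mult bdd_seq_sum intro!: bdd_seq_sum bdd_seq_mult bd)
  also have "\<dots> \<le> (1 / (recip_sum P)\<^sup>2) * (\<Sum>p\<in>P. \<Sum>q\<in>P. (1 / real p) * (1 / real q) + (if p = q then 1 / real p else 0))"
  proof (intro mult_left_mono sum_mono)
    fix p q assume pq: "p \<in> P" "q \<in> P"
    have p0: "p > 0" "q > 0" using pq prime prime_gt_0_nat by auto
    show "L (\<lambda>n. d p n * d q n) \<le> (1 / real p) * (1 / real q) + (if p = q then 1 / real p else 0)"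
    proof (cases "p = q")
      case True
      have "(\<lambda>n. d p n * d q n) = (\<lambda>n. if p dvd n then 1 else 0)" using True by (auto simp: d_def)
      then show ?thesis using True p0 by (simp add: L_dvd)
    next
      case False
      then have "coprime p q" using pq prime by (simp add: primes_coprime)
      then have "(\<lambda>n. d p n * d q n) = (\<lambda>n. if p * q dvd n then 1 else 0)"
        by (auto simp: d_def fun_eq_iff divides_mult intro: dvd_mult_left dvd_mult_right)
      then show ?thesis using False p0 by (simp add: L_dvd)
    qed
  qed auto
  also have "(\<Sum>p\<in>P. \<Sum>q\<in>P. (1 / real p) * (1 / real q) + (if p = q then 1 / real p else 0)) = (recip_sum P)\<^sup>2 + recip_sum P"
    using P by (simp add: sum.distrib recip_sum_def power2_eq_square sum_product)
  also have "(1 / (recip_sum P)\<^sup>2) * ((recip_sum P)\<^sup>2 + recip_sum P) = 1 + 1 / recip_sum P"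
    using R by (simp add: field_simps power2_eq_square)
  also have "\<dots> \<le> 2" using R by simp
  finally show ?thesis .
qed

end

section \<open>Divergence of the sum of the reciprocals of the primes\<close>

lemma card_smooth_le:
  fixes K m :: nat
  shows "card {n\<in>{1..m\<^sup>2}. \<forall>p. prime p \<longrightarrow> p dvd n \<longrightarrow> p < K} \<le> 2 ^ K * m"
proof -
  have "{n\<in>{1..m\<^sup>2}. \<forall>p. prime p \<longrightarrow> p dvd n \<longrightarrow> p < K} \<subseteq> (\<lambda>(S, k). \<Prod>S * k\<^sup>2) ` (Pow {..<K} \<times> {1..m})"
  proof
    fix n assume n: "n \<in> {n\<in>{1..m\<^sup>2}. \<forall>p. prime p \<longrightarrow> p dvd n \<longrightarrow> p < K}"
    \<comment> \<open>The squarefree part is a product of distinct primes below \<open>K\<close>, so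
      a subset of \<open>{..<K}\<close> determines it; the square part leaves at most
      \<open>m\<close> choices.\<close>
    define a where "a = squarefree_part n"
    define k where "k = square_part n"
    have nak: "n = a * k\<^sup>2" unfolding a_def k_def by (rule squarefree_decompose)
    have a0: "a \<noteq> 0" "k \<noteq> 0" using nak n by (auto intro!: gr0I)
    have "a = (\<Prod>p\<in>prime_factors a. p ^ multiplicity p a)"
      using prod_prime_factors[of a] a0 by simp
    also have "\<dots> = \<Prod>(prime_factors a)"
    proof (intro prod.cong refl)
      fix p assume "p \<in> prime_factors a"
      moreover have "squarefree a" by (simp add: a_def)
      ultimately have "multiplicity p a = 1" using squarefree_factorial_semiring'[OF a0(1)] by blast
      then show "p ^ multiplicity p a = p" by simp
    qed
    finally have "n = (\<lambda>(S, k). \<Prod>S * k\<^sup>2) (prime_factors a, k)" using nak by simp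
    moreover have "prime_factors a \<subseteq> {..<K}" using n nak by (auto simp: in_prime_factors_iff)
    moreover have "k \<le> m"
    proof -
      have "k\<^sup>2 \<le> a * k\<^sup>2" using a0 by simp
      also have "\<dots> \<le> m\<^sup>2" using n nak by simp
      finally show ?thesis by (simp add: power2_nat_le_eq_le)
    qed
    ultimately show "n \<in> (\<lambda>(S, k). \<Prod>S * k\<^sup>2) ` (Pow {..<K} \<times> {1..m})"
      using a0 by (intro image_eqI[of _ _ "(prime_factors a, k)"]) auto
  qed
  then have "card {n\<in>{1..m\<^sup>2}. \<forall>p. prime p \<longrightarrow> p dvd n \<longrightarrow> p < K} \<le> card (Pow {..<K} \<times> {1..m})"
    by (rule surj_card_le[rotated]) auto
  then show ?thesis by (simp add: card_cartesian_product card_Pow)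
qed

lemma card_multiples_le:
  fixes p x :: nat
  assumes "p > 0"
  shows "real (card {n\<in>{1..x}. p dvd n}) \<le> real x / real p"
proof -
  have "{n\<in>{1..x}. p dvd n} \<subseteq> (\<lambda>m. p * m) ` {1..x div p}"
    using assms by (auto simp: dvd_def less_eq_div_iff_mult_less_eq mult.commute intro!: image_eqI)
  then have "card {n\<in>{1..x}. p dvd n} \<le> card {1..x div p}"
    by (rule surj_card_le[rotated]) auto
  also have "real (card {1..x div p}) \<le> real x / real p"
    by (simp add: of_nat_div_le_of_nat)
  finally show ?thesis by simp
qed

text \<open>Erdos' counting argument.\<close>
lemma recip_sum_primes_tail_large:
  "\<exists>P. finite P \<and> (\<forall>p\<in>P. prime p \<and> K \<le> p) \<and> recip_sum P > 1 / 2"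
proof (rule ccontr)
  assume not: "\<not> ?thesis"
  \<comment> \<open>Then \<open>2 ^ K * m\<close> is a quarter of \<open>m\<^sup>2\<close>, while
    the multiples of primes from \<open>P\<close> fill at most half; together they cannot cover
    \<open>{1..m\<^sup>2}\<close>.\<close>
  define m where "m = (2::nat) ^ (K + 2)"
  define P where "P = {p. prime p \<and> K \<le> p \<and> p \<le> m\<^sup>2}"
  have finP: "finite P" by (rule finite_subset[of _ "{..m\<^sup>2}"]) (auto simp: P_def)
  have "\<forall>p\<in>P. prime p \<and> K \<le> p" by (auto simp: P_def)
  then have "recip_sum P \<le> 1 / 2" using not finP by (meson not_less)
  define S where "S = {n\<in>{1..m\<^sup>2}. \<forall>p. prime p \<longrightarrow> p dvd n \<longrightarrow> p < K}"
  have sub: "{1..m\<^sup>2} \<subseteq> S \<union> (\<Union>p\<in>P. {n\<in>{1..m\<^sup>2}. p dvd n})"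
  proof
    fix n assume n: "n \<in> {1..m\<^sup>2}"
    show "n \<in> S \<union> (\<Union>p\<in>P. {n\<in>{1..m\<^sup>2}. p dvd n})"
    proof (cases "n \<in> S")
      case False
      then obtain p where p: "prime p" "p dvd n" "K \<le> p" using n by (auto simp: S_def not_less)
      then have "p \<le> m\<^sup>2" using n dvd_imp_le[of p n] by auto
      then show ?thesis using n p by (auto simp: P_def)
    qed simp
  qed
  have "m\<^sup>2 \<le> card (S \<union> (\<Union>p\<in>P. {n\<in>{1..m\<^sup>2}. p dvd n}))"
    using card_mono[OF _ sub] finP by (simp add: S_def)
  also have "\<dots> \<le> card S + (\<Sum>p\<in>P. card {n\<in>{1..m\<^sup>2}. p dvd n})"
    by (intro order_trans[OF card_Un_le] add_left_mono card_UN_le finP)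
  finally have "real (m\<^sup>2) \<le> real (card S) + (\<Sum>p\<in>P. real (card {n\<in>{1..m\<^sup>2}. p dvd n}))"
    unfolding of_nat_sum [symmetric] of_nat_add [symmetric] by (rule of_nat_mono)
  also have "\<dots> \<le> real (2 ^ K * m) + (\<Sum>p\<in>P. real (m\<^sup>2) * (1 / real p))"
    using card_smooth_le[of m K] card_multiples_le[of _ "m\<^sup>2"]
    by (intro add_mono sum_mono) (auto simp: S_def P_def prime_gt_0_nat simp del: of_nat_mult of_nat_power)
  also have "\<dots> = real (2 ^ K * m) + real (m\<^sup>2) * recip_sum P"
    by (simp only: recip_sum_def sum_distrib_left)
  also have "\<dots> \<le> real (2 ^ K * m) + real (m\<^sup>2) * (1 / 2)"
    using \<open>recip_sum P \<le> 1 / 2\<close> by (intro add_left_mono mult_left_mono) auto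
  finally have "real m * real m \<le> 2 * (2 ^ K * real m)" by (simp add: power2_eq_square)
  moreover have "real m = 4 * 2 ^ K" by (simp add: m_def)
  ultimately show False by simp
qed

lemma recip_sum_primes_large:
  "\<exists>P. finite P \<and> (\<forall>p\<in>P. prime p \<and> K \<le> p) \<and> recip_sum P \<ge> M"
proof -
  have "\<exists>P. finite P \<and> (\<forall>p\<in>P. prime p \<and> K \<le> p) \<and> recip_sum P \<ge> real j / 2" for j
  proof (induction j)
    case 0
    then show ?case by (intro exI[of _ "{}"]) (auto simp: recip_sum_def)
  next
    case (Suc j)
    then obtain P where P: "finite P" "\<forall>p\<in>P. prime p \<and> K \<le> p" "recip_sum P \<ge> real j / 2" by blast
    define K' where "K' = Suc (Max (insert K P))"
    have K': "K \<le> K'" "\<And>p. p \<in> P \<Longrightarrow> p < K'"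
      using P Max_ge[of "insert K P"] by (auto simp: K'_def le_imp_less_Suc le_SucI)
    obtain Q where Q: "finite Q" "\<forall>p\<in>Q. prime p \<and> K' \<le> p" "recip_sum Q > 1 / 2"
      using recip_sum_primes_tail_large[of K'] by blast
    have "P \<inter> Q = {}" using K'(2) Q(2) by (meson disjoint_iff not_less)
    then have "recip_sum (P \<union> Q) = recip_sum P + recip_sum Q"
      using P Q by (simp add: recip_sum_def sum.union_disjoint)
    then show ?case using P Q K' by (intro exI[of _ "P \<union> Q"]) (auto intro: order_trans)
  qed
  note ex = this
  obtain j :: nat where "2 * M \<le> real j" using real_arch_simple by blast
  moreover obtain P where "finite P" "\<forall>p\<in>P. prime p \<and> K \<le> p" "recip_sum P \<ge> real j / 2" using ex by blast
  ultimately show ?thesis by (intro exI[of _ P]) auto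
qed

section \<open>Approximation of the prime averages by sparse sampling\<close>

text \<open>Metric entropy at most \<open>\<delta>\<close> for the blocks of \<open>X\<close>, measured in normalised \<open>L1\<close> distance. Only blocks
  starting at multiples of \<open>Q\<close> are considered, so that conditions \<open>p dvd n\<close> with \<open>p dvd Q\<close> cost nothing.\<close>
abbreviation word_cover :: "real \<Rightarrow> (nat \<Rightarrow> real) \<Rightarrow> nat \<Rightarrow> nat \<Rightarrow> bool" where
  "word_cover \<delta> X Q H \<equiv> \<exists>V :: (nat \<Rightarrow> real) set.
      finite V \<and> real (card V) \<le> exp (\<delta> * real H) \<and>
      (\<forall>n. Q dvd n \<longrightarrow> (\<exists>w\<in>V. (\<Sum>h<H. \<bar>X (n + h) - w h\<bar>) \<le> \<delta> * real H))"

text \<open>One \<open>Q\<close> serves all long blocks, so that \<open>H\<close> can later be taken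
  as a common multiple of \<open>Q\<close> and an older block length.\<close>

definition block_cov :: "real \<Rightarrow> (nat \<Rightarrow> real) \<Rightarrow> bool" where
  "block_cov \<delta> X \<longleftrightarrow> (\<exists>Q>0. \<exists>H0. \<forall>H\<ge>H0. word_cover \<delta> X Q H)"

text \<open>Probability in counting form: under a uniform colouring all points of \<open>S\<close>
  receive colour 0 with probability \<open>1 / q ^ card S\<close>.\<close>

lemma sum_colourings_vanishing:
  fixes W :: "'a set" and q :: nat
  assumes W: "finite W" "S \<subseteq> W" and q: "q \<ge> 1"
  shows "real q ^ card S * (\<Sum>\<kappa>\<in>(W \<rightarrow>\<^sub>E {..<q}). of_bool (\<forall>x\<in>S. \<kappa> x = 0)) = real (card (W \<rightarrow>\<^sub>E {..<q}))"
proof -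
  have "{\<kappa> \<in> (W \<rightarrow>\<^sub>E {..<q}). \<forall>x\<in>S. \<kappa> x = 0} = PiE W (\<lambda>x. if x \<in> S then {0} else {..<q})"
    using W q by (auto simp: PiE_iff extensional_def split: if_splits)
  then have "(\<Sum>\<kappa>\<in>(W \<rightarrow>\<^sub>E {..<q}). of_bool (\<forall>x\<in>S. \<kappa> x = 0)) = real (card (PiE W (\<lambda>x. if x \<in> S then {0} else {..<q})))"
    using W by (simp add: sum.If_cases of_bool_def finite_PiE Int_def conj_commute)
  also have "card (PiE W (\<lambda>x. if x \<in> S then {0} else {..<q})) = (\<Prod>x\<in>W. if x \<in> S then 1 else q)"
    using W by (simp add: card_PiE if_distrib cong: if_cong)
  also have "\<dots> = q ^ card (W - S)"
    using W by (simp add: prod.If_cases Diff_eq)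
  finally have "real q ^ card S * (\<Sum>\<kappa>\<in>(W \<rightarrow>\<^sub>E {..<q}). of_bool (\<forall>x\<in>S. \<kappa> x = 0)) = real q ^ (card S + card (W - S))"
    by (simp add: power_add)
  also have "card S + card (W - S) = card W"
    using W by (metis card_Diff_subset card_mono finite_subset le_add_diff_inverse)
  finally show ?thesis using W by (simp add: card_PiE)
qed

lemma sum_square_orthogonal:
  fixes c :: "'p \<Rightarrow> real" and \<zeta> :: "'p \<Rightarrow> 'w \<Rightarrow> real"
  assumes P: "finite P"
    and orth: "\<And>p p'. p \<in> P \<Longrightarrow> p' \<in> P \<Longrightarrow> p \<noteq> p' \<Longrightarrow> (\<Sum>\<kappa>\<in>\<Omega>. \<zeta> p \<kappa> * \<zeta> p' \<kappa>) = 0"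
    and diag: "\<And>p. p \<in> P \<Longrightarrow> (\<Sum>\<kappa>\<in>\<Omega>. (\<zeta> p \<kappa>)\<^sup>2) \<le> D"
    and c: "\<And>p. p \<in> P \<Longrightarrow> \<bar>c p\<bar> \<le> 1"
  shows "(\<Sum>\<kappa>\<in>\<Omega>. (\<Sum>p\<in>P. c p * \<zeta> p \<kappa>)\<^sup>2) \<le> real (card P) * D"
proof -
  have "(\<Sum>\<kappa>\<in>\<Omega>. (\<Sum>p\<in>P. c p * \<zeta> p \<kappa>)\<^sup>2) = (\<Sum>\<kappa>\<in>\<Omega>. \<Sum>p\<in>P. \<Sum>p'\<in>P. c p * c p' * (\<zeta> p \<kappa> * \<zeta> p' \<kappa>))"
    by (simp add: power2_eq_square sum_product mult_ac)
  also have "\<dots> = (\<Sum>p\<in>P. \<Sum>p'\<in>P. c p * c p' * (\<Sum>\<kappa>\<in>\<Omega>. \<zeta> p \<kappa> * \<zeta> p' \<kappa>))"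
    by (subst sum.swap, intro sum.cong refl, subst sum.swap) (simp add: sum_distrib_left)
  also have "\<dots> = (\<Sum>p\<in>P. \<Sum>p'\<in>P. if p = p' then (c p)\<^sup>2 * (\<Sum>\<kappa>\<in>\<Omega>. (\<zeta> p \<kappa>)\<^sup>2) else 0)"
    by (intro sum.cong refl) (auto simp: orth power2_eq_square)
  also have "\<dots> = (\<Sum>p\<in>P. (c p)\<^sup>2 * (\<Sum>\<kappa>\<in>\<Omega>. (\<zeta> p \<kappa>)\<^sup>2))"
    using P by simp
  also have "\<dots> \<le> (\<Sum>p\<in>P. 1 * D)"
  proof (intro sum_mono mult_mono diag)
    fix p assume "p \<in> P"
    then show "(c p)\<^sup>2 \<le> 1" using c[of p] by (simp add: abs_square_le_1)
  qed (auto intro: sum_nonneg)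
  finally show ?thesis by simp
qed

text \<open>A uniform colouring with \<open>q\<close> colours selects the points of colour \<open>0\<close>. For distinct primes exceeding all
  shifts the sets of points involved are disjoint, so the errors of different primes are uncorrelated.\<close>
lemma sampling_variance:
  fixes b :: "'i \<Rightarrow> int" and f :: "int \<Rightarrow> real" and W :: "int set"
  assumes I: "finite I" "inj_on b I"
    and b: "\<And>i. i \<in> I \<Longrightarrow> b i \<noteq> 0 \<and> \<bar>b i\<bar> < int K \<and> e i > 0"
    and P: "finite P" "\<And>p. p \<in> P \<Longrightarrow> prime p \<and> K \<le> p"
    and W: "finite W" "\<And>p i. p \<in> P \<Longrightarrow> i \<in> I \<Longrightarrow> z + int p * b i \<in> W"
    and q: "q \<ge> 1" and f: "\<And>x. \<bar>f x\<bar> \<le> 1"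
  defines "\<Omega> \<equiv> (W \<rightarrow>\<^sub>E {..<q})"
  shows "(\<Sum>\<kappa>\<in>\<Omega>. (dilate_sum P I b e f z - real q ^ card I * dilate_sum P I b e (\<lambda>x. if x \<in> {y\<in>W. \<kappa> y = 0} then f x else 0) z)\<^sup>2)
    \<le> real (card \<Omega>) * real q ^ card I * real (card {p\<in>P. int p dvd z}) / (recip_sum P)\<^sup>2"
proof -
  define k where "k = card I"
  define Pz where "Pz = {p\<in>P. int p dvd z}"
  define S where "S p = (\<lambda>i. z + int p * b i) ` I" for p
  \<comment> \<open>\<open>\<zeta> p\<close> is the centred error of the prime \<open>p\<close>: the
    indicator that all its points are sampled, scaled to mean one, minus one. The sign of
    \<open>c p\<close> makes the total error a sum of the \<open>c p * \<zeta> p\<close>.\<close>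
  define c where "c p = - (\<Prod>i\<in>I. f (z + int p * b i) ^ e i)" for p
  define \<zeta> where "\<zeta> p \<kappa> = real q ^ k * of_bool (\<forall>x\<in>S p. \<kappa> x = 0) - 1" for p and \<kappa> :: "int \<Rightarrow> nat"
  have fin\<Omega>: "finite \<Omega>" unfolding \<Omega>_def using W by (intro finite_PiE) auto
  have finPz: "finite Pz" using P by (simp add: Pz_def)
  have SW: "S p \<subseteq> W" if "p \<in> P" for p using W that by (auto simp: S_def)
  have cardS: "card (S p) = k" if "p \<in> P" for p
  proof -
    have "p \<noteq> 0" using P(2)[OF that] prime_gt_0_nat[of p] by auto
    then have "inj_on (\<lambda>i. z + int p * b i) I" using I(2) by (auto simp: inj_on_def)
    then show ?thesis by (simp add: S_def k_def card_image)
  qed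
  \<comment> \<open>A common point gives \<open>p * b i = p' * b j\<close>, so \<open>p'\<close>
    divides \<open>b i\<close>, although \<open>0 < \<bar>b i\<bar> < K \<le> p'\<close>.\<close>
  have disj: "S p \<inter> S p' = {}" if pp: "p \<in> P" "p' \<in> P" "p \<noteq> p'" for p p'
  proof (rule ccontr)
    assume "S p \<inter> S p' \<noteq> {}"
    then obtain i j where ij: "i \<in> I" "j \<in> I" "int p * b i = int p' * b j" by (auto simp: S_def)
    have "coprime (int p) (int p')" using pp P(2) by (simp add: primes_coprime)
    then have "int p' dvd b i" using ij(3) by (metis coprime_commute coprime_dvd_mult_right_iff dvd_triv_left)
    then have "int p' \<le> \<bar>b i\<bar>" using b[OF ij(1)] dvd_imp_le_int[of "b i" "int p'"] by simp
    then show False using b[OF ij(1)] P(2)[OF pp(2)] by simp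
  qed
  have cnt: "real q ^ card T * (\<Sum>\<kappa>\<in>\<Omega>. of_bool (\<forall>x\<in>T. \<kappa> x = 0)) = real (card \<Omega>)" if "T \<subseteq> W" for T
    unfolding \<Omega>_def by (rule sum_colourings_vanishing[OF W(1) that q])
  have mean: "(\<Sum>\<kappa>\<in>\<Omega>. real q ^ k * of_bool (\<forall>x\<in>S p. \<kappa> x = 0)) = real (card \<Omega>)" if "p \<in> P" for p
    using cnt[OF SW[OF that]] cardS[OF that] by (simp add: sum_distrib_left)
  have orth: "(\<Sum>\<kappa>\<in>\<Omega>. \<zeta> p \<kappa> * \<zeta> p' \<kappa>) = 0" if pp: "p \<in> Pz" "p' \<in> Pz" "p \<noteq> p'" for p p'
  proof -
    have PP: "p \<in> P" "p' \<in> P" using pp by (auto simp: Pz_def)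
    have "card (S p \<union> S p') = k + k"
      using card_Un_disjoint[OF _ _ disj[OF PP pp(3)]] cardS PP I by (simp add: S_def)
    then have joint: "(\<Sum>\<kappa>\<in>\<Omega>. (real q ^ k * of_bool (\<forall>x\<in>S p. \<kappa> x = 0)) * (real q ^ k * of_bool (\<forall>x\<in>S p'. \<kappa> x = 0))) = real (card \<Omega>)"
      using cnt[of "S p \<union> S p'"] SW PP
      by (simp add: sum_distrib_left power_add ball_Un of_bool_conj mult_ac)
    have "\<zeta> p \<kappa> * \<zeta> p' \<kappa> = (real q ^ k * of_bool (\<forall>x\<in>S p. \<kappa> x = 0)) * (real q ^ k * of_bool (\<forall>x\<in>S p'. \<kappa> x = 0))
       - real q ^ k * of_bool (\<forall>x\<in>S p. \<kappa> x = 0) - real q ^ k * of_bool (\<forall>x\<in>S p'. \<kappa> x = 0) + 1" for \<kappa>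
      by (simp add: \<zeta>_def algebra_simps)
    then show ?thesis
      by (simp only: sum.distrib sum_subtractf joint mean[OF PP(1)] mean[OF PP(2)]) simp
  qed
  have diag: "(\<Sum>\<kappa>\<in>\<Omega>. (\<zeta> p \<kappa>)\<^sup>2) \<le> real (card \<Omega>) * real q ^ k" if p: "p \<in> Pz" for p
  proof -
    have pP: "p \<in> P" using p by (simp add: Pz_def)
    have "(\<zeta> p \<kappa>)\<^sup>2 = (real q ^ k - 2) * (real q ^ k * of_bool (\<forall>x\<in>S p. \<kappa> x = 0)) + 1" for \<kappa>
      by (simp add: \<zeta>_def power2_eq_square algebra_simps of_bool_def)
    then have "(\<Sum>\<kappa>\<in>\<Omega>. (\<zeta> p \<kappa>)\<^sup>2) = (real q ^ k - 2) * real (card \<Omega>) + real (card \<Omega>)"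
      using mean[OF pP] by (simp add: sum.distrib sum_distrib_left [symmetric])
    then show ?thesis by (simp add: algebra_simps)
  qed
  have c1: "\<bar>c p\<bar> \<le> 1" for p
    unfolding c_def abs_minus_cancel by (intro abs_prod_le_1 abs_power_le_1 f)
  have diff: "dilate_sum P I b e f z - real q ^ k * dilate_sum P I b e (\<lambda>x. if x \<in> {y\<in>W. \<kappa> y = 0} then f x else 0) z
      = (\<Sum>p\<in>Pz. c p * \<zeta> p \<kappa>) / recip_sum P" for \<kappa>
  proof -
    have prod: "(\<Prod>i\<in>I. (if z + int p * b i \<in> {y\<in>W. \<kappa> y = 0} then f (z + int p * b i) else 0) ^ e i)
        = - c p * of_bool (\<forall>x\<in>S p. \<kappa> x = 0)" if p: "p \<in> P" for p
    proof (cases "\<forall>x\<in>S p. \<kappa> x = 0")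
      case True
      then show ?thesis using SW[OF p] by (auto simp: c_def S_def intro!: prod.cong)
    next
      \<comment> \<open>Positive exponents matter here: with \<open>e i = 0\<close> a missing point
        would contribute \<open>0 ^ 0 = 1\<close>.\<close>
      case False
      then obtain i where "i \<in> I" "\<kappa> (z + int p * b i) \<noteq> 0" by (auto simp: S_def)
      then show ?thesis using False I b[of i] by (auto intro!: prod_zero bexI[of _ i])
    qed
    have "dilate_sum P I b e g z = (\<Sum>p\<in>Pz. \<Prod>i\<in>I. g (z + int p * b i) ^ e i) / recip_sum P" for g
      using P by (simp add: dilate_sum_def Pz_def sum.inter_filter)
    moreover have "(\<Sum>p\<in>Pz. \<Prod>i\<in>I. (if z + int p * b i \<in> {y\<in>W. \<kappa> y = 0} then f (z + int p * b i) else 0) ^ e i)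
        = (\<Sum>p\<in>Pz. - c p * of_bool (\<forall>x\<in>S p. \<kappa> x = 0))"
      by (intro sum.cong refl prod) (simp add: Pz_def)
    moreover have "(\<Sum>p\<in>Pz. \<Prod>i\<in>I. f (z + int p * b i) ^ e i) = (\<Sum>p\<in>Pz. - c p)"
      by (simp add: c_def)
    ultimately have "dilate_sum P I b e f z - real q ^ k * dilate_sum P I b e (\<lambda>x. if x \<in> {y\<in>W. \<kappa> y = 0} then f x else 0) z
        = ((\<Sum>p\<in>Pz. - c p) - real q ^ k * (\<Sum>p\<in>Pz. - c p * of_bool (\<forall>x\<in>S p. \<kappa> x = 0))) / recip_sum P"
      by (simp add: diff_divide_distrib)
    also have "(\<Sum>p\<in>Pz. - c p) - real q ^ k * (\<Sum>p\<in>Pz. - c p * of_bool (\<forall>x\<in>S p. \<kappa> x = 0)) = (\<Sum>p\<in>Pz. c p * \<zeta> p \<kappa>)"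
      unfolding sum_distrib_left sum_subtractf [symmetric] by (intro sum.cong refl) (simp add: \<zeta>_def algebra_simps)
    finally show ?thesis .
  qed
  have "(\<Sum>\<kappa>\<in>\<Omega>. (dilate_sum P I b e f z - real q ^ k * dilate_sum P I b e (\<lambda>x. if x \<in> {y\<in>W. \<kappa> y = 0} then f x else 0) z)\<^sup>2)
     = (\<Sum>\<kappa>\<in>\<Omega>. (\<Sum>p\<in>Pz. c p * \<zeta> p \<kappa>)\<^sup>2) / (recip_sum P)\<^sup>2"
    by (simp only: diff power_divide sum_divide_distrib [symmetric])
  also have "\<dots> \<le> real (card Pz) * (real (card \<Omega>) * real q ^ k) / (recip_sum P)\<^sup>2"
    using sum_square_orthogonal[OF finPz orth diag c1] by (intro divide_right_mono) auto
  finally show ?thesis by (simp add: k_def Pz_def mult_ac)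
qed

text \<open>The extra \<open>card P\<close> pays for \<open>h = 0\<close>, which every prime
  divides.\<close>

lemma sum_card_divisors_le:
  assumes P: "finite P" "\<And>p. p \<in> P \<Longrightarrow> prime p"
  shows "(\<Sum>h<H. real (card {p\<in>P. int p dvd int h})) \<le> real H * recip_sum P + real (card P)"
proof -
  have "(\<Sum>h<H. real (card {p\<in>P. int p dvd int h})) = (\<Sum>h<H. \<Sum>p\<in>P. of_bool (p dvd h))"
    using P by (simp add: of_bool_def sum.If_cases Int_def)
  also have "\<dots> = (\<Sum>p\<in>P. real (card {h\<in>{..<H}. p dvd h}))"
    by (subst sum.swap) (simp add: of_bool_def sum.If_cases Int_def)
  also have "\<dots> \<le> (\<Sum>p\<in>P. real H * (1 / real p) + 1)"
  proof (rule sum_mono)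
    fix p assume "p \<in> P"
    then have p: "p > 0" using P(2) prime_gt_0_nat by blast
    have "card {h\<in>{..<H}. p dvd h} \<le> card (insert 0 {n\<in>{1..H}. p dvd n})"
      by (rule card_mono) auto
    also have "\<dots> \<le> card {n\<in>{1..H}. p dvd n} + 1" by (simp add: card_insert_if)
    finally have "real (card {h\<in>{..<H}. p dvd h}) \<le> real (card {n\<in>{1..H}. p dvd n}) + 1" by linarith
    then show "real (card {h\<in>{..<H}. p dvd h}) \<le> real H * (1 / real p) + 1"
      using card_multiples_le[OF p, of H] by simp
  qed
  also have "\<dots> = real H * recip_sum P + real (card P)"
    by (simp only: sum.distrib recip_sum_def sum_distrib_left) simp
  finally show ?thesis .
qed

text \<open>First moment method for two requirements at once. Squared error and number of sampled
  points are each divided by their mean, or a bound for it; the two quotients together average to at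
  most 2, so some colouring keeps each of them at most 2. Cauchy-Schwarz then passes from squares to
  absolute values.\<close>

lemma sampling:
  fixes b :: "'i \<Rightarrow> int" and f :: "int \<Rightarrow> real" and W :: "int set"
  assumes I: "finite I" "inj_on b I"
    and b: "\<And>i. i \<in> I \<Longrightarrow> b i \<noteq> 0 \<and> \<bar>b i\<bar> < int K \<and> e i > 0"
    and P: "finite P" "\<And>p. p \<in> P \<Longrightarrow> prime p \<and> K \<le> p" and R: "recip_sum P \<ge> 1"
    and H: "card P \<le> H"
    and W: "finite W" "W \<noteq> {}" "\<And>p i h. p \<in> P \<Longrightarrow> i \<in> I \<Longrightarrow> h < H \<Longrightarrow> int h + int p * b i \<in> W"
    and q: "q \<ge> 1" and f: "\<And>x. \<bar>f x\<bar> \<le> 1"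
  obtains R where "R \<subseteq> W" "real (card R) \<le> 2 * real (card W) / real q"
    "(\<Sum>h<H. \<bar>dilate_sum P I b e f (int h) - real q ^ card I * dilate_sum P I b e (\<lambda>x. if x \<in> R then f x else 0) (int h)\<bar>)
       \<le> sqrt (4 * real q ^ card I / recip_sum P) * real H"
proof -
  define \<Omega> where "\<Omega> = (W \<rightarrow>\<^sub>E {..<q})"
  define k where "k = card I"
  define Z where "Z \<kappa> = {y\<in>W. \<kappa> y = 0}" for \<kappa> :: "int \<Rightarrow> nat"
  define d where "d \<kappa> h = dilate_sum P I b e f (int h) - real q ^ k * dilate_sum P I b e (\<lambda>x. if x \<in> Z \<kappa> then f x else 0) (int h)" for \<kappa> h
  define a where "a \<kappa> = (\<Sum>h<H. (d \<kappa> h)\<^sup>2)" for \<kappa>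
  have P0: "P \<noteq> {}" using R by (auto simp: recip_sum_def)
  then have H0: "H > 0" using H P(1) card_gt_0_iff[of P] by linarith
  define Abar where "Abar = 2 * real q ^ k * real H / recip_sum P"
  define Rbar where "Rbar = real (card W) / real q"
  have pos: "Abar > 0" "Rbar > 0" using R q H0 W by (auto simp: Abar_def Rbar_def card_gt_0_iff)
  have fin\<Omega>: "finite \<Omega>" unfolding \<Omega>_def using W by (intro finite_PiE) auto
  have ne: "\<Omega> \<noteq> {}" using q by (auto simp: \<Omega>_def PiE_eq_empty_iff lessThan_empty_iff)
  have "(\<Sum>\<kappa>\<in>\<Omega>. a \<kappa>) = (\<Sum>h<H. \<Sum>\<kappa>\<in>\<Omega>. (d \<kappa> h)\<^sup>2)" unfolding a_def by (rule sum.swap)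
  also have "\<dots> \<le> (\<Sum>h<H. real (card \<Omega>) * real q ^ k / (recip_sum P)\<^sup>2 * real (card {p\<in>P. int p dvd int h}))"
  proof (rule sum_mono)
    fix h assume "h \<in> {..<H}"
    then have "\<And>p i. p \<in> P \<Longrightarrow> i \<in> I \<Longrightarrow> int h + int p * b i \<in> W" using W(3) by auto
    from sampling_variance[OF I b P W(1) this q f]
    show "(\<Sum>\<kappa>\<in>\<Omega>. (d \<kappa> h)\<^sup>2) \<le> real (card \<Omega>) * real q ^ k / (recip_sum P)\<^sup>2 * real (card {p\<in>P. int p dvd int h})"
      by (simp add: d_def Z_def k_def \<Omega>_def)
  qed
  also have "\<dots> \<le> real (card \<Omega>) * real q ^ k / (recip_sum P)\<^sup>2 * (real H * recip_sum P + real (card P))"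
    unfolding sum_distrib_left [symmetric] using P by (intro mult_left_mono sum_card_divisors_le) auto
  also have "\<dots> \<le> real (card \<Omega>) * real q ^ k / (recip_sum P)\<^sup>2 * (real H * recip_sum P + real H * recip_sum P)"
  proof (intro mult_left_mono add_left_mono)
    have "real (card P) \<le> real H * 1" using H by simp
    also have "\<dots> \<le> real H * recip_sum P" using R by (intro mult_left_mono) auto
    finally show "real (card P) \<le> real H * recip_sum P" .
  qed auto
  also have "\<dots> = real (card \<Omega>) * Abar"
    using R by (simp add: Abar_def power2_eq_square field_simps)
  finally have suma: "(\<Sum>\<kappa>\<in>\<Omega>. a \<kappa> / Abar) \<le> real (card \<Omega>)"
    using pos by (simp add: sum_divide_distrib [symmetric] pos_divide_le_eq)
  have "(\<Sum>\<kappa>\<in>\<Omega>. real (card (Z \<kappa>))) = (\<Sum>\<kappa>\<in>\<Omega>. \<Sum>x\<in>W. of_bool (\<kappa> x = 0))"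
    using W by (simp add: Z_def of_bool_def sum.If_cases Int_def)
  also have "\<dots> = (\<Sum>x\<in>W. \<Sum>\<kappa>\<in>\<Omega>. of_bool (\<kappa> x = 0))" by (rule sum.swap)
  also have "\<dots> = (\<Sum>x\<in>W. real (card \<Omega>) / real q)"
  proof (rule sum.cong[OF refl])
    fix x assume "x \<in> W"
    then show "(\<Sum>\<kappa>\<in>\<Omega>. of_bool (\<kappa> x = 0)) = real (card \<Omega>) / real q"
      using sum_colourings_vanishing[OF W(1), of "{x}" q] q by (simp add: \<Omega>_def field_simps)
  qed
  also have "\<dots> = real (card \<Omega>) * Rbar" by (simp add: Rbar_def)
  finally have sumr: "(\<Sum>\<kappa>\<in>\<Omega>. real (card (Z \<kappa>)) / Rbar) = real (card \<Omega>)"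
    using pos by (simp add: sum_divide_distrib [symmetric])
  have "\<exists>\<kappa>\<in>\<Omega>. a \<kappa> / Abar + real (card (Z \<kappa>)) / Rbar \<le> 2"
  proof (rule ccontr)
    assume "\<not> ?thesis"
    then have "(\<Sum>\<kappa>\<in>\<Omega>. 2) < (\<Sum>\<kappa>\<in>\<Omega>. a \<kappa> / Abar + real (card (Z \<kappa>)) / Rbar)"
      using fin\<Omega> ne by (intro sum_strict_mono) (auto simp: not_le)
    then show False using suma sumr by (simp add: sum.distrib)
  qed
  then obtain \<kappa> where \<kappa>: "\<kappa> \<in> \<Omega>" "a \<kappa> / Abar + real (card (Z \<kappa>)) / Rbar \<le> 2" by blast
  have an: "a \<kappa> \<ge> 0" unfolding a_def by (intro sum_nonneg) auto
  have "0 \<le> a \<kappa> / Abar" "0 \<le> real (card (Z \<kappa>)) / Rbar" using an pos by auto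
  then have "a \<kappa> / Abar \<le> 2" "real (card (Z \<kappa>)) / Rbar \<le> 2" using \<kappa>(2) by linarith+
  then have a2: "a \<kappa> \<le> 2 * Abar" and r2: "real (card (Z \<kappa>)) \<le> 2 * Rbar"
    using pos by (auto simp: pos_divide_le_eq)
  show ?thesis
  proof (rule that[of "Z \<kappa>"])
    show "Z \<kappa> \<subseteq> W" by (auto simp: Z_def)
    show "real (card (Z \<kappa>)) \<le> 2 * real (card W) / real q" using r2 by (simp add: Rbar_def)
    have "(\<Sum>h<H. \<bar>d \<kappa> h\<bar> * 1)\<^sup>2 \<le> (\<Sum>h<H. \<bar>d \<kappa> h\<bar>\<^sup>2) * (\<Sum>h<H. 1\<^sup>2)"
      by (rule Cauchy_Schwarz_ineq_sum)
    then have "(\<Sum>h<H. \<bar>d \<kappa> h\<bar>)\<^sup>2 \<le> a \<kappa> * real H" by (simp add: a_def)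
    also have "\<dots> \<le> 2 * Abar * real H" using a2 by (intro mult_right_mono) auto
    also have "\<dots> = (4 * real q ^ k / recip_sum P) * (real H)\<^sup>2" by (simp add: Abar_def power2_eq_square)
    finally have "(\<Sum>h<H. \<bar>d \<kappa> h\<bar>) \<le> sqrt ((4 * real q ^ k / recip_sum P) * (real H)\<^sup>2)"
      by (rule real_le_rsqrt)
    also have "\<dots> = sqrt (4 * real q ^ k / recip_sum P) * real H"
      by (subst real_sqrt_mult) simp
    finally show "(\<Sum>h<H. \<bar>dilate_sum P I b e f (int h) - real q ^ card I * dilate_sum P I b e (\<lambda>x. if x \<in> Z \<kappa> then f x else 0) (int h)\<bar>)
       \<le> sqrt (4 * real q ^ card I / recip_sum P) * real H"
      by (simp add: d_def k_def)
  qed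
qed

text \<open>A Chernoff type count. Each function is weighted with \<open>t = 1 / q\<close> per
  nonzero value; the total weight factors into \<open>(1 + 2 * t) ^ card W\<close>, while members of
  \<open>B\<close> weigh at least \<open>t powr s\<close>.\<close>

lemma card_sparse_functions_le:
  fixes W :: "'a set" and q :: nat and s :: real
  assumes W: "finite W" and q: "q \<ge> 1"
  defines "B \<equiv> {u \<in> (W \<rightarrow>\<^sub>E {-1, 0, 1 :: real}). real (card {x\<in>W. u x \<noteq> 0}) \<le> s}"
  shows "finite B" "real (card B) \<le> exp (s * ln (real q) + 2 * real (card W) / real q)"
proof -
  have finE: "finite (W \<rightarrow>\<^sub>E {-1, 0, 1 :: real})" using W by (intro finite_PiE) auto
  then show finB: "finite B" unfolding B_def by simp
  define t where "t = 1 / real q"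
  have t: "t > 0" "t \<le> 1" using q by (auto simp: t_def)
  have "real (card B) * (t powr s) = (\<Sum>u\<in>B. t powr s)" by simp
  also have "\<dots> \<le> (\<Sum>u\<in>B. \<Prod>x\<in>W. if u x = 0 then 1 else t)"
  proof (rule sum_mono)
    fix u assume u: "u \<in> B"
    have "t powr s \<le> t powr real (card {x\<in>W. u x \<noteq> 0})"
      using u t by (intro powr_mono') (auto simp: B_def)
    also have "\<dots> = t ^ card {x\<in>W. u x \<noteq> 0}" using t by (simp add: powr_realpow)
    also have "\<dots> = (\<Prod>x\<in>W. if u x = 0 then 1 else t)"
      using W by (simp add: prod.If_cases Int_def Compl_eq)
    finally show "t powr s \<le> (\<Prod>x\<in>W. if u x = 0 then 1 else t)" .
  qed
  also have "\<dots> \<le> (\<Sum>u\<in>(W \<rightarrow>\<^sub>E {-1, 0, 1 :: real}). \<Prod>x\<in>W. if u x = 0 then 1 else t)"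
    using t finE by (intro sum_mono2) (auto simp: B_def intro!: prod_nonneg)
  also have "\<dots> = (\<Prod>x\<in>W. \<Sum>y\<in>{-1, 0, 1 :: real}. if y = 0 then 1 else t)"
    using W by (subst prod_sum_PiE) auto
  also have "\<dots> = (1 + 2 * t) ^ card W" by (simp add: add.commute)
  also have "\<dots> \<le> exp (2 * t) ^ card W"
    using t exp_ge_add_one_self[of "2 * t"] by (intro power_mono) auto
  also have "\<dots> = exp (2 * real (card W) / real q)"
    by (simp add: t_def exp_of_nat_mult [symmetric])
  finally have "real (card B) \<le> exp (2 * real (card W) / real q) / t powr s"
    using t by (simp add: pos_le_divide_eq)
  also have "t powr s = exp (- (s * ln (real q)))"
    using q by (simp add: t_def powr_def ln_div)
  also have "exp (2 * real (card W) / real q) / exp (- (s * ln (real q))) = exp (s * ln (real q) + 2 * real (card W) / real q)"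
    by (simp add: exp_diff [symmetric] add.commute)
  finally show "real (card B) \<le> exp (s * ln (real q) + 2 * real (card W) / real q)" .
qed

section \<open>A Cauchy sequence of structured correlates\<close>

text \<open>A block is described by a sparse function on a window around it. First \<open>q\<close>
  is chosen so that there are few such functions, then \<open>M\<close> so that the sampling error
  \<open>sqrt (4 * q ^ card I / recip_sum P)\<close> is at most \<open>\<delta>\<close>.\<close>

lemma block_cov_dilated_corr:
  assumes A: "finite A" "s0 \<in> A" "\<And>s. s \<in> A \<Longrightarrow> e s > 0" and \<delta>: "\<delta> > 0"
  shows "\<exists>M. \<forall>P. finite P \<and> (\<forall>p\<in>P. prime p \<and> Max A < p) \<and> M \<le> recip_sum P \<longrightarrow> block_cov \<delta> (dilated_corr P A s0 e)"
proof -
  define I where "I = A - {s0}"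
  define b where "b s = int s - int s0" for s
  define K where "K = Suc (Max A)"
  have I: "finite I" "inj_on b I" using A by (auto simp: I_def b_def inj_on_def)
  have b: "b i \<noteq> 0 \<and> \<bar>b i\<bar> < int K \<and> e i > 0" if "i \<in> I" for i
  proof -
    have "i \<le> Max A" "s0 \<le> Max A" using that A Max_ge[OF A(1)] by (auto simp: I_def simp del: Max_ge_iff)
    then have "\<bar>int i - int s0\<bar> < int K" unfolding K_def by linarith
    then show ?thesis using that A by (auto simp: I_def b_def)
  qed
  have "((\<lambda>n. ln (real n) / real n + 1 / real n) \<longlongrightarrow> 0 + 0) sequentially"
    by (intro tendsto_add lim_ln_over_n lim_1_over_n)
  then have "eventually (\<lambda>n. ln (real n) / real n + 1 / real n < \<delta> / 4) sequentially"
    using \<delta> by (intro order_tendstoD(2)) auto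
  then have "eventually (\<lambda>n. ln (real n) / real n + 1 / real n < \<delta> / 4 \<and> n \<ge> 1) sequentially"
    by (intro eventually_conj eventually_ge_at_top)
  then obtain q :: nat where q: "q \<ge> 1" "ln (real q) / real q + 1 / real q < \<delta> / 4"
    by (auto simp: eventually_sequentially)
  define M where "M = max 1 (4 * real q ^ card I / \<delta>\<^sup>2)"
  have "block_cov \<delta> (dilated_corr P A s0 e)" if P: "finite P" "\<And>p. p \<in> P \<Longrightarrow> prime p \<and> Max A < p" "M \<le> recip_sum P" for P
  proof -
    have R: "recip_sum P \<ge> 1" and R': "4 * real q ^ card I / recip_sum P \<le> \<delta>\<^sup>2"
      using P(3) \<delta> by (auto simp: M_def field_simps)
    have PK: "prime p \<and> K \<le> p" if "p \<in> P" for p using P(2)[OF that] by (auto simp: K_def)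
    have P0: "P \<noteq> {}" using R by (auto simp: recip_sum_def)
    \<comment> \<open>\<open>D\<close> bounds the displacements \<open>p * b i\<close>; a block with
      \<open>H \<ge> 2 * D\<close> has a window of length at most \<open>2 * H\<close>.\<close>
    define D where "D = Max P * K"
    define H0 where "H0 = 2 * D + card P + 1"
    have Q0: "\<Prod>P > 0" using P(1) PK prime_gt_0_nat by (intro prod_pos) auto
    show ?thesis unfolding block_cov_def
    proof (rule exI[of _ "\<Prod>P"], intro conjI Q0 exI[of _ H0] allI impI)
      fix H assume H: "H0 \<le> H"
      define W where "W = {- int D..<int (H + D)}"
      have cardW: "real (card W) \<le> 2 * real H" using H by (simp add: W_def H0_def)
      have W: "finite W" "W \<noteq> {}" using H by (auto simp: W_def H0_def)
      have WI: "int h + int p * b i \<in> W" if "p \<in> P" "i \<in> I" "h < H" for p i h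
      proof -
        have "int p * \<bar>b i\<bar> \<le> int (Max P) * int K"
          using b[OF that(2)] Max_ge[OF P(1) that(1)] by (intro mult_mono) auto
        then have "\<bar>int p * b i\<bar> \<le> int D" by (simp add: D_def abs_mult)
        then show ?thesis using that(3) by (auto simp: W_def)
      qed
      define s where "s = 2 * real (card W) / real q"
      define B where "B = {u \<in> W \<rightarrow>\<^sub>E {-1, 0, 1 :: real}. real (card {x\<in>W. u x \<noteq> 0}) \<le> s}"
      \<comment> \<open>The word decoded from a sparse function; it does not refer to the position
        \<open>n\<close> of the block.\<close>
      define g where "g u = (\<lambda>h::nat. real q ^ card I * dilate_sum P I b e (\<lambda>x. if x \<in> W then u x else 0) (int h))" for u
      have finB: "finite B" and cardB: "real (card B) \<le> exp (s * ln (real q) + 2 * real (card W) / real q)"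
        unfolding B_def using card_sparse_functions_le[OF W(1) q(1), of s] by auto
      show "word_cover \<delta> (dilated_corr P A s0 e) (\<Prod>P) H"
      proof (intro exI[of _ "g ` B"] conjI allI impI)
        show "finite (g ` B)" using finB by simp
        have "s * ln (real q) + 2 * real (card W) / real q = 2 * real (card W) * (ln (real q) / real q + 1 / real q)"
          by (simp add: s_def distrib_left)
        also have "\<dots> \<le> 2 * (2 * real H) * (\<delta> / 4)"
          using q cardW by (intro mult_mono) auto
        also have "\<dots> = \<delta> * real H" by simp
        finally have "s * ln (real q) + 2 * real (card W) / real q \<le> \<delta> * real H" .
        then have "exp (s * ln (real q) + 2 * real (card W) / real q) \<le> exp (\<delta> * real H)" by simp
        moreover have "real (card (g ` B)) \<le> real (card B)" using finB card_image_le by simp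
        ultimately show "real (card (g ` B)) \<le> exp (\<delta> * real H)" using cardB by linarith
      next
        fix n assume n: "\<Prod>P dvd n"
        define f where "f z = moebius (nat (z + int n))" for z
        have f1: "\<bar>f x\<bar> \<le> 1" for x by (simp add: f_def abs_moebius_le_1)
        have cH: "card P \<le> H" using H by (simp add: H0_def)
        \<comment> \<open>Every \<open>p\<close> in \<open>P\<close> divides \<open>n\<close>, so
          the divisibility conditions along the block are the same for all admissible
          \<open>n\<close> and need not be encoded.\<close>
        have dvd: "int p dvd int (n + h) \<longleftrightarrow> int p dvd int h" if "p \<in> P" for p h
        proof -
          have "p dvd n" using n that P(1) by (meson dvd_prod_eqI dvd_trans dvd_prodI)
          then show ?thesis by (simp add: dvd_add_right_iff)
        qed
        have arg: "nat (int n + int h + int p * b i) = nat (int h + int p * b i + int n)" for p h i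
          by (simp add: algebra_simps)
        have shift: "dilated_corr P A s0 e (n + h) = dilate_sum P I b e f (int h)" for h
          unfolding dilated_corr_def dilate_sum_def I_def [symmetric] f_def b_def [symmetric]
          by (intro arg_cong2[where f = "(/)"] sum.cong refl) (simp only: dvd of_nat_add arg cong: if_cong, simp add: dvd [unfolded of_nat_add])
        obtain R where R: "R \<subseteq> W" "real (card R) \<le> 2 * real (card W) / real q"
          and le: "(\<Sum>h<H. \<bar>dilate_sum P I b e f (int h) - real q ^ card I * dilate_sum P I b e (\<lambda>x. if x \<in> R then f x else 0) (int h)\<bar>)
             \<le> sqrt (4 * real q ^ card I / recip_sum P) * real H"
          by (rule sampling[where f = f, OF I b P(1) PK R cH W WI q(1) f1]) (assumption | (rule that, assumption+))+
        define u where "u = restrict (\<lambda>x. if x \<in> R then f x else 0) W"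
        have "card {x\<in>W. u x \<noteq> 0} \<le> card R"
          using R W finite_subset by (intro card_mono) (auto simp: u_def)
        moreover have "f x \<in> {-1, 0, 1}" for x using moebius_values by (simp add: f_def)
        ultimately have "u \<in> B"
          using R(2) by (auto simp: B_def s_def u_def)
        moreover have "(\<lambda>x. if x \<in> W then u x else 0) = (\<lambda>x. if x \<in> R then f x else 0)"
          using R(1) by (auto simp: u_def fun_eq_iff)
        then have "(\<Sum>h<H. \<bar>dilated_corr P A s0 e (n + h) - g u h\<bar>) \<le> sqrt (4 * real q ^ card I / recip_sum P) * real H"
          using le by (simp add: shift g_def)
        moreover have "sqrt (4 * real q ^ card I / recip_sum P) * real H \<le> \<delta> * real H"
          using R' \<delta> by (intro mult_right_mono real_le_lsqrt) auto
        ultimately show "\<exists>w\<in>g ` B. (\<Sum>h<H. \<bar>dilated_corr P A s0 e (n + h) - w h\<bar>) \<le> \<delta> * real H"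
          by (meson image_eqI order_trans)
      qed
    qed
  qed
  then show ?thesis by (intro exI[of _ M]) auto
qed

section \<open>Stability of \<open>block_cov\<close> under linear combinations\<close>

lemma block_covE:
  assumes "block_cov \<delta> X"
  obtains Q H0 where "Q > 0"
    "\<And>H. H \<ge> H0 \<Longrightarrow> word_cover \<delta> X Q H"
  using assms unfolding block_cov_def by blast

lemma block_cov_mono:
  assumes X: "block_cov \<delta> X" and le: "\<delta> \<le> \<delta>'"
  shows "block_cov \<delta>' X"
proof -
  obtain Q H0 where Q: "Q > 0" and 1: "\<And>H. H \<ge> H0 \<Longrightarrow> word_cover \<delta> X Q H"
    using block_covE[OF X] by blast
  show ?thesis unfolding block_cov_def
  proof (rule exI[of _ Q], intro conjI Q exI[of _ H0] allI impI)
    fix H assume H: "H0 \<le> H"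
    have "\<delta> * real H \<le> \<delta>' * real H" using le by (intro mult_right_mono) auto
    then show "word_cover \<delta>' X Q H"
      using 1[OF H] by (meson exp_le_cancel_iff order_trans)
  qed
qed

lemma block_cov_zero: "block_cov 0 (\<lambda>n. 0)"
  unfolding block_cov_def by (intro exI[of _ 1] conjI exI[of _ 0] allI impI exI[of _ "{\<lambda>h. 0}"]) auto

lemma block_cov_cmult:
  assumes "block_cov \<delta> X" "\<bar>c\<bar> \<le> 1"
  shows "block_cov \<delta> (\<lambda>n. c * X n)"
proof -
  obtain Q H0 where Q: "Q > 0" and 1: "\<And>H. H \<ge> H0 \<Longrightarrow> word_cover \<delta> X Q H"
    using block_covE[OF assms(1)] by blast
  show ?thesis unfolding block_cov_def
  proof (rule exI[of _ Q], intro conjI Q exI[of _ H0] allI impI)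
    fix H assume "H0 \<le> H"
    from 1[OF this] obtain V where V: "finite V" "real (card V) \<le> exp (\<delta> * real H)"
      "\<And>n. Q dvd n \<Longrightarrow> \<exists>w\<in>V. (\<Sum>h<H. \<bar>X (n + h) - w h\<bar>) \<le> \<delta> * real H" by blast
    show "word_cover \<delta> (\<lambda>n. c * X n) Q H"
    proof (intro exI[of _ "(\<lambda>w h. c * w h) ` V"] conjI allI impI)
      show "real (card ((\<lambda>w h. c * w h) ` V)) \<le> exp (\<delta> * real H)"
        using V(2) card_image_le[OF V(1), of "\<lambda>w h. c * w h"] by linarith
      fix n assume "Q dvd n"
      from V(3)[OF this] obtain w where w: "w \<in> V" "(\<Sum>h<H. \<bar>X (n + h) - w h\<bar>) \<le> \<delta> * real H" by blast
      have "(\<Sum>h<H. \<bar>c * X (n + h) - c * w h\<bar>) = \<bar>c\<bar> * (\<Sum>h<H. \<bar>X (n + h) - w h\<bar>)"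
        by (simp add: sum_distrib_left abs_mult [symmetric] right_diff_distrib)
      also have "\<dots> \<le> 1 * (\<Sum>h<H. \<bar>X (n + h) - w h\<bar>)"
        using assms(2) by (intro mult_right_mono sum_nonneg) auto
      finally have "(\<Sum>h<H. \<bar>c * X (n + h) - c * w h\<bar>) \<le> \<delta> * real H" using w by simp
      then show "\<exists>w\<in>(\<lambda>w h. c * w h) ` V. (\<Sum>h<H. \<bar>c * X (n + h) - w h\<bar>) \<le> \<delta> * real H"
        by (rule bexI[where x = "\<lambda>h. c * w h"]) (use w(1) in blast)
    qed (use V in auto)
  qed
qed

lemma block_cov_add:
  assumes "block_cov \<delta> X" "block_cov \<delta>' Y"
  shows "block_cov (\<delta> + \<delta>') (\<lambda>n. X n + Y n)"
proof -
  obtain Q H0 where Q: "Q > 0" and 1: "\<And>H. H \<ge> H0 \<Longrightarrow> word_cover \<delta> X Q H"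
    using block_covE[OF assms(1)] by blast
  obtain Q' H0' where Q': "Q' > 0" and 2: "\<And>H. H \<ge> H0' \<Longrightarrow> word_cover \<delta>' Y Q' H"
    using block_covE[OF assms(2)] by blast
  show ?thesis unfolding block_cov_def
  proof (rule exI[of _ "Q * Q'"], intro conjI exI[of _ "max H0 H0'"] allI impI)
    show "Q * Q' > 0" using Q Q' by simp
    fix H assume H: "max H0 H0' \<le> H"
    obtain V where V: "finite V" "real (card V) \<le> exp (\<delta> * real H)"
      "\<And>n. Q dvd n \<Longrightarrow> \<exists>w\<in>V. (\<Sum>h<H. \<bar>X (n + h) - w h\<bar>) \<le> \<delta> * real H" using 1[of H] H by auto
    obtain V' where V': "finite V'" "real (card V') \<le> exp (\<delta>' * real H)"
      "\<And>n. Q' dvd n \<Longrightarrow> \<exists>w\<in>V'. (\<Sum>h<H. \<bar>Y (n + h) - w h\<bar>) \<le> \<delta>' * real H" using 2[of H] H by auto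
    define g :: "(nat \<Rightarrow> real) \<times> (nat \<Rightarrow> real) \<Rightarrow> nat \<Rightarrow> real" where "g = (\<lambda>(w, w') h. w h + w' h)"
    show "word_cover (\<delta> + \<delta>') (\<lambda>n. X n + Y n) (Q * Q') H"
    proof (intro exI[of _ "g ` (V \<times> V')"] conjI allI impI)
      have "real (card (g ` (V \<times> V'))) \<le> real (card V) * real (card V')"
        using card_image_le[of "V \<times> V'" g] V(1) V'(1) by (simp add: card_cartesian_product flip: of_nat_mult)
      also have "\<dots> \<le> exp (\<delta> * real H) * exp (\<delta>' * real H)"
        using V(2) V'(2) by (intro mult_mono) auto
      finally show "real (card (g ` (V \<times> V'))) \<le> exp ((\<delta> + \<delta>') * real H)"
        by (simp add: exp_add [symmetric] distrib_right)
      fix n assume "Q * Q' dvd n"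
      then have "Q dvd n" "Q' dvd n" by (auto dest: dvd_mult_left dvd_mult_right)
      then obtain w w' where w: "w \<in> V" "(\<Sum>h<H. \<bar>X (n + h) - w h\<bar>) \<le> \<delta> * real H"
        "w' \<in> V'" "(\<Sum>h<H. \<bar>Y (n + h) - w' h\<bar>) \<le> \<delta>' * real H" using V(3) V'(3) by blast
      have "(\<Sum>h<H. \<bar>X (n + h) + Y (n + h) - g (w, w') h\<bar>) \<le> (\<Sum>h<H. \<bar>X (n + h) - w h\<bar> + \<bar>Y (n + h) - w' h\<bar>)"
        by (intro sum_mono) (simp add: g_def)
      also have "\<dots> \<le> (\<delta> + \<delta>') * real H" using w by (simp add: sum.distrib distrib_right)
      finally show "\<exists>w\<in>g ` (V \<times> V'). (\<Sum>h<H. \<bar>X (n + h) + Y (n + h) - w h\<bar>) \<le> (\<delta> + \<delta>') * real H"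
        using w by auto
    qed (use V V' in auto)
  qed
qed

lemma block_cov_sum:
  assumes "finite I" "\<And>i. i \<in> I \<Longrightarrow> block_cov (\<delta> i) (X i) \<and> \<bar>c i\<bar> \<le> 1"
  shows "block_cov (\<Sum>i\<in>I. \<delta> i) (\<lambda>n. \<Sum>i\<in>I. c i * X i n)"
  using assms by (induction I rule: finite_induct) (auto simp: block_cov_zero intro!: block_cov_add block_cov_cmult)

section \<open>Convex combinations of tails and the parallelogram law\<close>

definition conv_tail :: "(nat \<Rightarrow> nat \<Rightarrow> real) \<Rightarrow> nat \<Rightarrow> (nat \<Rightarrow> real) set" where
  "conv_tail F t = {X. \<exists>c m. (\<forall>i. 0 \<le> c i \<and> c i \<le> 1) \<and> (\<forall>i\<ge>m. c i = 0) \<and> (\<Sum>i\<in>{t..<m}. c i) = 1 \<and>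
      X = (\<lambda>n. \<Sum>i\<in>{t..<m}. c i * F i n)}"

lemma conv_tailE:
  assumes "X \<in> conv_tail F t"
  obtains w m where "\<And>i. 0 \<le> w i" "\<And>i. w i \<le> 1" "\<And>i. i \<ge> m \<Longrightarrow> w i = 0" "(\<Sum>i\<in>{t..<m}. w i) = 1"
    "X = (\<lambda>n. \<Sum>i\<in>{t..<m}. w i * F i n)"
  using assms unfolding conv_tail_def mem_Collect_eq by (elim exE conjE) metis

lemma conv_tail_base: "F t \<in> conv_tail F t"
  unfolding conv_tail_def
  by (rule CollectI, rule exI[of _ "\<lambda>i. if i = t then 1 else 0"], rule exI[of _ "Suc t"]) auto

lemma conv_tail_Suc: "conv_tail F (Suc t) \<subseteq> conv_tail F t"
proof
  fix X assume "X \<in> conv_tail F (Suc t)"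
  then obtain c m where c: "\<forall>i. 0 \<le> c i \<and> c i \<le> 1" "\<forall>i\<ge>m. c i = 0" "(\<Sum>i\<in>{Suc t..<m}. c i) = 1"
    "X = (\<lambda>n. \<Sum>i\<in>{Suc t..<m}. c i * F i n)" unfolding conv_tail_def by blast
  define c' where "c' i = (if i = t then 0 else c i)" for i
  have "t < m" using c(3) by (cases "t < m") auto
  then have "(\<Sum>i\<in>{t..<m}. c' i * g i) = (\<Sum>i\<in>{Suc t..<m}. c i * g i)" for g :: "nat \<Rightarrow> real"
    by (subst sum.atLeast_Suc_lessThan) (auto simp: c'_def intro!: sum.cong)
  from this[of "\<lambda>_. 1"] this c show "X \<in> conv_tail F t"
    unfolding conv_tail_def
    by (intro CollectI exI[of _ c'] exI[of _ m]) (auto simp: c'_def)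
qed

text \<open>Weights are required to vanish from \<open>m\<close> on so that two combinations can be
  written over a common range before averaging.\<close>

lemma conv_tail_midpoint:
  assumes "X \<in> conv_tail F t" "Y \<in> conv_tail F t"
  shows "(\<lambda>n. (X n + Y n) / 2) \<in> conv_tail F t"
proof -
  obtain c m where c: "\<forall>i. 0 \<le> c i \<and> c i \<le> 1" "\<forall>i\<ge>m. c i = 0" "(\<Sum>i\<in>{t..<m}. c i) = 1"
    "X = (\<lambda>n. \<Sum>i\<in>{t..<m}. c i * F i n)" using assms(1) unfolding conv_tail_def by blast
  obtain d l where d: "\<forall>i. 0 \<le> d i \<and> d i \<le> 1" "\<forall>i\<ge>l. d i = 0" "(\<Sum>i\<in>{t..<l}. d i) = 1"
    "Y = (\<lambda>n. \<Sum>i\<in>{t..<l}. d i * F i n)" using assms(2) unfolding conv_tail_def by blast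
  have 1: "(\<Sum>i\<in>{t..<m}. c i * g i) = (\<Sum>i\<in>{t..<max m l}. c i * g i)" for g
    using c(2) by (intro sum.mono_neutral_left) auto
  have 2: "(\<Sum>i\<in>{t..<l}. d i * g i) = (\<Sum>i\<in>{t..<max m l}. d i * g i)" for g
    using d(2) by (intro sum.mono_neutral_left) auto
  have 3: "(\<Sum>i\<in>{t..<max m l}. (c i + d i) / 2 * g i) = ((\<Sum>i\<in>{t..<m}. c i * g i) + (\<Sum>i\<in>{t..<l}. d i * g i)) / 2" for g
    unfolding 1 2 by (simp add: sum.distrib [symmetric] sum_divide_distrib distrib_right)
  show ?thesis unfolding conv_tail_def
  proof (intro CollectI exI[of _ "\<lambda>i. (c i + d i) / 2"] exI[of _ "max m l"] conjI)
    show "\<forall>i. 0 \<le> (c i + d i) / 2 \<and> (c i + d i) / 2 \<le> 1"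
    proof
      fix i show "0 \<le> (c i + d i) / 2 \<and> (c i + d i) / 2 \<le> 1"
        using c(1)[rule_format, of i] d(1)[rule_format, of i] by auto
    qed
    show "(\<Sum>i\<in>{t..<max m l}. (c i + d i) / 2) = 1" using 3[of "\<lambda>_. 1"] c(3) d(3) by simp
    show "(\<lambda>n. (X n + Y n) / 2) = (\<lambda>n. \<Sum>i\<in>{t..<max m l}. (c i + d i) / 2 * F i n)"
      unfolding 3 c(4) d(4) ..
  qed (use c d in auto)
qed

context log_limit
begin

lemma L_abs_le_sqrt:
  assumes "bdd_seq f"
  shows "L (\<lambda>n. \<bar>f n\<bar>) \<le> sqrt (L (\<lambda>n. (f n)\<^sup>2))"
proof -
  define a where "a = L (\<lambda>n. \<bar>f n\<bar>)"
  have b: "bdd_seq (\<lambda>n. \<bar>f n\<bar>)" "bdd_seq (\<lambda>n. (f n)\<^sup>2)" using assms by (auto intro: bdd_intros)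
  have "0 \<le> L (\<lambda>n. (\<bar>f n\<bar> - a)\<^sup>2)"
    by (intro L_nonneg bdd_intros assms) auto
  also have "L (\<lambda>n. (\<bar>f n\<bar> - a)\<^sup>2) = L (\<lambda>n. ((f n)\<^sup>2 + (- 2 * a) * \<bar>f n\<bar>) + a\<^sup>2)"
    by (intro arg_cong[where f = L]) (simp add: power2_eq_square algebra_simps fun_eq_iff)
  also have "\<dots> = L (\<lambda>n. (f n)\<^sup>2 + (- 2 * a) * \<bar>f n\<bar>) + a\<^sup>2"
    by (subst L_add) (auto simp: L_const intro!: bdd_intros assms)
  also have "L (\<lambda>n. (f n)\<^sup>2 + (- 2 * a) * \<bar>f n\<bar>) = L (\<lambda>n. (f n)\<^sup>2) + L (\<lambda>n. (- 2 * a) * \<bar>f n\<bar>)"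
    by (intro L_add bdd_intros assms)
  also have "L (\<lambda>n. (- 2 * a) * \<bar>f n\<bar>) = (- 2 * a) * a"
    unfolding a_def by (intro L_cmult b)
  finally have "a\<^sup>2 \<le> L (\<lambda>n. (f n)\<^sup>2)" by (simp add: power2_eq_square)
  then show ?thesis unfolding a_def [symmetric] by (rule real_le_rsqrt)
qed

lemma L_parallelogram:
  assumes "bdd_seq X" "bdd_seq Y"
  shows "L (\<lambda>n. (X n - Y n)\<^sup>2) = 2 * L (\<lambda>n. (X n)\<^sup>2) + 2 * L (\<lambda>n. (Y n)\<^sup>2) - 4 * L (\<lambda>n. ((X n + Y n) / 2)\<^sup>2)"
proof -
  have "bdd_seq (\<lambda>n. (X n + Y n) * (1/2))" by (intro bdd_intros assms)
  then have b: "bdd_seq (\<lambda>n. ((X n + Y n) / 2)\<^sup>2)" by (auto intro: bdd_intros)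
  have "L (\<lambda>n. (X n - Y n)\<^sup>2) = L (\<lambda>n. (2 * (X n)\<^sup>2 + 2 * (Y n)\<^sup>2) - 4 * ((X n + Y n) / 2)\<^sup>2)"
    by (intro arg_cong[where f = L]) (simp add: power2_eq_square field_simps fun_eq_iff)
  also have "\<dots> = L (\<lambda>n. 2 * (X n)\<^sup>2 + 2 * (Y n)\<^sup>2) - L (\<lambda>n. 4 * ((X n + Y n) / 2)\<^sup>2)"
    by (intro L_diff bdd_intros b assms)
  also have "L (\<lambda>n. 2 * (X n)\<^sup>2 + 2 * (Y n)\<^sup>2) = L (\<lambda>n. 2 * (X n)\<^sup>2) + L (\<lambda>n. 2 * (Y n)\<^sup>2)"
    by (intro L_add bdd_intros assms)
  finally show ?thesis by (simp add: L_cmult b assms bdd_intros)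
qed

text \<open>Almost minimal elements of a decreasing sequence of convex sets form a Cauchy sequence by the
  parallelogram law; this replaces a weak limit and Mazur's theorem.\<close>
lemma ex_cauchy_selection:
  assumes ne: "\<And>t. C t \<noteq> {}" and dec: "\<And>t. C (Suc t) \<subseteq> C t"
    and mid: "\<And>t X Y. X \<in> C t \<Longrightarrow> Y \<in> C t \<Longrightarrow> (\<lambda>n. (X n + Y n) / 2) \<in> C t"
    and bd: "\<And>X. X \<in> C 0 \<Longrightarrow> bdd_seq X" and B: "\<And>X. X \<in> C 0 \<Longrightarrow> L (\<lambda>n. (X n)\<^sup>2) \<le> B"
    and \<epsilon>: "\<And>t. \<epsilon> t > 0" "\<And>t. \<epsilon> (Suc t) \<le> \<epsilon> t"
  shows "\<exists>G. \<forall>t. G t \<in> C t \<and> L (\<lambda>n. \<bar>G t n - G (Suc t) n\<bar>) \<le> \<epsilon> t"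
proof -
  define N where "N X = L (\<lambda>n. (X n)\<^sup>2)" for X
  \<comment> \<open>The infima over the shrinking sets increase and are bounded by \<open>B\<close>,
    hence converge.\<close>
  define d where "d t = Inf (N ` C t)" for t
  have anti: "C t' \<subseteq> C t" if "t \<le> t'" for t t'
    using lift_Suc_antimono_le[of C] dec that by blast
  have sub0: "C t \<subseteq> C 0" for t by (rule anti) simp
  have N0: "N X \<ge> 0" if "X \<in> C 0" for X
    unfolding N_def using bd[OF that] by (intro L_nonneg bdd_intros) auto
  have bb: "bdd_below (N ` C t)" for t using N0 sub0 by (intro bdd_belowI[of _ 0]) auto
  have dle: "d t \<le> N X" if "X \<in> C t" for t X
    unfolding d_def using bb that by (intro cInf_lower) auto
  have dmono: "d t \<le> d t'" if "t \<le> t'" for t t'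
    unfolding d_def using anti[OF that] ne bb by (intro cInf_superset_mono) auto
  have dB: "d t \<le> B" for t
    using ne[of t] dle B sub0 unfolding N_def by (meson equals0I order_trans subsetD)
  have "incseq d" by (intro monoI dmono)
  then obtain D where D: "d \<longlonglongrightarrow> D" "\<And>t. d t \<le> D"
    using incseq_convergent[of d B] dB by blast
  \<comment> \<open>The parallelogram law below leaves \<open>8 * \<eta> t\<close>, which is less
    than \<open>(\<epsilon> t)\<^sup>2\<close>.\<close>
  define \<eta> where "\<eta> t = (\<epsilon> t)\<^sup>2 / 12" for t
  have \<eta>: "\<eta> t > 0" "\<eta> (Suc t) \<le> \<eta> t" for t
    using \<epsilon>(1)[of t] \<epsilon>(1)[of "Suc t"] \<epsilon>(2)[of t] by (auto simp: \<eta>_def intro!: power_mono)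
  have "\<exists>r X. r \<ge> t \<and> X \<in> C r \<and> D - \<eta> t \<le> d r \<and> N X \<le> D + \<eta> t" for t
  proof -
    have "eventually (\<lambda>r. d r > D - \<eta> t) sequentially" using D(1) \<eta>(1)[of t] by (intro order_tendstoD(1)) auto
    then obtain r where r: "r \<ge> t" "d r > D - \<eta> t"
      by (metis eventually_sequentially linorder_linear order_refl)
    have "Inf (N ` C r) < D + \<eta> t" using D(2)[of r] \<eta>(1)[of t] by (simp add: d_def)
    then obtain X where "X \<in> C r" "N X < D + \<eta> t"
      using cInf_lessD[of "N ` C r"] ne[of r] by blast
    then show ?thesis using r by (intro exI[of _ r] exI[of _ X]) auto
  qed
  then obtain r G where rG: "\<And>t. r t \<ge> t" "\<And>t. G t \<in> C (r t)" "\<And>t. D - \<eta> t \<le> d (r t)" "\<And>t. N (G t) \<le> D + \<eta> t"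
    by metis
  have "L (\<lambda>n. \<bar>G t n - G (Suc t) n\<bar>) \<le> \<epsilon> t" for t
  proof -
    \<comment> \<open>Both elements and hence their midpoint lie in the larger set
      \<open>C s\<close>, so \<open>N\<close> of the midpoint is at least
      \<open>d s\<close>.\<close>
    define s where "s = min (r t) (r (Suc t))"
    have Gs: "G t \<in> C s" "G (Suc t) \<in> C s" using rG(2)[of t] rG(2)[of "Suc t"] anti[of s "r t"] anti[of s "r (Suc t)"] by (auto simp: s_def)
    have bG: "bdd_seq (G t)" "bdd_seq (G (Suc t))" using Gs sub0 bd by auto
    have "d s \<le> N (\<lambda>n. (G t n + G (Suc t) n) / 2)" by (intro dle mid Gs)
    moreover have "D - \<eta> t \<le> d s"
      using rG(3)[of t] rG(3)[of "Suc t"] \<eta>(2)[of t] by (auto simp: s_def min_def)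
    ultimately have *: "D - \<eta> t \<le> N (\<lambda>n. (G t n + G (Suc t) n) / 2)" by (rule order_trans[rotated])
    have arith: "x \<le> 2 * (D + h) + 2 * (D + h) - 4 * (D - h)"
      if "D - h \<le> m" "a \<le> D + h" "b \<le> D + h'" "h' \<le> h" "x = 2 * a + 2 * b - 4 * m" for x m a b h h'
      using that by argo
    have "N (\<lambda>n. G t n - G (Suc t) n) \<le> 2 * (D + \<eta> t) + 2 * (D + \<eta> t) - 4 * (D - \<eta> t)"
      by (rule arith[OF * rG(4) rG(4) \<eta>(2)]) (simp only: N_def L_parallelogram[OF bG])
    also have "\<dots> \<le> (\<epsilon> t)\<^sup>2" by (simp add: \<eta>_def)
    finally have "L (\<lambda>n. (G t n - G (Suc t) n)\<^sup>2) \<le> (\<epsilon> t)\<^sup>2" by (simp add: N_def)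
    then have "sqrt (L (\<lambda>n. (G t n - G (Suc t) n)\<^sup>2)) \<le> \<epsilon> t"
      using \<epsilon>(1)[of t] by (intro real_le_lsqrt) auto
    then show ?thesis using L_abs_le_sqrt[of "\<lambda>n. G t n - G (Suc t) n"] bG bdd_seq_diff by fastforce
  qed
  then show ?thesis using rG(1,2) anti by (intro exI[of _ G]) blast
qed

text \<open>Convex combinations of the \<open>F i\<close> inherit all that is needed: entropies add,
  the square is convex, and the correlations with \<open>moebius\<close> have the common sign
  \<open>\<sigma>\<close>. So the Cauchy selection applies to the tails.\<close>

lemma ex_structured_correlates:
  assumes A: "finite A" "s0 \<in> A" "\<And>s. s \<in> A \<Longrightarrow> e s > 0" "odd (e s0)"
    and c: "\<bar>L (corr A e)\<bar> \<ge> 2 * c" "c > 0" and \<eta>: "\<eta> > 0"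
  shows "\<exists>G. \<forall>t. bdd_seq (G t) \<and> block_cov (\<eta> / 2 ^ t) (G t) \<and> L (\<lambda>n. \<bar>G t n - G (Suc t) n\<bar>) \<le> \<eta> / 2 ^ t
    \<and> \<bar>L (\<lambda>n. moebius n * G t n)\<bar> \<ge> c"
proof -
  \<comment> \<open>Primes from \<open>K\<close> on bring the error \<open>2 * card A / K\<close>
    down to \<open>c\<close>, which leaves correlation \<open>2 * c - c\<close>.\<close>
  define K where "K = nat \<lceil>2 * real (card A) / c\<rceil> + Max A + 1"
  have K: "K > Max A" "2 * real (card A) / c \<le> real K" "K > 0" unfolding K_def by linarith+
  have Kc: "2 * real (card A) / real K \<le> c" using K c by (simp add: field_simps)
  \<comment> \<open>These sum over the indices from \<open>t\<close> on to at most
    \<open>\<eta> / 2 ^ t\<close>.\<close>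
  define \<delta> where "\<delta> i = \<eta> / 2 ^ Suc i" for i
  have "\<exists>P. finite P \<and> (\<forall>p\<in>P. prime p \<and> K \<le> p) \<and> recip_sum P \<ge> 1 \<and> block_cov (\<delta> i) (dilated_corr P A s0 e)" for i
  proof -
    have pos: "\<delta> i > 0" using \<eta> by (simp add: \<delta>_def)
    obtain M where M: "\<forall>P. finite P \<and> (\<forall>p\<in>P. prime p \<and> Max A < p) \<and> M \<le> recip_sum P \<longrightarrow> block_cov (\<delta> i) (dilated_corr P A s0 e)"
      using block_cov_dilated_corr[OF A(1-3) pos] by (rule exE)
    obtain P where P: "finite P" "\<forall>p\<in>P. prime p \<and> K \<le> p" "recip_sum P \<ge> max 1 M"
      using recip_sum_primes_large[of K "max 1 M"] by blast
    then have "\<forall>p\<in>P. prime p \<and> Max A < p" using K(1) by fastforce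
    then show ?thesis using M[rule_format, of P] P by (intro exI[of _ P]) auto
  qed
  then obtain P where P: "\<And>i. finite (P i)" "\<And>i. \<forall>p\<in>P i. prime p \<and> K \<le> p" "\<And>i. recip_sum (P i) \<ge> 1"
    "\<And>i. block_cov (\<delta> i) (dilated_corr (P i) A s0 e)" by metis
  define F where "F i = dilated_corr (P i) A s0 e" for i
  define \<sigma> where "\<sigma> = (-1) ^ (\<Sum>s\<in>A. e s) * sgn (L (corr A e))"
  have \<sigma>1: "\<bar>\<sigma>\<bar> = 1" using c by (auto simp: \<sigma>_def abs_mult power_abs sgn_real_def)
  have bF: "bdd_seq (F i)" for i by (auto simp: F_def)
  have bmu: "bdd_seq moebius" by (rule bdd_seqI[of _ 1]) (rule abs_moebius_le_1)
  have FL: "\<sigma> * L (\<lambda>n. moebius n * F i n) \<ge> c" for i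
  proof -
    have "P i \<noteq> {}" using P(3)[of i] by (auto simp: recip_sum_def)
    then have "\<bar>L (\<lambda>n. moebius n * F i n) - (-1) ^ (\<Sum>s\<in>A. e s) * L (corr A e)\<bar> \<le> 2 * real (card A) / real K"
      unfolding F_def using P K by (intro L_moebius_dilated_corr A) auto
    then have "\<bar>\<sigma>\<bar> * \<bar>L (\<lambda>n. moebius n * F i n) - (-1) ^ (\<Sum>s\<in>A. e s) * L (corr A e)\<bar> \<le> c"
      using Kc \<sigma>1 by simp
    then have "\<bar>\<sigma> * L (\<lambda>n. moebius n * F i n) - \<sigma> * ((-1) ^ (\<Sum>s\<in>A. e s) * L (corr A e))\<bar> \<le> c"
      by (simp add: abs_mult [symmetric] right_diff_distrib)
    moreover have "\<sigma> * ((-1) ^ (\<Sum>s\<in>A. e s) * L (corr A e)) = \<bar>L (corr A e)\<bar>"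
      by (simp add: \<sigma>_def abs_sgn mult_ac power_mult_distrib [symmetric])
    ultimately show ?thesis using c by linarith
  qed
  have F2: "L (\<lambda>n. (F i n)\<^sup>2) \<le> 2" for i
    unfolding F_def using P by (intro L_dilated_corr_square) auto
  define C where "C t = conv_tail F t" for t
  have bC: "bdd_seq X" if "X \<in> C t" for t X
    using that unfolding C_def conv_tail_def by (auto intro!: bdd_intros bF)
  have C2: "L (\<lambda>n. (X n)\<^sup>2) \<le> 2" if X: "X \<in> C t" for t X
  proof -
    obtain c m where c: "\<And>i. 0 \<le> c i" "(\<Sum>i\<in>{t..<m}. c i) = 1"
      "X = (\<lambda>n. \<Sum>i\<in>{t..<m}. c i * F i n)" by (rule conv_tailE[OF X[unfolded C_def]]) (rule that, assumption+)
    have "(X n)\<^sup>2 \<le> (\<Sum>i\<in>{t..<m}. c i * (F i n)\<^sup>2)" for n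
    proof -
      have "(X n)\<^sup>2 = (\<Sum>i\<in>{t..<m}. sqrt (c i) * (sqrt (c i) * F i n))\<^sup>2"
        using c by (simp only: mult.assoc [symmetric] real_sqrt_mult_self abs_of_nonneg)
      also have "\<dots> \<le> (\<Sum>i\<in>{t..<m}. (sqrt (c i))\<^sup>2) * (\<Sum>i\<in>{t..<m}. (sqrt (c i) * F i n)\<^sup>2)"
        by (rule Cauchy_Schwarz_ineq_sum)
      also have "\<dots> = (\<Sum>i\<in>{t..<m}. c i * (F i n)\<^sup>2)"
        using c by (simp add: power_mult_distrib)
      finally show ?thesis .
    qed
    then have "L (\<lambda>n. (X n)\<^sup>2) \<le> L (\<lambda>n. \<Sum>i\<in>{t..<m}. c i * (F i n)\<^sup>2)"
      using bC[OF that] by (intro L_mono bdd_intros bF) auto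
    also have "\<dots> = (\<Sum>i\<in>{t..<m}. c i * L (\<lambda>n. (F i n)\<^sup>2))"
      by (subst L_sum) (auto simp: L_cmult bdd_intros bF intro!: bdd_intros bF)
    also have "\<dots> \<le> (\<Sum>i\<in>{t..<m}. c i * 2)" using c F2 by (intro sum_mono mult_left_mono) auto
    finally show ?thesis using c by (simp add: sum_distrib_right [symmetric])
  qed
  have CL: "\<bar>L (\<lambda>n. moebius n * X n)\<bar> \<ge> c" if X: "X \<in> C t" for t X
  proof -
    obtain w m where w: "\<And>i. 0 \<le> w i" "\<And>i. w i \<le> 1" "(\<Sum>i\<in>{t..<m}. w i) = 1"
      "X = (\<lambda>n. \<Sum>i\<in>{t..<m}. w i * F i n)" by (rule conv_tailE[OF X[unfolded C_def]]) (rule that, assumption+)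
    have eq: "(\<lambda>n. moebius n * X n) = (\<lambda>n. \<Sum>i\<in>{t..<m}. w i * (moebius n * F i n))"
      by (simp add: w sum_distrib_left mult_ac)
    have "\<sigma> * L (\<lambda>n. moebius n * X n) = \<sigma> * (\<Sum>i\<in>{t..<m}. w i * L (\<lambda>n. moebius n * F i n))"
      unfolding eq by (subst L_sum) (auto simp: L_cmult bdd_intros bF bmu intro!: bdd_intros bF bmu)
    also have "\<dots> = (\<Sum>i\<in>{t..<m}. w i * (\<sigma> * L (\<lambda>n. moebius n * F i n)))"
      by (simp add: sum_distrib_left mult_ac)
    also have "\<dots> \<ge> (\<Sum>i\<in>{t..<m}. w i * c)" using w FL by (intro sum_mono mult_left_mono) auto
    finally have "c \<le> \<sigma> * L (\<lambda>n. moebius n * X n)" using w by (simp add: sum_distrib_right [symmetric])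
    also have "\<dots> \<le> \<bar>\<sigma>\<bar> * \<bar>L (\<lambda>n. moebius n * X n)\<bar>" by (metis abs_ge_self abs_mult)
    finally show ?thesis using \<sigma>1 by simp
  qed
  have Ccov: "block_cov (\<eta> / 2 ^ t) X" if X: "X \<in> C t" for t X
  proof -
    obtain w m where w: "\<And>i. 0 \<le> w i" "\<And>i. w i \<le> 1" "(\<Sum>i\<in>{t..<m}. w i) = 1"
      "X = (\<lambda>n. \<Sum>i\<in>{t..<m}. w i * F i n)" by (rule conv_tailE[OF X[unfolded C_def]]) (rule that, assumption+)
    have "t \<le> m" using w(3) by (cases "t \<le> m") auto
    then have "(\<Sum>i\<in>{t..<m}. \<delta> i) = \<eta> / 2 ^ t - \<eta> / 2 ^ m"
      by (induction rule: dec_induct) (auto simp: \<delta>_def)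
    then have "(\<Sum>i\<in>{t..<m}. \<delta> i) \<le> \<eta> / 2 ^ t" using \<eta> by simp
    moreover have "block_cov (\<Sum>i\<in>{t..<m}. \<delta> i) X" unfolding w(4)
      using P(4) w(1,2) by (intro block_cov_sum) (auto simp: F_def)
    ultimately show ?thesis by (rule block_cov_mono[rotated])
  qed
  have "\<exists>G. \<forall>t. G t \<in> C t \<and> L (\<lambda>n. \<bar>G t n - G (Suc t) n\<bar>) \<le> \<eta> / 2 ^ t"
  proof (rule ex_cauchy_selection[where B = 2])
    show "C t \<noteq> {}" for t using conv_tail_base[of F t] by (auto simp: C_def)
    show "\<eta> / 2 ^ Suc t \<le> \<eta> / 2 ^ t" for t using \<eta> by (simp add: divide_simps)
  qed (use bC C2 \<eta> in \<open>auto simp: C_def conv_tail_midpoint dest: subsetD[OF conv_tail_Suc]\<close>)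
  then show ?thesis using bC CL Ccov by blast
qed

end

section \<open>A sequence of zero complexity correlating with the Moebius function\<close>

text \<open>Only the first \<open>m\<close> values of a word matter. Blocks are aligned at multiples
  of \<open>m\<close>, which makes dictionaries comparable when one length divides the
  other.\<close>

definition concats :: "nat \<Rightarrow> (nat \<Rightarrow> real) set \<Rightarrow> (nat \<Rightarrow> real) set" where
  "concats m W = {y. \<forall>q. \<exists>w\<in>W. \<forall>h<m. y (q * m + h) = w h}"

lemma concats_finite_range:
  assumes "y \<in> concats m W" "m > 0"
  shows "range y \<subseteq> (\<Union>w\<in>W. w ` {..<m})"
proof (rule image_subsetI)
  fix n
  obtain w where "w \<in> W" "\<forall>h<m. y (n div m * m + h) = w h" using assms(1) by (auto simp: concats_def)
  then show "y n \<in> (\<Union>w\<in>W. w ` {..<m})"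
    using assms(2) by (auto intro!: bexI[of _ w] image_eqI[of _ _ "n mod m"] dest!: spec[of _ "n mod m"])
qed

lemma concats_bound:
  assumes "finite W" "m > 0"
  obtains C where "\<And>y n. y \<in> concats m W \<Longrightarrow> \<bar>y n\<bar> \<le> C"
proof -
  have "finite (abs ` (\<Union>w\<in>W. w ` {..<m}))" using assms by auto
  then have "\<bar>y n\<bar> \<le> Max (abs ` (\<Union>w\<in>W. w ` {..<m}))" if "y \<in> concats m W" for y n
    by (intro Max_ge imageI subsetD[OF concats_finite_range[OF that assms(2)]] rangeI)
  then show ?thesis by (rule that)
qed

lemma bdd_seq_concats: "finite W \<Longrightarrow> m > 0 \<Longrightarrow> y \<in> concats m W \<Longrightarrow> bdd_seq y"
  by (metis bdd_seqI concats_bound)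

lemma concats_shift:
  assumes "y \<in> concats m W" "m dvd k"
  shows "(\<lambda>h. y (k + h)) \<in> concats m W"
proof -
  obtain j where k: "k = m * j" using assms(2) by blast
  have "\<exists>w\<in>W. \<forall>h<m. y (k + (q * m + h)) = w h" for q
  proof -
    have eq: "k + (q * m + h) = (j + q) * m + h" for h by (simp add: k algebra_simps)
    have "\<exists>w\<in>W. \<forall>h<m. y ((j + q) * m + h) = w h" using assms(1) unfolding concats_def by blast
    then show ?thesis unfolding eq .
  qed
  then show ?thesis by (simp add: concats_def)
qed

lemma concats_subset:
  assumes W': "W' \<subseteq> concats m W" and m: "m dvd m'" "m > 0" "m' > 0"
  shows "concats m' W' \<subseteq> concats m W"
proof
  fix z assume z: "z \<in> concats m' W'"
  have "\<exists>w\<in>W. \<forall>h<m. z (q * m + h) = w h" for q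
  proof -
    \<comment> \<open>The block number \<open>q\<close> of length \<open>m\<close> starts at offset
      \<open>r\<close> in the block number \<open>a\<close> of length \<open>m'\<close> and, as
      \<open>m dvd m'\<close>, does not cross its end.\<close>
    define a where "a = q * m div m'"
    define r where "r = q * m mod m'"
    have dec: "q * m = a * m' + r" by (simp add: a_def r_def)
    obtain v where v: "v \<in> W'" "\<And>h. h < m' \<Longrightarrow> z (a * m' + h) = v h"
      using z by (auto simp: concats_def)
    have "m dvd r" using m(1) by (simp add: r_def dvd_mod_iff)
    then obtain b where b: "r = b * m" by (metis dvdE mult.commute)
    have "r < m'" using m by (simp add: r_def)
    obtain d where d: "m' = d * m" using m(1) by (metis dvdE mult.commute)
    have "b < d" using \<open>r < m'\<close> b d by simp
    then have "r + m \<le> m'" unfolding b d by (metis Suc_leI add.commute mult_Suc mult_le_mono1)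
    have "v \<in> concats m W" using v(1) W' by blast
    then have "\<exists>w\<in>W. \<forall>h<m. v (b * m + h) = w h" unfolding concats_def by blast
    then obtain w where w: "w \<in> W" "\<forall>h<m. v (b * m + h) = w h" by blast
    have "z (q * m + h) = w h" if "h < m" for h
      using v(2)[of "r + h"] w(2) that \<open>r + m \<le> m'\<close> b dec by (simp add: add.assoc)
    then show ?thesis using w(1) by blast
  qed
  then show "z \<in> concats m W" by (simp add: concats_def)
qed

text \<open>Replaces a nearest point, whose existence would need an argument; the loss of 1 will be
  at most \<open>\<delta> * H\<close>.\<close>

lemma ex_almost_minimal:
  fixes \<phi> :: "'a \<Rightarrow> real"
  assumes "S \<noteq> {}" "\<And>v. v \<in> S \<Longrightarrow> \<phi> v \<ge> 0"
  shows "\<exists>v\<in>S. \<forall>v'\<in>S. \<phi> v \<le> \<phi> v' + 1"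
proof -
  have "Inf (\<phi> ` S) < Inf (\<phi> ` S) + 1" by simp
  then obtain v where v: "v \<in> S" "\<phi> v < Inf (\<phi> ` S) + 1"
    using cInf_lessD[of "\<phi> ` S"] assms(1) by blast
  have "Inf (\<phi> ` S) \<le> \<phi> v'" if "v' \<in> S" for v'
    using assms(2) that by (intro cInf_lower bdd_belowI[of _ 0]) auto
  then show ?thesis using v by force
qed

text \<open>One length \<open>m\<close> for each \<open>\<delta>\<close> suffices, because longer
  words are cut into blocks. The threshold \<open>M\<close> is there because a spliced sequence
  obeys the dictionary of stage \<open>t\<close> only after the earlier pieces.\<close>

definition zero_complexity :: "(nat \<Rightarrow> real) \<Rightarrow> bool" where
  "zero_complexity y \<longleftrightarrow> (\<forall>\<delta>>0. \<exists>m W M. m > 0 \<and> finite W \<and> real (card W) \<le> exp (\<delta> * real m) \<and>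
     (\<forall>q. M \<le> q * m \<longrightarrow> (\<exists>w\<in>W. \<forall>h<m. y (q * m + h) = w h)))"

context log_limit
begin

text \<open>Each word of the finer dictionary is replaced by the concatenation of coarser words nearest to
  it, so that the new sequences are still concatenations of coarser words.\<close>
lemma refine_dictionary:
  assumes y: "y \<in> concats m W" "bdd_seq y" and m: "m > 0" and G: "bdd_seq G" "bdd_seq G'"
    and block_cov: "block_cov \<delta> G'" and \<delta>: "\<delta> > 0"
    and \<epsilon>: "L (\<lambda>n. \<bar>G n - G' n\<bar>) \<le> \<epsilon>" and \<eta>: "L (\<lambda>n. \<bar>G n - y n\<bar>) \<le> \<eta>"
  shows "\<exists>m' W' y'. m' > 0 \<and> m dvd m' \<and> finite W' \<and> real (card W') \<le> exp (\<delta> * real m') \<and>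
    concats m' W' \<subseteq> concats m W \<and> y' \<in> concats m' W' \<and> L (\<lambda>n. \<bar>G' n - y' n\<bar>) \<le> \<eta> + \<epsilon> + 3 * \<delta>"
proof -
  obtain Q H0 where Q: "Q > 0" and HV: "\<And>H. H \<ge> H0 \<Longrightarrow> word_cover \<delta> G' Q H"
    using block_covE[OF block_cov] by blast
  \<comment> \<open>\<open>H\<close> has to be long enough for the cover, at least
    \<open>1 / \<delta>\<close> to absorb the loss of 1, and a multiple of both \<open>m\<close> and
    \<open>Q\<close>.\<close>
  define k where "k = H0 + nat \<lceil>1 / \<delta>\<rceil> + 1"
  define H where "H = k * (m * Q)"
  have "m * Q \<ge> 1" using m Q by simp
  then have "k \<le> H" unfolding H_def by (metis mult_le_mono2 mult.right_neutral)
  then have H: "H0 \<le> H" "H > 0" "m dvd H" "Q dvd H" by (auto simp: k_def H_def)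
  have "1 / \<delta> \<le> real k" unfolding k_def by linarith
  also have "\<dots> \<le> real H" using \<open>k \<le> H\<close> by simp
  finally have H1: "1 \<le> \<delta> * real H" using \<delta> by (simp add: field_simps)
  obtain V where V: "finite V" "real (card V) \<le> exp (\<delta> * real H)"
    and Vw: "\<And>n. Q dvd n \<Longrightarrow> \<exists>w\<in>V. (\<Sum>h<H. \<bar>G' (n + h) - w h\<bar>) \<le> \<delta> * real H"
    using HV[OF H(1)] by blast
  define \<phi> where "\<phi> w v = (\<Sum>h<H. \<bar>v h - w h\<bar>)" for v w :: "nat \<Rightarrow> real"
  have "\<exists>v\<in>concats m W. \<forall>v'\<in>concats m W. \<phi> w v \<le> \<phi> w v' + 1" for w
    using y(1) by (intro ex_almost_minimal) (auto simp: \<phi>_def intro: sum_nonneg)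
  then obtain near where near: "\<And>w. near w \<in> concats m W" "\<And>w v'. v' \<in> concats m W \<Longrightarrow> \<phi> w (near w) \<le> \<phi> w v' + 1"
    by metis
  have "\<exists>w\<in>V. (\<Sum>h<H. \<bar>G' (q * H + h) - w h\<bar>) \<le> \<delta> * real H" for q
    using H(4) by (intro Vw) simp
  then obtain wq where wq: "\<And>q. wq q \<in> V" "\<And>q. (\<Sum>h<H. \<bar>G' (q * H + h) - wq q h\<bar>) \<le> \<delta> * real H" by metis
  define y' where "y' n = near (wq (n div H)) (n mod H)" for n
  have y'b: "y' (q * H + h) = near (wq q) h" if "h < H" for q h
    using that by (simp add: y'_def)
  have sub: "concats H (near ` V) \<subseteq> concats m W" using near(1) H m by (intro concats_subset) auto
  have y'c: "y' \<in> concats H (near ` V)" using wq(1) y'b by (auto simp: concats_def)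
  have by': "bdd_seq y'" using bdd_seq_concats[OF _ H(2) y'c] V(1) by simp
  \<comment> \<open>The distance of \<open>G'\<close> to \<open>w\<close> enters twice, on the way
    from \<open>G'\<close> to \<open>y'\<close> and on the way from \<open>y\<close> to
    \<open>w\<close>; the third \<open>\<delta>\<close> covers the loss of 1.\<close>
  have "L (\<lambda>n. \<bar>G' n - y' n\<bar> - (\<bar>G n - G' n\<bar> + \<bar>G n - y n\<bar>)) \<le> 3 * \<delta>"
  proof (rule L_aligned_blocks[OF _ H(2)])
    fix q
    define w where "w = wq q"
    have "(\<lambda>h. y (q * H + h)) \<in> concats m W" using H(3) by (intro concats_shift y(1)) simp
    from near(2)[OF this, of w]
    have 1: "(\<Sum>h<H. \<bar>near w h - w h\<bar>) \<le> (\<Sum>h<H. \<bar>y (q * H + h) - w h\<bar>) + 1" by (simp add: \<phi>_def)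
    have "(\<Sum>h<H. \<bar>G' (q * H + h) - y' (q * H + h)\<bar>) \<le> (\<Sum>h<H. \<bar>G' (q * H + h) - w h\<bar> + \<bar>near w h - w h\<bar>)"
      using y'b by (intro sum_mono) (auto simp: w_def)
    also have "\<dots> \<le> (\<Sum>h<H. \<bar>G' (q * H + h) - w h\<bar>) + ((\<Sum>h<H. \<bar>y (q * H + h) - w h\<bar>) + 1)"
      using 1 by (simp add: sum.distrib)
    also have "(\<Sum>h<H. \<bar>y (q * H + h) - w h\<bar>) \<le> (\<Sum>h<H. (\<bar>G (q * H + h) - G' (q * H + h)\<bar> + \<bar>G (q * H + h) - y (q * H + h)\<bar>) + \<bar>G' (q * H + h) - w h\<bar>)"
      by (intro sum_mono) linarith
    also have "\<dots> = (\<Sum>h<H. \<bar>G (q * H + h) - G' (q * H + h)\<bar> + \<bar>G (q * H + h) - y (q * H + h)\<bar>) + (\<Sum>h<H. \<bar>G' (q * H + h) - w h\<bar>)"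
      by (rule sum.distrib)
    finally have "(\<Sum>h<H. \<bar>G' (q * H + h) - y' (q * H + h)\<bar>)
      \<le> (\<Sum>h<H. \<bar>G (q * H + h) - G' (q * H + h)\<bar> + \<bar>G (q * H + h) - y (q * H + h)\<bar>) + 2 * (\<Sum>h<H. \<bar>G' (q * H + h) - w h\<bar>) + 1"
      by simp
    then show "(\<Sum>h<H. \<bar>G' (q * H + h) - y' (q * H + h)\<bar> - (\<bar>G (q * H + h) - G' (q * H + h)\<bar> + \<bar>G (q * H + h) - y (q * H + h)\<bar>)) \<le> 3 * \<delta> * real H"
      using wq(2)[of q] H1 unfolding sum_subtractf w_def by linarith
  qed (intro bdd_intros G by' y(2))
  also have "L (\<lambda>n. \<bar>G' n - y' n\<bar> - (\<bar>G n - G' n\<bar> + \<bar>G n - y n\<bar>)) = L (\<lambda>n. \<bar>G' n - y' n\<bar>) - L (\<lambda>n. \<bar>G n - G' n\<bar> + \<bar>G n - y n\<bar>)"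
    by (intro L_diff bdd_intros G by' y(2))
  also have "L (\<lambda>n. \<bar>G n - G' n\<bar> + \<bar>G n - y n\<bar>) = L (\<lambda>n. \<bar>G n - G' n\<bar>) + L (\<lambda>n. \<bar>G n - y n\<bar>)"
    by (intro L_add bdd_intros G by' y(2))
  finally have "L (\<lambda>n. \<bar>G' n - y' n\<bar>) \<le> \<eta> + \<epsilon> + 3 * \<delta>" using \<epsilon> \<eta> by linarith
  moreover have "real (card (near ` V)) \<le> exp (\<delta> * real H)"
    using card_image_le[OF V(1), of near] V(2) by linarith
  ultimately show ?thesis using H sub y'c V(1)
    by (intro exI[of _ H] exI[of _ "near ` V"] exI[of _ y']) auto
qed

lemma ex_dictionaries:
  assumes G: "\<And>t. bdd_seq (G t)" "\<And>t. block_cov (\<eta> / 2 ^ t) (G t)" "\<And>t. L (\<lambda>n. \<bar>G t n - G (Suc t) n\<bar>) \<le> \<eta> / 2 ^ t"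
    and \<eta>: "\<eta> > 0"
  shows "\<exists>m W y. \<forall>t. m t > 0 \<and> m t dvd m (Suc t) \<and> finite (W t) \<and> real (card (W t)) \<le> exp (\<eta> / 2 ^ t * real (m t)) \<and>
     concats (m (Suc t)) (W (Suc t)) \<subseteq> concats (m t) (W t) \<and> y t \<in> concats (m t) (W t) \<and> L (\<lambda>n. \<bar>G t n - y t n\<bar>) \<le> 8 * \<eta>"
proof -
  \<comment> \<open>Each step adds \<open>\<eta> / 2 ^ t + 3 * \<eta> / 2 ^ Suc t\<close>, which is
    exactly the increase of \<open>8 * \<eta> - 5 * \<eta> / 2 ^ t\<close>; the start
    \<open>3 * \<eta>\<close> is its value at 0.\<close>
  define P where "P t = (\<lambda>(m, W, y). m > 0 \<and> finite W \<and> real (card W) \<le> exp (\<eta> / 2 ^ t * real m) \<and>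
     y \<in> concats m W \<and> L (\<lambda>n. \<bar>G t n - y n\<bar>) \<le> 8 * \<eta> - 5 * \<eta> / 2 ^ t)" for t
  define R :: "nat \<times> (nat \<Rightarrow> real) set \<times> (nat \<Rightarrow> real) \<Rightarrow> nat \<times> (nat \<Rightarrow> real) set \<times> (nat \<Rightarrow> real) \<Rightarrow> bool"
    where "R = (\<lambda>(m, W, y) (m', W', y'). m dvd m' \<and> concats m' W' \<subseteq> concats m W)"
  have "\<exists>f. \<forall>t. P t (f t) \<and> R (f t) (f (Suc t))"
  proof (rule dependent_nat_choice)
    \<comment> \<open>The trivial dictionary of all words of length 1 serves as predecessor of stage
      0.\<close>
    have "G 0 \<in> concats 1 UNIV" by (auto simp: concats_def)
    moreover have "L (\<lambda>n. \<bar>G 0 n - G 0 n\<bar>) \<le> 0" by (simp add: L_const)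
    ultimately have "\<exists>m' W' y'. m' > 0 \<and> 1 dvd m' \<and> finite W' \<and> real (card W') \<le> exp (\<eta> / 2 ^ 0 * real m') \<and>
      concats m' W' \<subseteq> concats 1 UNIV \<and> y' \<in> concats m' W' \<and> L (\<lambda>n. \<bar>G 0 n - y' n\<bar>) \<le> 0 + 0 + 3 * (\<eta> / 2 ^ 0)"
      using \<eta> by (intro refine_dictionary[where G = "G 0" and y = "G 0"] G) auto
    then show "\<exists>x. P 0 x" using \<eta> by (auto simp: P_def L_const)
  next
    fix x t assume "P t x"
    then obtain m W y where x: "x = (m, W, y)" "m > 0" "finite W" "y \<in> concats m W"
      "L (\<lambda>n. \<bar>G t n - y n\<bar>) \<le> 8 * \<eta> - 5 * \<eta> / 2 ^ t" by (auto simp: P_def)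
    obtain m' W' y' where s: "m' > 0" "m dvd m'" "finite W'" "real (card W') \<le> exp (\<eta> / 2 ^ Suc t * real m')"
      "concats m' W' \<subseteq> concats m W" "y' \<in> concats m' W'"
      "L (\<lambda>n. \<bar>G (Suc t) n - y' n\<bar>) \<le> 8 * \<eta> - 5 * \<eta> / 2 ^ t + \<eta> / 2 ^ t + 3 * (\<eta> / 2 ^ Suc t)"
      using refine_dictionary[OF x(4) bdd_seq_concats[OF x(3,2,4)] x(2) G(1) G(1) G(2) _ G(3) x(5)] \<eta> by auto
    have "8 * \<eta> - 5 * \<eta> / 2 ^ t + \<eta> / 2 ^ t + 3 * (\<eta> / 2 ^ Suc t) = 8 * \<eta> - 5 * \<eta> / 2 ^ Suc t"
      by (simp add: field_simps)
    then show "\<exists>x'. P (Suc t) x' \<and> R x x'" using s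
      by (intro exI[of _ "(m', W', y')"]) (auto simp: P_def R_def x(1))
  qed
  then obtain f where f: "\<And>t. P t (f t)" "\<And>t. R (f t) (f (Suc t))" by blast
  have le: "8 * \<eta> - 5 * \<eta> / 2 ^ t \<le> 8 * \<eta>" for t using \<eta> by simp
  show ?thesis
  proof (rule exI[of _ "\<lambda>t. fst (f t)"], rule exI[of _ "\<lambda>t. fst (snd (f t))"], rule exI[of _ "\<lambda>t. snd (snd (f t))"], rule allI)
    fix t
    obtain m W y m' W' y' where ft: "f t = (m, W, y)" "f (Suc t) = (m', W', y')" by (metis prod_cases3)
    have "L (\<lambda>n. \<bar>G t n - y n\<bar>) \<le> 8 * \<eta>"
      using f(1)[of t] by (intro order_trans[OF _ le[of t]]) (simp add: ft P_def)
    then show "fst (f t) > 0 \<and> fst (f t) dvd fst (f (Suc t)) \<and> finite (fst (snd (f t))) \<and>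
       real (card (fst (snd (f t)))) \<le> exp (\<eta> / 2 ^ t * real (fst (f t))) \<and>
       concats (fst (f (Suc t))) (fst (snd (f (Suc t)))) \<subseteq> concats (fst (f t)) (fst (snd (f t))) \<and>
       snd (snd (f t)) \<in> concats (fst (f t)) (fst (snd (f t))) \<and> L (\<lambda>n. \<bar>G t n - snd (snd (f t)) n\<bar>) \<le> 8 * \<eta>"
      using f(1)[of t] f(2)[of t] by (simp add: ft P_def R_def)
  qed
qed

lemma ex_late_correlation:
  assumes f: "bdd_seq f" and c: "\<bar>L f\<bar> \<ge> 2 * c" "c > 0"
  shows "\<exists>N\<ge>N0. \<bar>logmean f N\<bar> \<ge> c \<and> harm N \<ge> (D::real)"
proof -
  have "eventually (\<lambda>N. \<bar>logmean f N - L f\<bar> < c) U"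
    using L_lim[OF f] c(2) by (simp add: tendsto_iff dist_real_def)
  moreover have "eventually (\<lambda>N. N \<ge> N0) U" by (intro L_eventually eventually_ge_at_top)
  moreover have "eventually (\<lambda>N. harm N \<ge> D) U"
    using harm_at_top by (intro L_eventually) (simp add: filterlim_at_top)
  ultimately have "eventually (\<lambda>N. N \<ge> N0 \<and> \<bar>logmean f N\<bar> \<ge> c \<and> harm N \<ge> D) U"
    by eventually_elim (use c in linarith)
  then show ?thesis using eventually_happens'[OF U_nonbot] by blast
qed

end

section \<open>Splicing sequences along increasing switch times\<close>

definition splice_at :: "(nat \<Rightarrow> nat) \<Rightarrow> (nat \<Rightarrow> nat \<Rightarrow> real) \<Rightarrow> nat \<Rightarrow> real" where
  "splice_at M y n = y (LEAST t. n < M (Suc t)) n"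

lemma splice_at_eq:
  assumes "mono M" "M t \<le> n" "n < M (Suc t)"
  shows "splice_at M y n = y t n"
proof -
  have "(LEAST t. n < M (Suc t)) = t"
  proof (rule Least_equality)
    fix s assume "n < M (Suc s)"
    then show "t \<le> s" using assms(1,2) by (metis Suc_leI monoD not_less order_trans)
  qed (rule assms(3))
  then show ?thesis by (simp add: splice_at_def)
qed

text \<open>The block lies inside one piece, because the later switch times are multiples of
  \<open>m t\<close>; and a later piece still consists of words of stage \<open>t\<close>, because
  the dictionaries are nested.\<close>

lemma splice_at_block:
  assumes M: "strict_mono M" "M 0 = 0" "\<And>t. m t dvd M t" and m: "\<And>t. m t > 0" "\<And>t. m t dvd m (Suc t)"
    and W: "\<And>t. concats (m (Suc t)) (W (Suc t)) \<subseteq> concats (m t) (W t)" and y: "\<And>t. y t \<in> concats (m t) (W t)"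
    and q: "M t \<le> q * m t"
  shows "\<exists>w\<in>W t. \<forall>h<m t. splice_at M y (q * m t + h) = w h"
proof -
  have mono: "mono M" using M(1) by (rule strict_mono_mono)
  have ex: "\<exists>s. q * m t < M (Suc s)" using strict_mono_imp_increasing[OF M(1)] by (meson Suc_le_lessD)
  define s where "s = (LEAST s. q * m t < M (Suc s))"
  have s1: "q * m t < M (Suc s)" unfolding s_def using ex by (rule LeastI_ex)
  have s2: "M s \<le> q * m t"
  proof (cases s)
    case (Suc s')
    then have "s' < s" by simp
    then have "\<not> q * m t < M (Suc s')" unfolding s_def by (rule not_less_Least)
    then show ?thesis using Suc by simp
  qed (simp add: M(2))
  have ts: "t \<le> s"
  proof (rule ccontr)
    assume "\<not> t \<le> s"
    then have "M (Suc s) \<le> M t" using mono by (simp add: monoD)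
    then show False using s1 q by simp
  qed
  have dvd: "m t dvd m (t + k)" for k by (induction k) (auto intro: dvd_trans m(2))
  have "concats (m (t + k)) (W (t + k)) \<subseteq> concats (m t) (W t)" for k
    by (induction k) (use W in auto)
  then have "y s \<in> concats (m t) (W t)" using y[of s] ts by (metis le_add_diff_inverse subsetD)
  then obtain w where w: "w \<in> W t" "\<forall>h<m t. y s (q * m t + h) = w h" by (auto simp: concats_def)
  have "m t dvd M (Suc s)" using dvd[of "Suc s - t"] ts M(3)[of "Suc s"] by (auto intro: dvd_trans)
  then obtain b where b: "M (Suc s) = b * m t" by (metis dvdE mult.commute)
  then have "q < b" using s1 by simp
  then have "q * m t + m t \<le> M (Suc s)" unfolding b by (metis Suc_leI add.commute mult_Suc mult_le_mono1)
  then have "splice_at M y (q * m t + h) = y s (q * m t + h)" if "h < m t" for h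
    using that s2 by (intro splice_at_eq mono) auto
  then show ?thesis using w by auto
qed

text \<open>Altering an initial segment costs at most \<open>C * harm M / harm N\<close>; this is
  why the correlation times are chosen with \<open>harm N\<close> large compared to
  \<open>harm M\<close>.\<close>

lemma logmean_change_le:
  assumes eq: "\<And>n. M \<le> n \<Longrightarrow> n \<le> N \<Longrightarrow> f n = g n" and C: "\<And>n. \<bar>f n - g n\<bar> \<le> C"
    and D: "harm N \<ge> D * harm M" "D > 0" "N > 0"
  shows "\<bar>logmean f N - logmean g N\<bar> \<le> C / D"
proof -
  have C0: "C \<ge> 0" using C[of 0] by linarith
  have "\<bar>\<Sum>n=1..N. (f n - g n) / real n\<bar> \<le> (\<Sum>n=1..N. if n \<le> M then C / real n else 0)"
  proof (rule order_trans[OF sum_abs sum_mono])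
    fix n assume "n \<in> {1..N}"
    then show "\<bar>(f n - g n) / real n\<bar> \<le> (if n \<le> M then C / real n else 0)"
      using C[of n] eq[of n] by (auto simp: abs_divide divide_right_mono)
  qed
  also have "\<dots> = (\<Sum>n\<in>{1..N} \<inter> {..M}. C / real n)" 
    using sum.inter_restrict[of "{1..N}" "\<lambda>n. C / real n" "{..M}"] by simp
  also have "\<dots> \<le> (\<Sum>n\<in>{1..M}. C / real n)" using C0 by (intro sum_mono2) auto
  also have "\<dots> = C * harm M" by (simp add: harm_def sum_distrib_left divide_inverse)
  also have "\<dots> \<le> C * (harm N / D)" using D C0 by (intro mult_left_mono) (auto simp: field_simps)
  finally have "\<bar>\<Sum>n=1..N. (f n - g n) / real n\<bar> \<le> C / D * harm N" by simp
  moreover have "harm N > (0::real)" using D by simp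
  moreover have "logmean f N - logmean g N = (\<Sum>n=1..N. (f n - g n) / real n) / harm N"
    by (simp add: logmean_def sum_subtractf diff_divide_distrib)
  ultimately show ?thesis by (simp add: abs_divide pos_divide_le_eq)
qed

context log_limit
begin

lemma ex_zero_complexity_correlate:
  assumes A: "finite A" "s0 \<in> A" "\<And>s. s \<in> A \<Longrightarrow> e s > 0" "odd (e s0)" and nz: "L (corr A e) \<noteq> 0"
  shows "\<exists>y. finite (range y) \<and> zero_complexity y \<and> \<not> logmean (\<lambda>n. moebius n * y n) \<longlonglongrightarrow> 0"
proof -
  define c where "c = \<bar>L (corr A e)\<bar> / 2"
  \<comment> \<open>The rounding loss \<open>8 * \<eta>\<close> is half of \<open>c\<close>. At a
    finite \<open>N\<close> correlation \<open>c / 4\<close> remains, of which splicing costs at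
    most \<open>c / 8\<close> by the choice of \<open>D\<close>.\<close>
  define \<eta> where "\<eta> = c / 16"
  have c: "c > 0" and \<eta>: "\<eta> > 0" using nz by (auto simp: c_def \<eta>_def)
  have c2: "2 * c \<le> \<bar>L (corr A e)\<bar>" by (simp add: c_def)
  obtain G where G: "\<And>t. bdd_seq (G t)" "\<And>t. block_cov (\<eta> / 2 ^ t) (G t)"
    "\<And>t. L (\<lambda>n. \<bar>G t n - G (Suc t) n\<bar>) \<le> \<eta> / 2 ^ t" "\<And>t. \<bar>L (\<lambda>n. moebius n * G t n)\<bar> \<ge> c"
    using ex_structured_correlates[OF A c2 c \<eta>] by metis
  obtain m W y where mWy_all: "\<forall>t. m t > 0 \<and> m t dvd m (Suc t) \<and> finite (W t) \<and>
     real (card (W t)) \<le> exp (\<eta> / 2 ^ t * real (m t)) \<and> concats (m (Suc t)) (W (Suc t)) \<subseteq> concats (m t) (W t) \<and>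
     y t \<in> concats (m t) (W t) \<and> L (\<lambda>n. \<bar>G t n - y t n\<bar>) \<le> 8 * \<eta>"
    using ex_dictionaries[OF G(1-3) \<eta>] by (elim exE) (rule that)
  have mWy: "m t > 0" "m t dvd m (Suc t)" "finite (W t)" "real (card (W t)) \<le> exp (\<eta> / 2 ^ t * real (m t))"
    "concats (m (Suc t)) (W (Suc t)) \<subseteq> concats (m t) (W t)" "y t \<in> concats (m t) (W t)"
    "L (\<lambda>n. \<bar>G t n - y t n\<bar>) \<le> 8 * \<eta>" for t
    using mWy_all by blast+
  \<comment> \<open>Nestedness puts all \<open>y t\<close> over the finite alphabet of stage 0,
    whence a common bound and the finite range.\<close>
  have y0: "y t \<in> concats (m 0) (W 0)" for t
  proof -
    have "concats (m t) (W t) \<subseteq> concats (m 0) (W 0)" by (induction t) (use mWy(5) in auto)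
    then show ?thesis using mWy(6) by blast
  qed
  obtain C where C': "\<And>y n. y \<in> concats (m 0) (W 0) \<Longrightarrow> \<bar>y n\<bar> \<le> C" by (rule concats_bound[OF mWy(3) mWy(1), of 0 0]) (rule that)
  have C: "\<bar>y t n\<bar> \<le> C" for t n by (rule C'[OF y0])
  define B where "B = C + 1"
  have B: "\<bar>y t n\<bar> \<le> B" "B > 0" for t n using C[of t n] unfolding B_def by linarith+
  have bmu: "bdd_seq moebius" by (rule bdd_seqI[of _ 1]) (rule abs_moebius_le_1)
  have b_y: "bdd_seq (y t)" for t by (rule bdd_seqI) (rule B(1))
  have big: "\<bar>L (\<lambda>n. moebius n * y t n)\<bar> \<ge> 2 * (c / 4)" for t
  proof -
    have "\<bar>L (\<lambda>n. moebius n * G t n) - L (\<lambda>n. moebius n * y t n)\<bar> = \<bar>L (\<lambda>n. moebius n * G t n - moebius n * y t n)\<bar>"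
      by (subst L_diff) (auto intro!: bdd_intros bmu G b_y)
    also have "\<dots> \<le> L (\<lambda>n. \<bar>moebius n * G t n - moebius n * y t n\<bar>)" by (intro L_abs bdd_intros bmu G b_y)
    also have "\<dots> \<le> L (\<lambda>n. \<bar>G t n - y t n\<bar>)"
    proof (rule L_mono)
      fix n
      show "\<bar>moebius n * G t n - moebius n * y t n\<bar> \<le> \<bar>G t n - y t n\<bar>"
        using mult_right_mono[OF abs_moebius_le_1[of n], of "\<bar>G t n - y t n\<bar>"]
        by (simp add: right_diff_distrib [symmetric] abs_mult)
    qed (intro bdd_intros bmu G b_y)+
    also have "\<dots> \<le> c / 2" using mWy(7)[of t] by (simp add: \<eta>_def)
    finally show ?thesis using G(4)[of t] by linarith
  qed
  define D where "D = 16 * B / c"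
  have D: "D > 0" using B c by (simp add: D_def)
  \<comment> \<open>The next switch is placed beyond a time \<open>N\<close> at which the current
    sequence visibly correlates with \<open>moebius\<close>, so the spliced sequence has large means
    at arbitrarily late times.\<close>
  have "\<exists>M. \<forall>t. (m t dvd M t \<and> (t = 0 \<longrightarrow> M t = 0)) \<and> (M t < M (Suc t) \<and>
    (\<exists>N>M t. N < M (Suc t) \<and> \<bar>logmean (\<lambda>n. moebius n * y t n) N\<bar> \<ge> c / 4 \<and> harm N \<ge> D * harm (M t)))"
  proof (rule dependent_nat_choice)
    fix M t assume "m t dvd M \<and> (t = 0 \<longrightarrow> M = 0)"
    obtain N where N: "N \<ge> Suc M" "\<bar>logmean (\<lambda>n. moebius n * y t n) N\<bar> \<ge> c / 4" "harm N \<ge> D * harm M"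
      using ex_late_correlation[OF _ big[of t], of "Suc M" "D * harm M"] c by (auto intro: bdd_intros bmu b_y)
    have "Suc N * 1 \<le> Suc N * m (Suc t)" using mWy(1)[of "Suc t"] by (intro mult_le_mono2) simp
    then have "N < Suc N * m (Suc t)" by simp
    then show "\<exists>M'. (m (Suc t) dvd M' \<and> (Suc t = 0 \<longrightarrow> M' = 0)) \<and> M < M' \<and>
      (\<exists>N>M. N < M' \<and> \<bar>logmean (\<lambda>n. moebius n * y t n) N\<bar> \<ge> c / 4 \<and> harm N \<ge> D * harm M)"
      using N by (intro exI[of _ "Suc N * m (Suc t)"]) (auto intro!: exI[of _ N])
  qed (use dvd_0_right in blast)
  then obtain M where M_all: "\<forall>t. (m t dvd M t \<and> (t = 0 \<longrightarrow> M t = 0)) \<and> (M t < M (Suc t) \<and>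
    (\<exists>N>M t. N < M (Suc t) \<and> \<bar>logmean (\<lambda>n. moebius n * y t n) N\<bar> \<ge> c / 4 \<and> harm N \<ge> D * harm (M t)))"
    by (elim exE) (rule that)
  have M: "\<And>t. m t dvd M t" "M 0 = 0" "\<And>t. M t < M (Suc t)" using M_all by blast+
  have MN: "\<exists>N>M t. N < M (Suc t) \<and> \<bar>logmean (\<lambda>n. moebius n * y t n) N\<bar> \<ge> c / 4 \<and> harm N \<ge> D * harm (M t)" for t
    using M_all by blast
  have sm: "strict_mono M" using M(3) by (simp add: strict_mono_Suc_iff)
  define z where "z = splice_at M y"
  have block: "\<exists>w\<in>W t. \<forall>h<m t. z (q * m t + h) = w h" if "M t \<le> q * m t" for t q
    unfolding z_def by (rule splice_at_block[OF sm M(2) M(1) mWy(1,2,5,6) that])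
  have zB: "\<bar>z n\<bar> \<le> B" for n by (simp add: z_def splice_at_def B)
  have "z \<in> concats (m 0) (W 0)" using block[of 0] by (simp add: concats_def M(2))
  then have "finite (range z)"
    using concats_finite_range[OF _ mWy(1)[of 0]] mWy(3)[of 0] by (meson finite_UN_I finite_imageI finite_lessThan finite_subset)
  moreover have "zero_complexity z"
    unfolding zero_complexity_def
  proof (intro allI impI)
    fix \<delta> :: real assume "\<delta> > 0"
    have "(\<lambda>t. \<eta> * (1 / 2) ^ t) \<longlonglongrightarrow> \<eta> * 0" by (intro tendsto_mult tendsto_const LIMSEQ_power_zero) auto
    then have "eventually (\<lambda>t. \<eta> * (1 / 2) ^ t < \<delta>) sequentially"
      using \<open>\<delta> > 0\<close> by (intro order_tendstoD(2)) auto
    then obtain t where t: "\<eta> * (1 / 2) ^ t < \<delta>" by (auto simp: eventually_sequentially)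
    have "\<eta> / 2 ^ t * real (m t) \<le> \<delta> * real (m t)"
      using t by (intro mult_right_mono) (auto simp: power_one_over)
    then have "real (card (W t)) \<le> exp (\<delta> * real (m t))" using mWy(4)[of t] by (meson exp_le_cancel_iff order_trans)
    then show "\<exists>m W M. m > 0 \<and> finite W \<and> real (card W) \<le> exp (\<delta> * real m) \<and>
       (\<forall>q. M \<le> q * m \<longrightarrow> (\<exists>w\<in>W. \<forall>h<m. z (q * m + h) = w h))"
      using mWy(1,3) block[of t] by blast
  qed
  moreover have "\<not> logmean (\<lambda>n. moebius n * z n) \<longlonglongrightarrow> 0"
  proof
    assume lim: "logmean (\<lambda>n. moebius n * z n) \<longlonglongrightarrow> 0"
    have "eventually (\<lambda>N. \<bar>logmean (\<lambda>n. moebius n * z n) N\<bar> < c / 8) sequentially"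
      using tendstoD[OF lim, of "c / 8"] c by (simp add: dist_real_def)
    then obtain N0 where N0: "\<And>N. N \<ge> N0 \<Longrightarrow> \<bar>logmean (\<lambda>n. moebius n * z n) N\<bar> < c / 8"
      by (auto simp: eventually_sequentially)
    obtain N where N: "M N0 < N" "N < M (Suc N0)" "\<bar>logmean (\<lambda>n. moebius n * y N0 n) N\<bar> \<ge> c / 4" "harm N \<ge> D * harm (M N0)"
      using MN[of N0] by blast
    have "\<bar>logmean (\<lambda>n. moebius n * z n) N - logmean (\<lambda>n. moebius n * y N0 n) N\<bar> \<le> 2 * B / D"
    proof (rule logmean_change_le)
      fix n assume "M N0 \<le> n" "n \<le> N"
      then show "moebius n * z n = moebius n * y N0 n"
        using N by (simp add: z_def splice_at_eq strict_mono_mono[OF sm])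
    next
      fix n
      have "\<bar>moebius n * z n - moebius n * y N0 n\<bar> = \<bar>moebius n\<bar> * \<bar>z n - y N0 n\<bar>"
        by (simp add: right_diff_distrib [symmetric] abs_mult)
      also have "\<dots> \<le> 1 * \<bar>z n - y N0 n\<bar>" by (intro mult_right_mono abs_moebius_le_1) auto
      also have "\<dots> \<le> 2 * B" using abs_triangle_ineq4[of "z n" "y N0 n"] zB[of n] B(1)[of N0 n] by simp
      finally show "\<bar>moebius n * z n - moebius n * y N0 n\<bar> \<le> 2 * B" .
    qed (use N D in auto)
    also have "2 * B / D = c / 8" using B c by (simp add: D_def)
    finally have "\<bar>logmean (\<lambda>n. moebius n * z n) N\<bar> \<ge> c / 8" using N(3) by linarith
    moreover have "N0 \<le> N" using strict_mono_imp_increasing[OF sm, of N0] N(1) by simp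
    ultimately show False using N0[of N] by simp
  qed
  ultimately show ?thesis by blast
qed

end

section \<open>Subshifts of zero entropy and the logarithmic Chowla conjecture\<close>

definition subwords :: "(nat \<Rightarrow> 'a) \<Rightarrow> nat \<Rightarrow> 'a list set" where
  "subwords y N = range (\<lambda>k. map (\<lambda>i. y (k + i)) [0..<N])"

lemma finite_subwords:
  assumes "finite (range y)"
  shows "finite (subwords y N)"
  by (rule finite_subset[OF _ finite_lists_length_eq[OF assms, of N]]) (auto simp: subwords_def)

text \<open>A word starting far out is a window in a concatenation of \<open>N div m + 2\<close>
  dictionary words, determined by these words and one of \<open>m\<close> offsets; the other
  starting points contribute at most \<open>M + m\<close> words.\<close>

lemma card_subwords_le:
  assumes "zero_complexity y" "\<delta> > 0"
  shows "\<exists>C\<ge>1. \<forall>N. real (card (subwords y N)) \<le> C * exp (\<delta> * real N)"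
proof -
  obtain m W M where m: "m > 0" "finite W" "real (card W) \<le> exp (\<delta> * real m)"
    and blk: "\<forall>q. M \<le> q * m \<longrightarrow> (\<exists>w\<in>W. \<forall>h<m. y (q * m + h) = w h)"
    using assms(1)[unfolded zero_complexity_def, rule_format, OF assms(2)] by (elim exE conjE) (rule that)
  define C where "C = real (M + m) + real m * exp (2 * (\<delta> * real m))"
  have "real (card (subwords y N)) \<le> C * exp (\<delta> * real N)" for N
  proof -
    define l where "l = N div m + 2"
    define A where "A = (\<lambda>k. map (\<lambda>i. y (k + i)) [0..<N]) ` {..<M + m}"
    define B where "B = (\<lambda>(t, ws). map (\<lambda>i. (ws ! ((t + i) div m)) ((t + i) mod m)) [0..<N]) `
       ({..<m} \<times> {ws. set ws \<subseteq> W \<and> length ws = l})"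
    have finl: "finite {ws. set ws \<subseteq> W \<and> length ws = l}" by (rule finite_lists_length_eq[OF m(2)])
    have "subwords y N \<subseteq> A \<union> B"
    proof
      fix v assume "v \<in> subwords y N"
      then obtain k where v: "v = map (\<lambda>i. y (k + i)) [0..<N]" by (auto simp: subwords_def)
      show "v \<in> A \<union> B"
      proof (cases "k < M + m")
        case True
        then show ?thesis by (auto simp: v A_def)
      next
        case False
        define q where "q = k div m"
        define t where "t = k mod m"
        have k: "k = q * m + t" "t < m" using m(1) by (auto simp: q_def t_def)
        then have "M \<le> (q + j) * m" for j using False by (simp add: distrib_right)
        then have "\<forall>j. \<exists>w\<in>W. \<forall>h<m. y ((q + j) * m + h) = w h" using blk by blast
        then obtain w where w: "\<And>j. w j \<in> W" "\<And>j h. h < m \<Longrightarrow> y ((q + j) * m + h) = w j h" by metis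
        define ws where "ws = map w [0..<l]"
        have "map (\<lambda>i. y (k + i)) [0..<N] = map (\<lambda>i. (ws ! ((t + i) div m)) ((t + i) mod m)) [0..<N]"
        proof (rule map_cong[OF refl])
          fix i assume "i \<in> set [0..<N]"
          then have i: "i < N" by simp
          have "t + i < m + N" using k(2) i by simp
          then have "(t + i) div m \<le> (m + N) div m" by (intro div_le_mono) simp
          also have "\<dots> = N div m + 1" using m(1) by simp
          finally have lt: "(t + i) div m < l" by (simp add: l_def)
          have "k + i = (q + (t + i) div m) * m + (t + i) mod m"
            using k(1) by (simp add: distrib_right)
          then have "y (k + i) = w ((t + i) div m) ((t + i) mod m)"
            using w(2)[of "(t + i) mod m" "(t + i) div m"] m(1) by simp
          then show "y (k + i) = (ws ! ((t + i) div m)) ((t + i) mod m)" using lt by (simp add: ws_def)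
        qed
        then have "v \<in> B" unfolding B_def v
          using k(2) w(1) by (intro image_eqI[of _ _ "(t, ws)"]) (auto simp: ws_def)
        then show ?thesis by simp
      qed
    qed
    then have "card (subwords y N) \<le> card (A \<union> B)"
      using finl by (intro card_mono) (auto simp: A_def B_def)
    also have "\<dots> \<le> card A + card B" by (rule card_Un_le)
    also have "\<dots> \<le> (M + m) + m * card W ^ l"
    proof (rule add_mono)
      show "card A \<le> M + m" unfolding A_def using card_image_le[of "{..<M + m}"] by simp
      have "card B \<le> card ({..<m} \<times> {ws. set ws \<subseteq> W \<and> length ws = l})"
        unfolding B_def using finl by (intro card_image_le) auto
      then show "card B \<le> m * card W ^ l" using card_lists_length_eq[OF m(2), of l] by (simp add: card_cartesian_product)
    qed
    finally have "real (card (subwords y N)) \<le> real (M + m) + real m * real (card W) ^ l"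
      by (metis of_nat_add of_nat_le_iff of_nat_mult of_nat_power)
    also have "\<dots> \<le> real (M + m) * exp (\<delta> * real N) + real m * (exp (2 * (\<delta> * real m)) * exp (\<delta> * real N))"
    proof (intro add_mono mult_left_mono)
      show "real (M + m) \<le> real (M + m) * exp (\<delta> * real N)"
        using assms(2) mult_left_mono[of 1 "exp (\<delta> * real N)" "real (M + m)"] by simp
      have "real (card W) ^ l \<le> exp (\<delta> * real m) ^ l" using m(3) by (intro power_mono) auto
      also have "\<dots> = exp (\<delta> * (real m * real l))" by (simp add: exp_of_nat_mult [symmetric] mult_ac)
      also have "\<dots> \<le> exp (\<delta> * (2 * real m + real N))"
      proof -
        have "m * l \<le> 2 * m + N" by (simp add: l_def distrib_left)
        then have "real m * real l \<le> 2 * real m + real N"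
          by (metis (no_types, lifting) of_nat_add of_nat_le_iff of_nat_mult of_nat_numeral)
        then show ?thesis using assms(2) by simp
      qed
      also have "\<dots> = exp (2 * (\<delta> * real m)) * exp (\<delta> * real N)"
        by (simp add: exp_add [symmetric] algebra_simps)
      finally show "real (card W) ^ l \<le> exp (2 * (\<delta> * real m)) * exp (\<delta> * real N)" .
    qed auto
    also have "\<dots> = C * exp (\<delta> * real N)" by (simp add: C_def distrib_right mult.assoc)
    finally show ?thesis .
  qed
  moreover have "C \<ge> 1" using m(1) by (simp add: C_def add_increasing2)
  ultimately show ?thesis by blast
qed

text \<open>Sequences over \<open>{..<b}\<close> are coded by expansions in base \<open>b + 1\<close>. Since the digit \<open>b\<close> never occurs,
  the code is injective, the leading digit is the integer part, and the integer part is locally constant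
  on the set of codes; so the shift becomes a continuous map for the usual metric.\<close>

definition expansion :: "nat \<Rightarrow> (nat \<Rightarrow> nat) \<Rightarrow> real" where
  "expansion b x = (\<Sum>i. real (x i) * (1 / (real b + 1)) ^ i)"

text \<open>The fractional part \<open>1 - 1 / b\<close> belongs to a tail of digits all equal to
  \<open>b - 1\<close>; the gaps of length \<open>1 / b\<close> between the intervals make the
  integer part locally constant.\<close>

definition expansion_dom :: "nat \<Rightarrow> real set" where
  "expansion_dom b = (\<Union>j<b. {real j .. real j + (1 - 1 / real b)})"

definition expansion_shift :: "nat \<Rightarrow> real \<Rightarrow> real" where
  "expansion_shift b r = (real b + 1) * (r - of_int \<lfloor>r\<rfloor>)"

lemma expansion_summable:
  assumes "\<And>i. x i < b"
  shows "summable (\<lambda>i. real (x i) * (1 / (real b + 1)) ^ i)"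
proof (rule summable_comparison_test')
  have "b > 0" using assms[of 0] by simp
  then show "summable (\<lambda>i. real b * (1 / (real b + 1)) ^ i)"
    by (intro summable_mult summable_geometric) simp
  show "\<And>n. n \<ge> 0 \<Longrightarrow> norm (real (x n) * (1 / (real b + 1)) ^ n) \<le> real b * (1 / (real b + 1)) ^ n"
    using assms by (simp add: abs_mult power_abs) (metis less_imp_le mult_right_mono of_nat_le_iff of_nat_0_le_iff zero_le_power divide_nonneg_nonneg add_nonneg_nonneg zero_le_one)
qed

lemma expansion_rec:
  assumes "\<And>i. x i < b"
  shows "expansion b x = real (x 0) + expansion b (\<lambda>i. x (Suc i)) / (real b + 1)"
proof -
  have "expansion b x = (\<Sum>i. real (x (Suc i)) * (1 / (real b + 1)) ^ Suc i) + real (x 0)"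
    unfolding expansion_def by (subst suminf_split_head[OF expansion_summable[OF assms]]) simp
  also have "(\<lambda>i. real (x (Suc i)) * (1 / (real b + 1)) ^ Suc i) = (\<lambda>i. (1 / (real b + 1)) * (real (x (Suc i)) * (1 / (real b + 1)) ^ i))"
    by simp
  also have "suminf \<dots> = (1 / (real b + 1)) * expansion b (\<lambda>i. x (Suc i))"
    unfolding expansion_def by (rule suminf_mult) (rule expansion_summable, rule assms)
  finally show ?thesis by simp
qed

lemma expansion_bounds:
  assumes "\<And>i. x i < b"
  shows "0 \<le> expansion b x" "expansion b x \<le> real b - 1 / real b"
proof -
  have b: "b > 0" using assms[of 0] by simp
  show "0 \<le> expansion b x" unfolding expansion_def by (intro suminf_nonneg expansion_summable assms) auto
  have "expansion b x \<le> (\<Sum>i. (real b - 1) * (1 / (real b + 1)) ^ i)"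
    unfolding expansion_def
  proof (rule suminf_le)
    fix i
    have "real (x i) \<le> real b - 1" using assms[of i] by linarith
    then show "real (x i) * (1 / (real b + 1)) ^ i \<le> (real b - 1) * (1 / (real b + 1)) ^ i"
      by (intro mult_right_mono) auto
  qed (use b in \<open>auto intro!: expansion_summable assms summable_mult summable_geometric\<close>)
  also have "\<dots> = (real b - 1) * (1 / (1 - 1 / (real b + 1)))"
  proof -
    have "norm (1 / (real b + 1)) < 1" using b by simp
    then show ?thesis by (simp only: suminf_mult[OF summable_geometric] suminf_geometric)
  qed
  also have "1 - 1 / (real b + 1) = real b / (real b + 1)" by (simp add: field_simps)
  also have "(real b - 1) * (1 / (real b / (real b + 1))) = ((real b - 1) * (real b + 1)) / real b" by simp
  also have "\<dots> = real b - 1 / real b" by (simp add: algebra_simps diff_divide_distrib add_divide_distrib)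
  finally show "expansion b x \<le> real b - 1 / real b" .
qed

lemma expansion_floor:
  assumes "\<And>i. x i < b"
  shows "real (x 0) \<le> expansion b x" "expansion b x \<le> real (x 0) + (1 - 1 / real b)" "\<lfloor>expansion b x\<rfloor> = int (x 0)"
proof -
  have b: "b > 0" using assms[of 0] by simp
  define z where "z = expansion b (\<lambda>i. x (Suc i))"
  have z: "0 \<le> z" "z \<le> real b - 1 / real b" unfolding z_def by (intro expansion_bounds assms)+
  have eq: "expansion b x = real (x 0) + z / (real b + 1)" unfolding z_def by (rule expansion_rec[OF assms])
  have "z / (real b + 1) \<le> (real b - 1 / real b) / (real b + 1)" using z by (intro divide_right_mono) auto
  also have "real b - 1 / real b = (1 - 1 / real b) * (real b + 1)" using b by (simp add: algebra_simps add_divide_distrib)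
  also have "\<dots> / (real b + 1) = 1 - 1 / real b" by simp
  finally have le: "z / (real b + 1) \<le> 1 - 1 / real b" .
  show "real (x 0) \<le> expansion b x" "expansion b x \<le> real (x 0) + (1 - 1 / real b)" using le z eq by auto
  have "1 - 1 / real b < 1" using b by simp
  moreover have "0 \<le> z / (real b + 1)" using z by simp
  ultimately show "\<lfloor>expansion b x\<rfloor> = int (x 0)"
    using le eq by (intro floor_unique; simp only: of_int_of_nat_eq; linarith)
qed

lemma expansion_in_dom: "(\<And>i. x i < b) \<Longrightarrow> expansion b x \<in> expansion_dom b"
  unfolding expansion_dom_def using expansion_floor(1,2)[of x b] by (auto intro!: bexI[of _ "x 0"])

lemma expansion_shift_expansion:
  assumes "\<And>i. x i < b"
  shows "expansion_shift b (expansion b x) = expansion b (\<lambda>i. x (Suc i))"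
proof -
  have "expansion b x - of_int \<lfloor>expansion b x\<rfloor> = expansion b (\<lambda>i. x (Suc i)) / (real b + 1)"
    using expansion_rec[of x b, OF assms] unfolding expansion_floor(3)[of x b, OF assms] by linarith
  then show ?thesis by (simp add: expansion_shift_def)
qed

lemma expansion_shift_funpow:
  assumes "\<And>i. x i < b"
  shows "(expansion_shift b ^^ k) (expansion b x) = expansion b (\<lambda>i. x (i + k))"
proof (induction k)
  case (Suc k)
  then show ?case using expansion_shift_expansion[of "\<lambda>i. x (i + k)" b] assms by simp
qed simp

lemma floor_eq_expansion_dom:
  assumes "r \<in> expansion_dom b" "r' \<in> expansion_dom b" "\<bar>r - r'\<bar> < 1 / real b"
  shows "\<lfloor>r\<rfloor> = \<lfloor>r'\<rfloor>"
proof -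
  obtain j where j: "j < b" "real j \<le> r" "r \<le> real j + (1 - 1 / real b)" using assms(1) by (auto simp: expansion_dom_def)
  obtain j' where j': "j' < b" "real j' \<le> r'" "r' \<le> real j' + (1 - 1 / real b)" using assms(2) by (auto simp: expansion_dom_def)
  have b: "1 / real b > 0" using j by simp
  have "j = j'"
  proof (rule ccontr)
    assume "j \<noteq> j'"
    then consider "real j + 1 \<le> real j'" | "real j' + 1 \<le> real j" by linarith
    then show False using j j' assms(3) by cases linarith+
  qed
  moreover have "\<lfloor>r\<rfloor> = int j" using j b by (intro floor_unique; simp only: of_int_of_nat_eq; linarith)
  moreover have "\<lfloor>r'\<rfloor> = int j'" using j' b by (intro floor_unique; simp only: of_int_of_nat_eq; linarith)
  ultimately show ?thesis by simp
qed

lemma continuous_on_floor_expansion_dom: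
  fixes h :: "int \<Rightarrow> 'a :: metric_space"
  assumes "b > 0"
  shows "continuous_on (expansion_dom b) (\<lambda>r. h \<lfloor>r\<rfloor>)"
  unfolding continuous_on_iff
proof (intro ballI allI impI)
  fix r e assume r: "r \<in> expansion_dom b" "(0::real) < e"
  show "\<exists>d>0. \<forall>r'\<in>expansion_dom b. dist r' r < d \<longrightarrow> dist (h \<lfloor>r'\<rfloor>) (h \<lfloor>r\<rfloor>) < e"
  proof (intro exI[of _ "1 / real b"] conjI ballI impI)
    fix r' assume "r' \<in> expansion_dom b" "dist r' r < 1 / real b"
    then have "\<lfloor>r'\<rfloor> = \<lfloor>r\<rfloor>" by (intro floor_eq_expansion_dom[OF _ r(1)]) (auto simp: dist_real_def)
    then show "dist (h \<lfloor>r'\<rfloor>) (h \<lfloor>r\<rfloor>) < e" using r(2) by simp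
  qed (use assms in simp)
qed

lemma expansion_dom_compact: "compact (expansion_dom b)"
  unfolding expansion_dom_def by (intro compact_UN) auto

section \<open>Entropy of the coded subshift\<close>

lemma topological_entropy_eq_0I:
  assumes "\<And>\<epsilon> \<delta>. \<epsilon> > 0 \<Longrightarrow> \<delta> > 0 \<Longrightarrow> \<exists>C\<ge>1. \<forall>n. real (max_separated m T n \<epsilon>) \<le> C * exp (\<delta> * real n)"
  shows "topological_entropy m T = 0"
proof -
  define X where "X \<epsilon> n = ereal (ln (real (max_separated m T n \<epsilon>)) / real n)" for \<epsilon> n
  \<comment> \<open>Conventions decide the degenerate cases: \<open>ln 0 = 0\<close>, and division
    by 0 gives 0.\<close>
  have nonneg: "0 \<le> X \<epsilon> n" for \<epsilon> n
  proof (cases "max_separated m T n \<epsilon> = 0")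
    case False
    then show ?thesis by (simp add: X_def)
  qed (simp add: X_def)
  have ge: "0 \<le> limsup (X \<epsilon>)" for \<epsilon> by (rule le_Limsup) (auto simp: nonneg)
  have le: "limsup (X \<epsilon>) \<le> 0" if \<epsilon>: "\<epsilon> > 0" for \<epsilon>
  proof (rule ereal_le_epsilon2)
    fix \<delta> :: real assume \<delta>: "\<delta> > 0"
    obtain C where C: "C \<ge> 1" "\<And>n. real (max_separated m T n \<epsilon>) \<le> C * exp (\<delta> / 2 * real n)"
      using assms[OF \<epsilon>, of "\<delta> / 2"] \<delta> by auto
    define n0 where "n0 = nat \<lceil>ln C / (\<delta> / 2)\<rceil> + 1"
    have "X \<epsilon> n \<le> ereal \<delta>" if "n \<ge> n0" for n
    proof -
      have n: "n > 0" "ln C / (\<delta> / 2) \<le> real n" using that by (simp_all add: n0_def) linarith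
      then have lnC: "ln C \<le> \<delta> / 2 * real n" using \<delta> by (simp add: field_simps)
      have "ln (real (max_separated m T n \<epsilon>)) \<le> \<delta> * real n"
      proof (cases "max_separated m T n \<epsilon> = 0")
        case True
        then show ?thesis using \<delta> by simp
      next
        case False
        then have "ln (real (max_separated m T n \<epsilon>)) \<le> ln (C * exp (\<delta> / 2 * real n))"
          using C by (intro ln_mono) auto
        also have "\<dots> = ln C + \<delta> / 2 * real n" using C by (simp add: ln_mult)
        finally show ?thesis using lnC by simp
      qed
      then show ?thesis using n by (simp add: X_def pos_divide_le_eq)
    qed
    then have "limsup (X \<epsilon>) \<le> ereal \<delta>" by (intro Limsup_bounded) (auto simp: eventually_sequentially)
    then show "limsup (X \<epsilon>) \<le> 0 + ereal \<delta>" by simp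
  qed
  have "topological_entropy m T = (SUP \<epsilon>\<in>{0<..}. limsup (X \<epsilon>))"
    unfolding topological_entropy_def X_def ..
  also have "\<dots> = (SUP \<epsilon>\<in>{0::real<..}. 0)" using le ge by (intro SUP_cong refl antisym) auto
  finally show ?thesis by (simp add: SUP_constant)
qed

text \<open>As long as the integer parts agree, both points move under the same affine map of slope
  \<open>b + 1\<close>.\<close>

lemma expansion_orbit_expanding:
  assumes inv: "\<And>r. r \<in> K \<Longrightarrow> expansion_shift b r \<in> K" and r: "r \<in> K" "u \<in> K"
    and eq: "\<And>i. i < N \<Longrightarrow> \<lfloor>(expansion_shift b ^^ i) r\<rfloor> = \<lfloor>(expansion_shift b ^^ i) u\<rfloor>"
  shows "\<bar>(expansion_shift b ^^ N) r - (expansion_shift b ^^ N) u\<bar> = (real b + 1) ^ N * \<bar>r - u\<bar>"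
  using eq
proof (induction N)
  case (Suc N)
  have fl: "\<lfloor>(expansion_shift b ^^ N) r\<rfloor> = \<lfloor>(expansion_shift b ^^ N) u\<rfloor>" by (rule Suc.prems) simp
  have "(expansion_shift b ^^ Suc N) r - (expansion_shift b ^^ Suc N) u =
      (real b + 1) * ((expansion_shift b ^^ N) r - (expansion_shift b ^^ N) u)"
    by (simp add: expansion_shift_def[of b "(expansion_shift b ^^ N) _"] fl right_diff_distrib)
  then show ?case using Suc by (simp add: abs_mult)
qed simp

text \<open>The subshift generated by \<open>y\<close> is realised as the closure of the codes of
  its shifts. Points with equal itineraries of length \<open>n + k\<close> stay closer than
  \<open>\<epsilon>\<close> for \<open>n\<close> steps, so separated sets inject into the words of
  \<open>y\<close>, whose number grows subexponentially.\<close>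

lemma Sarnak_finite_range:
  assumes Sarnak: "Sarnak_conjecture" and fin: "finite (range y)" and y: "zero_complexity y"
  shows "(\<lambda>N. (\<Sum>n=1..N. moebius n * y n) / real N) \<longlonglongrightarrow> 0"
proof -
  define b where "b = card (range y)"
  have b: "b > 0" using fin by (simp add: b_def card_gt_0_iff)
  obtain d where d: "bij_betw d (range y) {..<b}"
    using ex_bij_betw_finite_nat[OF fin] by (auto simp: b_def atLeast0LessThan)
  define v where "v = inv_into (range y) d"
  define s where "s n = d (y n)" for n
  have s: "s n < b" for n using d by (auto simp: s_def bij_betw_def)
  have vs: "v (s n) = y n" for n using d by (simp add: v_def s_def bij_betw_def inv_into_f_f)
  define T where "T = expansion_shift b"
  define p where "p k = expansion b (\<lambda>i. s (i + k))" for k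
  define K where "K = closure (range p)"
  have T_p: "(T ^^ i) (p k) = p (k + i)" for i k
    using expansion_shift_funpow[of "\<lambda>i. s (i + k)" b i] s by (simp add: T_def p_def add_ac)
  have fl_p: "\<lfloor>p k\<rfloor> = int (s k)" for k
    using expansion_floor(3)[of "\<lambda>i. s (i + k)" b] s by (simp add: p_def)
  have "range p \<subseteq> expansion_dom b" using s by (auto simp: p_def intro: expansion_in_dom)
  then have KD: "K \<subseteq> expansion_dom b"
    unfolding K_def by (intro closure_minimal compact_imp_closed expansion_dom_compact)
  have Kc: "compact K" using KD expansion_dom_compact unfolding K_def
    by (metis compact_Int_closed closed_closure inf.absorb_iff2)
  have contT: "continuous_on K T"
    unfolding T_def expansion_shift_def
    by (intro continuous_intros continuous_on_subset[OF continuous_on_floor_expansion_dom[OF b] KD])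
  have pK: "p k \<in> K" for k unfolding K_def using closure_subset[of "range p"] by auto
  have "T ` K \<subseteq> K" unfolding K_def
  proof (rule image_closure_subset)
    show "continuous_on (closure (range p)) T" using contT by (simp add: K_def)
    show "T ` range p \<subseteq> closure (range p)"
      using T_p[of 1] pK by (auto simp: K_def)
  qed simp
  then have TK: "T r \<in> K" if "r \<in> K" for r using that by blast
  have TKi: "(T ^^ i) r \<in> K" if "r \<in> K" for r i by (induction i) (auto simp: that TK)
  define m where "m = submetric euclidean_metric K"
  have mtop: "mtopology_of m = top_of_set K" by (simp add: m_def mtopology_of_submetric)
  have [simp]: "mspace m = K" "mdist m = dist" by (simp_all add: m_def)
  define wd where "wd N r = map (\<lambda>i. \<lfloor>(T ^^ i) r\<rfloor>) [0..<N]" for N r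
  have wd_in: "wd N r \<in> (map (\<lambda>z. int (d z))) ` subwords y N" if r: "r \<in> K" for N r
  proof -
    \<comment> \<open>After up to \<open>N\<close> expansions by \<open>b + 1\<close> the distance
      is still below the gap \<open>1 / b\<close>, so a limit point has the same first
      \<open>N\<close> integer parts as some orbit point.\<close>
    define e where "e = 1 / real b / (real b + 1) ^ N"
    have "e > 0" using b by (simp add: e_def)
    then obtain k where k: "dist (p k) r < e" using r unfolding K_def closure_approachable by blast
    have "\<lfloor>(T ^^ i) (p k)\<rfloor> = \<lfloor>(T ^^ i) r\<rfloor>" if "i < N" for i
      using that
    proof (induction i rule: less_induct)
      case (less i)
      have "\<bar>(T ^^ i) (p k) - (T ^^ i) r\<bar> = (real b + 1) ^ i * \<bar>p k - r\<bar>"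
        unfolding T_def by (rule expansion_orbit_expanding[of K]) (use TK less r pK in \<open>auto simp: T_def\<close>)
      also have "\<dots> \<le> (real b + 1) ^ N * \<bar>p k - r\<bar>"
        using less.prems by (intro mult_right_mono power_increasing) auto
      also have "\<dots> < (real b + 1) ^ N * e" using k by (intro mult_strict_left_mono) (auto simp: dist_real_def)
      also have "\<dots> = 1 / real b" using b by (simp add: e_def)
      finally show ?case using TKi pK r KD by (intro floor_eq_expansion_dom[of _ b]) auto
    qed
    then have "wd N r = map (\<lambda>i. int (s (k + i))) [0..<N]"
      by (auto simp: wd_def T_p fl_p intro!: map_cong)
    then show ?thesis by (auto simp: subwords_def s_def intro!: image_eqI[of _ _ "map (\<lambda>i. y (k + i)) [0..<N]"])
  qed
  have sep: "\<exists>k. \<forall>n. max_separated m T n \<epsilon> \<le> card (subwords y (n + k))" if \<epsilon>: "\<epsilon> > 0" for \<epsilon>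
  proof -
    \<comment> \<open>Points of \<open>K\<close> differ by at most \<open>b\<close>; if
      \<open>k\<close> further digits agree, expansion forces the distance down to
      \<open>b / (b + 1) ^ k\<close>.\<close>
    have "(\<lambda>k. real b * (1 / (real b + 1)) ^ k) \<longlonglongrightarrow> real b * 0"
      using b by (intro tendsto_mult tendsto_const LIMSEQ_power_zero) auto
    then have "eventually (\<lambda>k. real b * (1 / (real b + 1)) ^ k < \<epsilon>) sequentially"
      using \<epsilon> by (intro order_tendstoD(2)) auto
    then obtain k where k: "real b * (1 / (real b + 1)) ^ k < \<epsilon>" by (auto simp: eventually_sequentially)
    have "card S \<le> card (subwords y (n + k))" if S: "separated_set m T n \<epsilon> S" for S n
    proof -
      have SK: "S \<subseteq> K" "finite S" using S by (auto simp: separated_set_def)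
      have inj: "inj_on (wd (n + k)) S"
      proof (rule inj_onI, rule ccontr)
        fix r u assume ru: "r \<in> S" "u \<in> S" "wd (n + k) r = wd (n + k) u" "r \<noteq> u"
        then have eq: "\<lfloor>(T ^^ i) r\<rfloor> = \<lfloor>(T ^^ i) u\<rfloor>" if "i < n + k" for i
          using that by (auto simp: wd_def)
        have "\<forall>x\<in>S. \<forall>y\<in>S. x \<noteq> y \<longrightarrow> (\<exists>i<n. dist ((T ^^ i) x) ((T ^^ i) y) > \<epsilon>)"
          using S by (simp add: separated_set_def)
        from this[rule_format, OF ru(1,2,4)]
        obtain i where i: "i < n" "dist ((T ^^ i) r) ((T ^^ i) u) > \<epsilon>" by (elim exE conjE) (rule that)
        have K2: "(T ^^ i) r \<in> K" "(T ^^ i) u \<in> K" using TKi SK ru by auto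
        have "\<bar>(T ^^ k) ((T ^^ i) r) - (T ^^ k) ((T ^^ i) u)\<bar> = (real b + 1) ^ k * \<bar>(T ^^ i) r - (T ^^ i) u\<bar>"
          unfolding T_def
        proof (rule expansion_orbit_expanding[of K])
          fix j assume "j < k"
          then show "\<lfloor>(expansion_shift b ^^ j) ((expansion_shift b ^^ i) r)\<rfloor> = \<lfloor>(expansion_shift b ^^ j) ((expansion_shift b ^^ i) u)\<rfloor>"
            using eq[of "j + i"] i by (simp add: T_def funpow_add)
        qed (use TK K2 in \<open>auto simp: T_def\<close>)
        moreover have "\<bar>a - c\<bar> \<le> real b" if ac: "a \<in> K" "c \<in> K" for a c
        proof -
          have "0 \<le> a \<and> a \<le> real b" if "a \<in> K" for a
          proof -
            have "a \<in> expansion_dom b" using that KD by blast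
            then obtain j where j: "j < b" "real j \<le> a" "a \<le> real j + (1 - 1 / real b)" by (auto simp: expansion_dom_def)
            have "real j + 1 \<le> real b" "1 / real b > 0" using j(1) by auto
            then show ?thesis using j by linarith
          qed
          from this[OF ac(1)] this[OF ac(2)] show ?thesis by linarith
        qed
        ultimately have "(real b + 1) ^ k * \<bar>(T ^^ i) r - (T ^^ i) u\<bar> \<le> real b"
          using TKi K2 by metis
        then have "\<bar>(T ^^ i) r - (T ^^ i) u\<bar> \<le> real b * (1 / (real b + 1)) ^ k"
          by (simp add: power_one_over field_simps)
        then show False using i k by (simp add: dist_real_def)
      qed
      have "card S \<le> card ((map (\<lambda>z. int (d z))) ` subwords y (n + k))"
        using wd_in SK by (intro card_inj_on_le[OF inj] finite_imageI finite_subwords fin) auto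
      also have "\<dots> \<le> card (subwords y (n + k))" by (intro card_image_le finite_subwords fin)
      finally show ?thesis .
    qed
    \<comment> \<open>The empty set keeps the supremum from being taken over an empty
      family.\<close>
    moreover have "separated_set m T n \<epsilon> {}" for n by (simp add: separated_set_def)
    ultimately have "max_separated m T n \<epsilon> \<le> card (subwords y (n + k))" for n
      unfolding max_separated_def by (intro cSup_least) blast+
    then show ?thesis by blast
  qed
  have entropy: "topological_entropy m T = 0"
  proof (rule topological_entropy_eq_0I)
    fix \<epsilon> \<delta> :: real assume \<epsilon>: "\<epsilon> > 0" and \<delta>: "\<delta> > 0"
    obtain k where k: "\<And>n. max_separated m T n \<epsilon> \<le> card (subwords y (n + k))" using sep[OF \<epsilon>] by blast
    obtain C where C: "C \<ge> 1" "\<And>N. real (card (subwords y N)) \<le> C * exp (\<delta> * real N)"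
      using card_subwords_le[OF y \<delta>] by blast
    have "real (max_separated m T n \<epsilon>) \<le> (C * exp (\<delta> * real k)) * exp (\<delta> * real n)" for n
    proof -
      have "real (max_separated m T n \<epsilon>) \<le> C * exp (\<delta> * real (n + k))"
        using k[of n] C(2)[of "n + k"] by linarith
      then show ?thesis by (simp add: distrib_left exp_add mult_ac)
    qed
    moreover have "1 \<le> C * exp (\<delta> * real k)"
      using C(1) \<delta> mult_mono[of 1 C 1 "exp (\<delta> * real k)"] by simp
    ultimately show "\<exists>C\<ge>1. \<forall>n. real (max_separated m T n \<epsilon>) \<le> C * exp (\<delta> * real n)" by blast
  qed
  have tds: "tds m T"
    unfolding tds_def mtop using Kc contT TK
    by (auto simp: compact_space_subtopology continuous_map_in_subtopology)
  \<comment> \<open>The integer part is the leading digit, and decoding it is continuous because it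
    is locally constant on \<open>K\<close>.\<close>
  define f :: "real \<Rightarrow> complex" where "f r = complex_of_real (v (nat \<lfloor>r\<rfloor>))" for r
  have contf: "continuous_map (mtopology_of m) euclidean f"
    unfolding mtop f_def continuous_map_iff_continuous
    by (rule continuous_on_subset[OF continuous_on_floor_expansion_dom[OF b] KD])
  have "f ((T ^^ n) (p 0)) = complex_of_real (y n)" for n
    by (simp add: f_def T_p fl_p vs)
  then have "(\<lambda>N. (\<Sum>n=1..N. complex_of_real (y n) * complex_of_real (moebius n)) / of_nat N) \<longlonglongrightarrow> 0"
    using Sarnak[unfolded Sarnak_conjecture_def, rule_format, of m T "p 0" f] tds entropy contf pK by simp
  moreover have "(\<lambda>N. (\<Sum>n=1..N. complex_of_real (y n) * complex_of_real (moebius n)) / of_nat N)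
     = (\<lambda>N. complex_of_real ((\<Sum>n=1..N. moebius n * y n) / real N))"
    by (simp add: mult.commute)
  ultimately have "(\<lambda>N. complex_of_real ((\<Sum>n=1..N. moebius n * y n) / real N)) \<longlonglongrightarrow> complex_of_real 0" by simp
  then show ?thesis unfolding tendsto_of_real_iff .
qed

section \<open>Logarithmic means as averages of Cesaro means\<close>

lemma abel_log_sum:
  fixes a :: "nat \<Rightarrow> real"
  shows "(\<Sum>n=1..N. a n / real n) = (\<Sum>n=1..N. a n) / real (Suc N) + (\<Sum>n=1..N. ((\<Sum>i=1..n. a i) / real n) / real (Suc n))"
proof (induction N)
  case (Suc N)
  define S where "S = (\<Sum>n=1..N. a n)"
  have "S / real (Suc N) + x / real (Suc N) = (S + x) / real (Suc (Suc N)) + ((S + x) / real (Suc N)) / real (Suc (Suc N))" for x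
    by (simp add: divide_simps) (simp add: algebra_simps)
  from this[of "a (Suc N)"] show ?case using Suc by (simp add: S_def)
qed simp

text \<open>By partial summation the logarithmic sum is a boundary term plus the Cesaro means with
  weights \<open>1 / (n + 1)\<close>; the finitely many that are not small contribute a bounded
  amount, negligible against \<open>harm N\<close>.\<close>

lemma cesaro_imp_logmean:
  fixes a :: "nat \<Rightarrow> real"
  assumes "(\<lambda>N. (\<Sum>n=1..N. a n) / real N) \<longlonglongrightarrow> 0"
  shows "logmean a \<longlonglongrightarrow> 0"
proof (rule LIMSEQ_I)
  fix \<epsilon> :: real assume \<epsilon>: "\<epsilon> > 0"
  define c where "c N = \<bar>(\<Sum>n=1..N. a n) / real N\<bar>" for N
  obtain n0 where n0: "\<And>n. n \<ge> n0 \<Longrightarrow> c n < \<epsilon> / 2"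
    using LIMSEQ_D[OF assms, of "\<epsilon> / 2"] \<epsilon> by (auto simp: c_def)
  have "Bseq (\<lambda>N. (\<Sum>n=1..N. a n) / real N)" using assms by (intro convergent_imp_Bseq convergentI)
  then obtain C where C: "\<And>n. c n \<le> C" by (auto simp: Bseq_def c_def)
  have C0: "C \<ge> 0" using C[of 0] by (simp add: c_def)
  define D where "D = C + C * real n0"
  have bound: "\<bar>\<Sum>n=1..N. a n / real n\<bar> \<le> D + \<epsilon> / 2 * harm N" for N
  proof -
    have "\<bar>(\<Sum>n=1..N. a n) / real (Suc N)\<bar> \<le> c N"
      by (cases "N = 0") (auto simp: c_def abs_divide intro!: divide_left_mono)
    also have "\<dots> \<le> C" by (rule C)
    finally have 1: "\<bar>(\<Sum>n=1..N. a n) / real (Suc N)\<bar> \<le> C" .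
    have "\<bar>\<Sum>n=1..N. ((\<Sum>i=1..n. a i) / real n) / real (Suc n)\<bar> \<le> (\<Sum>n=1..N. (if n < n0 then C else 0) + \<epsilon> / 2 * inverse (real n))"
    proof (rule order_trans[OF sum_abs sum_mono])
      fix n assume n: "n \<in> {1..N}"
      have "\<bar>((\<Sum>i=1..n. a i) / real n) / real (Suc n)\<bar> = c n / real (Suc n)" by (simp add: c_def abs_divide)
      also have "\<dots> \<le> (if n < n0 then C else 0) + \<epsilon> / 2 * inverse (real n)"
      proof (cases "n < n0")
        case True
        have "c n / real (Suc n) \<le> C / 1" using C C0 by (intro frac_le) auto
        then show ?thesis using True \<epsilon> by (simp add: add_increasing2)
      next
        case False
        then have "c n \<le> \<epsilon> / 2" using n0[of n] by linarith
        moreover have "0 < real n" "real n \<le> real (Suc n)" "0 \<le> \<epsilon> / 2" using n \<epsilon> by simp_all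
        ultimately have "c n / real (Suc n) \<le> (\<epsilon> / 2) / real n" by (intro frac_le)
        then show ?thesis using False by (simp only: divide_inverse if_False add_0_left)
      qed
      finally show "\<bar>((\<Sum>i=1..n. a i) / real n) / real (Suc n)\<bar> \<le> (if n < n0 then C else 0) + \<epsilon> / 2 * inverse (real n)" .
    qed
    also have "\<dots> = (\<Sum>n=1..N. if n < n0 then C else 0) + \<epsilon> / 2 * harm N"
      by (simp add: sum.distrib harm_def sum_distrib_left)
    also have "(\<Sum>n=1..N. if n < n0 then C else 0) \<le> C * real n0"
    proof -
      have "(\<Sum>n=1..N. if n < n0 then C else 0) = (\<Sum>n\<in>{1..N} \<inter> {..<n0}. C)"
        using sum.inter_restrict[of "{1..N}" "\<lambda>_. C" "{..<n0}"] by simp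
      also have "\<dots> \<le> (\<Sum>n\<in>{..<n0}. C)" using C0 by (intro sum_mono2) auto
      finally show ?thesis by (simp add: mult.commute)
    qed
    finally show ?thesis using 1 unfolding abel_log_sum[of a N] D_def by linarith
  qed
  have "eventually (\<lambda>N. harm N \<ge> 2 * D / \<epsilon> + 1) sequentially"
    using harm_at_top unfolding filterlim_at_top by blast
  then obtain N0 where N0: "\<And>N. N \<ge> N0 \<Longrightarrow> harm N \<ge> 2 * D / \<epsilon> + 1" by (auto simp: eventually_sequentially)
  show "\<exists>N0. \<forall>N\<ge>N0. norm (logmean a N - 0) < \<epsilon>"
  proof (intro exI[of _ N0] allI impI)
    fix N assume "N \<ge> N0"
    have D0: "D \<ge> 0" using C0 by (simp add: D_def)
    have h: "harm N \<ge> 2 * D / \<epsilon> + 1" by (rule N0) fact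
    have "0 \<le> 2 * D / \<epsilon>" using D0 \<epsilon> by simp
    then have hp: "harm N > (0::real)" using h by linarith
    have "2 * D / \<epsilon> < harm N" using h by linarith
    then have "D < \<epsilon> / 2 * harm N" using \<epsilon> by (simp add: field_simps)
    then have "\<bar>\<Sum>n=1..N. a n / real n\<bar> < \<epsilon> * harm N" using bound[of N] by linarith
    then show "norm (logmean a N - 0) < \<epsilon>" using hp by (simp add: logmean_def abs_divide pos_divide_less_eq)
  qed
qed

text \<open>A failure along some sequence of \<open>N\<close> is caught by an ultrafilter; the
  resulting correlate contradicts Sarnak's conjecture, whose Cesaro limit implies the logarithmic
  one.\<close>

theorem log_Chowla:
  assumes Sarnak: "Sarnak_conjecture" and A: "finite A" "s0 \<in> A" "\<And>s. s \<in> A \<Longrightarrow> e s > 0" "odd (e s0)"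
  shows "logmean (corr A e) \<longlonglongrightarrow> 0"
proof (rule ccontr)
  assume "\<not> ?thesis"
  then obtain c where c: "c > 0" "\<not> eventually (\<lambda>N. \<bar>logmean (corr A e) N\<bar> < c) sequentially"
    by (auto simp: tendsto_iff dist_real_def)
  then have "frequently (\<lambda>N. \<bar>logmean (corr A e) N\<bar> \<ge> c) sequentially"
    by (simp add: frequently_def not_le)
  then obtain U L where "log_limit U L" and ev: "eventually (\<lambda>N. \<bar>logmean (corr A e) N\<bar> \<ge> c) U"
    using ex_log_limit by blast
  interpret log_limit U L by fact
  have "((\<lambda>N. \<bar>logmean (corr A e) N\<bar>) \<longlongrightarrow> \<bar>L (corr A e)\<bar>) U"
    by (intro tendsto_rabs L_lim bdd_seq_corr)
  from tendsto_lowerbound[OF this ev U_nonbot] have "L (corr A e) \<noteq> 0" using c by auto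
  from ex_zero_complexity_correlate[OF A this] obtain y where
    "finite (range y)" "zero_complexity y" "\<not> logmean (\<lambda>n. moebius n * y n) \<longlonglongrightarrow> 0" by blast
  then show False using cesaro_imp_logmean[OF Sarnak_finite_range[OF Sarnak]] by blast
qed

section \<open>From logarithmic to Cesaro means along a subsequence\<close>

lemma card_near_le:
  fixes h D H :: nat
  shows "card {h'\<in>{..<H}. h' \<le> h + D \<and> h \<le> h' + D} \<le> 2 * D + 1"
proof -
  have "card {h'\<in>{..<H}. h' \<le> h + D \<and> h \<le> h' + D} \<le> card {h - D..h + D}"
    by (rule card_mono) auto
  then show ?thesis by simp
qed

text \<open>The translates of \<open>A\<close> by \<open>h\<close> and \<open>h'\<close> are
  disjoint, the first lying below \<open>h'\<close> and the second not; so \<open>s < h'\<close>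
  tells which exponent applies.\<close>

lemma corr_shift_mult:
  assumes A: "finite A" and far: "Max A + h < h'"
  shows "corr A e (n + h) * corr A e (n + h') =
    corr ((\<lambda>s. s + h) ` A \<union> (\<lambda>s. s + h') ` A) (\<lambda>s. if s < h' then e (s - h) else e (s - h')) n"
proof -
  have lt: "s + h < h'" if "s \<in> A" for s using Max_ge[OF A that] far by linarith
  have "corr ((\<lambda>s. s + h) ` A \<union> (\<lambda>s. s + h') ` A) (\<lambda>s. if s < h' then e (s - h) else e (s - h')) n
     = (\<Prod>s\<in>(\<lambda>s. s + h) ` A. moebius (n + s) ^ (if s < h' then e (s - h) else e (s - h'))) *
       (\<Prod>s\<in>(\<lambda>s. s + h') ` A. moebius (n + s) ^ (if s < h' then e (s - h) else e (s - h')))"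
    unfolding corr_def using A lt by (intro prod.union_disjoint) fastforce+
  also have "(\<Prod>s\<in>(\<lambda>s. s + h) ` A. moebius (n + s) ^ (if s < h' then e (s - h) else e (s - h'))) = corr A e (n + h)"
    using lt by (subst prod.reindex) (auto simp: corr_def inj_on_def add_ac intro!: prod.cong)
  also have "(\<Prod>s\<in>(\<lambda>s. s + h') ` A. moebius (n + s) ^ (if s < h' then e (s - h) else e (s - h'))) = corr A e (n + h')"
    by (subst prod.reindex) (auto simp: corr_def inj_on_def add_ac intro!: prod.cong)
  finally show ?thesis by simp
qed

lemma logmean_sum: "logmean (\<lambda>n. \<Sum>i\<in>I. f i n) N = (\<Sum>i\<in>I. logmean (f i) N)"
  by (induction I rule: infinite_finite_induct) (auto simp: logmean_add, simp_all add: logmean_def)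

definition window_mean :: "nat \<Rightarrow> (nat \<Rightarrow> real) \<Rightarrow> nat \<Rightarrow> real" where
  "window_mean H g n = (\<Sum>h<H. g (n + h)) / real H"

text \<open>After expanding the square, pairs \<open>h\<close>, \<open>h'\<close> more than
  \<open>D\<close> apart vanish in the limit by \<open>log_Chowla\<close>, since an odd exponent
  survives in the product; the other pairs make up a fraction of at most
  \<open>(2 * D + 1) / H\<close>.\<close>

lemma logmean_window_mean_square:
  assumes Sarnak: "Sarnak_conjecture" and A: "finite A" "s0 \<in> A" "\<And>s. s \<in> A \<Longrightarrow> e s > 0" "odd (e s0)"
    and \<epsilon>: "\<epsilon> > 0"
  shows "\<exists>H>0. eventually (\<lambda>N. logmean (\<lambda>n. (window_mean H (corr A e) n)\<^sup>2) N \<le> \<epsilon>) sequentially"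
proof -
  define D where "D = Max A"
  define g where "g = corr A e"
  define H where "H = nat \<lceil>2 * real (2 * D + 1) / \<epsilon>\<rceil> + 1"
  have H: "H > 0" "2 * real (2 * D + 1) / \<epsilon> \<le> real H" unfolding H_def by linarith+
  define t where "t h h' N = logmean (\<lambda>n. g (n + h) * g (n + h')) N" for h h' N
  define near where "near h h' \<longleftrightarrow> h' \<le> h + D \<and> h \<le> h' + D" for h h'
  have t1: "\<bar>t h h' N\<bar> \<le> 1" for h h' N
    unfolding t_def
  proof (rule logmean_abs_le)
    fix n show "\<bar>g (n + h) * g (n + h')\<bar> \<le> 1"
      unfolding g_def abs_mult by (intro mult_le_one abs_corr_le_1) auto
  qed
  have far: "t h h' \<longlonglongrightarrow> 0" if "D + h < h'" for h h'
  proof -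
    have "logmean (corr ((\<lambda>s. s + h) ` A \<union> (\<lambda>s. s + h') ` A) (\<lambda>s. if s < h' then e (s - h) else e (s - h'))) \<longlonglongrightarrow> 0"
    proof (rule log_Chowla[OF Sarnak, of _ "s0 + h"])
      have "s0 + h < h'" using Max_ge[OF A(1,2)] that by (simp add: D_def)
      then show "odd (if s0 + h < h' then e (s0 + h - h) else e (s0 + h - h'))" using A by simp
      fix s assume "s \<in> (\<lambda>s. s + h) ` A \<union> (\<lambda>s. s + h') ` A"
      moreover have "s + h < h'" if "s \<in> A" for s
        using Max_ge[OF A(1) that] \<open>D + h < h'\<close> by (simp add: D_def)
      ultimately show "0 < (if s < h' then e (s - h) else e (s - h'))" using A(3) by auto
    qed (use A in auto)
    then show ?thesis
      using corr_shift_mult[OF A(1), of h h' e] that unfolding t_def g_def D_def by simp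
  qed
  have far': "t h h' \<longlonglongrightarrow> 0" if "\<not> near h h'" for h h'
  proof (cases "D + h < h'")
    case False
    then have "D + h' < h" using that by (auto simp: near_def)
    moreover have "t h h' = t h' h" by (simp add: t_def mult.commute fun_eq_iff)
    ultimately show ?thesis using far by simp
  qed (rule far)
  have lim0: "(\<lambda>N. if near h h' then 0 else t h h' N) \<longlonglongrightarrow> 0" for h h'
    by (cases "near h h'") (auto simp: far')
  have "(\<lambda>N. (\<Sum>h<H. \<Sum>h'<H. if near h h' then 0 else t h h' N) / (real H)\<^sup>2) \<longlonglongrightarrow> (\<Sum>h<H. \<Sum>h'<H. 0) / (real H)\<^sup>2"
    by (intro tendsto_divide tendsto_sum tendsto_const lim0) (use H in auto)
  then have "eventually (\<lambda>N. (\<Sum>h<H. \<Sum>h'<H. if near h h' then 0 else t h h' N) / (real H)\<^sup>2 < \<epsilon> / 2) sequentially"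
    using \<epsilon> by (intro order_tendstoD(2)) auto
  then have "eventually (\<lambda>N. logmean (\<lambda>n. (window_mean H g n)\<^sup>2) N \<le> \<epsilon>) sequentially"
  proof eventually_elim
    fix N assume N: "(\<Sum>h<H. \<Sum>h'<H. if near h h' then 0 else t h h' N) / (real H)\<^sup>2 < \<epsilon> / 2"
    have "(window_mean H g n)\<^sup>2 = (1 / (real H)\<^sup>2) * (\<Sum>h<H. \<Sum>h'<H. g (n + h) * g (n + h'))" for n
      by (simp add: window_mean_def power_divide power2_eq_square sum_product)
    then have "logmean (\<lambda>n. (window_mean H g n)\<^sup>2) N = (1 / (real H)\<^sup>2) * (\<Sum>h<H. \<Sum>h'<H. t h h' N)"
      by (simp add: logmean_cmult logmean_sum t_def del: times_divide_eq_left)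
    also have "(\<Sum>h<H. \<Sum>h'<H. t h h' N) = (\<Sum>h<H. \<Sum>h'<H. if near h h' then t h h' N else 0)
        + (\<Sum>h<H. \<Sum>h'<H. if near h h' then 0 else t h h' N)"
      unfolding sum.distrib [symmetric] by (intro sum.cong refl) auto
    also have "(\<Sum>h<H. \<Sum>h'<H. if near h h' then t h h' N else 0) \<le> (\<Sum>h<H. real (2 * D + 1))"
    proof (rule sum_mono)
      fix h
      have "(\<Sum>h'<H. if near h h' then t h h' N else 0) \<le> (\<Sum>h'<H. if near h h' then 1 else 0)"
        using t1 by (intro sum_mono) (auto simp: abs_le_iff)
      also have "\<dots> = real (card {h'\<in>{..<H}. near h h'})" by (simp add: sum.If_cases Int_def)
      also have "\<dots> \<le> real (2 * D + 1)" unfolding near_def using card_near_le by (intro of_nat_mono)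
      finally show "(\<Sum>h'<H. if near h h' then t h h' N else 0) \<le> real (2 * D + 1)" .
    qed
    finally have "logmean (\<lambda>n. (window_mean H g n)\<^sup>2) N \<le> (1 / (real H)\<^sup>2) *
        ((\<Sum>h<H. real (2 * D + 1)) + (\<Sum>h<H. \<Sum>h'<H. if near h h' then 0 else t h h' N))"
      by (simp add: mult_left_mono divide_right_mono)
    also have "\<dots> = real (2 * D + 1) / real H + (\<Sum>h<H. \<Sum>h'<H. if near h h' then 0 else t h h' N) / (real H)\<^sup>2"
      using H by (simp add: distrib_left power2_eq_square add_divide_distrib del: of_nat_add of_nat_mult of_nat_Suc)
    also have "real (2 * D + 1) / real H \<le> \<epsilon> / 2"
      using H \<epsilon> by (simp add: field_simps)
    finally show "logmean (\<lambda>n. (window_mean H g n)\<^sup>2) N \<le> \<epsilon>" using N by linarith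
  qed
  then show ?thesis using H unfolding g_def by blast
qed

text \<open>If all Cesaro means beyond \<open>N0\<close> exceeded \<open>2 * \<eta>\<close>, partial
  summation would push the logarithmic mean towards \<open>2 * \<eta>\<close>. This yields
  arbitrarily large \<open>x\<close>, but no control for every \<open>x\<close>.\<close>

lemma ex_small_cesaro_mean:
  fixes \<Phi> :: "nat \<Rightarrow> real"
  assumes \<Phi>: "\<And>n. \<Phi> n \<ge> 0" and \<eta>: "\<eta> > 0" and ev: "eventually (\<lambda>N. logmean \<Phi> N \<le> \<eta>) sequentially"
  shows "\<exists>x>N0. (\<Sum>n=1..x. \<Phi> n) \<le> 2 * \<eta> * real x"
proof (rule ccontr)
  assume "\<not> ?thesis"
  then have big: "(\<Sum>n=1..x. \<Phi> n) > 2 * \<eta> * real x" if "x > N0" for x using that by (auto simp: not_le)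
  \<comment> \<open>This makes \<open>2 * (harm N - harm (Suc N0))\<close> larger than
    \<open>harm N\<close>.\<close>
  have "eventually (\<lambda>N. harm N \<ge> 2 * harm (Suc N0) + (1::real)) sequentially"
    using harm_at_top unfolding filterlim_at_top by blast
  then have "eventually (\<lambda>N. logmean \<Phi> N \<le> \<eta> \<and> harm N \<ge> 2 * harm (Suc N0) + (1::real)) sequentially"
    using ev by eventually_elim simp
  then obtain N where N: "logmean \<Phi> N \<le> \<eta>" "harm N \<ge> 2 * harm (Suc N0) + (1::real)"
    using eventually_happens'[OF sequentially_bot] by blast
  have hp: "harm N > (0::real)" using N(2) harm_nonneg[of "Suc N0", where 'a = real] by linarith
  have "2 * \<eta> * (harm (Suc N) - harm (Suc N0)) \<le> (\<Sum>n=1..N. ((\<Sum>i=1..n. \<Phi> i) / real n) / real (Suc n))"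
  proof -
    have "2 * \<eta> * (harm (Suc M) - harm (Suc N0)) \<le> (\<Sum>n=1..M. ((\<Sum>i=1..n. \<Phi> i) / real n) / real (Suc n))" for M
    proof (induction M)
      case 0
      have "harm (Suc 0) \<le> (harm (Suc N0) :: real)" by (rule harm_mono) simp
      then show ?case using \<eta> by (simp add: mult_le_0_iff)
    next
      case (Suc M)
      show ?case
      proof (cases "Suc M \<le> N0")
        case True
        then have "harm (Suc (Suc M)) \<le> (harm (Suc N0) :: real)" by (intro harm_mono) simp
        then have "2 * \<eta> * (harm (Suc (Suc M)) - harm (Suc N0)) \<le> 0" using \<eta> by (simp add: mult_le_0_iff)
        also have "\<dots> \<le> (\<Sum>n=1..Suc M. ((\<Sum>i=1..n. \<Phi> i) / real n) / real (Suc n))"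
          using \<Phi> by (intro sum_nonneg divide_nonneg_nonneg) auto
        finally show ?thesis .
      next
        case False
        then have "2 * \<eta> \<le> (\<Sum>i=1..Suc M. \<Phi> i) / real (Suc M)"
          using big[of "Suc M"] by (simp add: pos_le_divide_eq less_imp_le)
        then have "2 * \<eta> / real (Suc (Suc M)) \<le> ((\<Sum>i=1..Suc M. \<Phi> i) / real (Suc M)) / real (Suc (Suc M))"
          by (intro divide_right_mono) auto
        moreover have "2 * \<eta> * (harm (Suc (Suc M)) - harm (Suc N0)) = 2 * \<eta> * (harm (Suc M) - harm (Suc N0)) + 2 * \<eta> / real (Suc (Suc M))"
          by (simp add: harm_Suc[of "Suc M"] algebra_simps divide_inverse del: harm_Suc)
        moreover have "(\<Sum>n=1..Suc M. ((\<Sum>i=1..n. \<Phi> i) / real n) / real (Suc n)) =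
          (\<Sum>n=1..M. ((\<Sum>i=1..n. \<Phi> i) / real n) / real (Suc n)) + ((\<Sum>i=1..Suc M. \<Phi> i) / real (Suc M)) / real (Suc (Suc M))"
          by simp
        ultimately show ?thesis using Suc by linarith
      qed
    qed
    then show ?thesis .
  qed
  also have "\<dots> \<le> (\<Sum>n=1..N. \<Phi> n / real n)"
    unfolding abel_log_sum[of \<Phi> N] using \<Phi> by (simp add: sum_nonneg)
  also have "\<dots> \<le> \<eta> * harm N" using N(1) hp by (simp add: logmean_def pos_divide_le_eq)
  finally have "2 * \<eta> * (harm (Suc N) - harm (Suc N0)) \<le> \<eta> * harm N" .
  moreover have "2 * \<eta> * (harm N - harm (Suc N0)) \<le> 2 * \<eta> * (harm (Suc N) - harm (Suc N0))"
    using \<eta> by (intro mult_left_mono) (auto simp: harm_Suc)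
  ultimately have "2 * \<eta> * (harm N - harm (Suc N0)) \<le> \<eta> * harm N" by (rule order_trans[rotated])
  then have "\<eta> * (2 * (harm N - harm (Suc N0))) \<le> \<eta> * harm N" by (simp only: mult_ac)
  then have "2 * (harm N - harm (Suc N0)) \<le> (harm N :: real)" using \<eta> by (simp only: mult_le_cancel_left_pos)
  then show False using N(2) by argo
qed

lemma sum_shift_diff_le:
  fixes g :: "nat \<Rightarrow> real"
  assumes "\<And>n. \<bar>g n\<bar> \<le> 1"
  shows "\<bar>(\<Sum>n=1..x. g (n + h)) - (\<Sum>n=1..x. g n)\<bar> \<le> 2 * real h"
proof (induction h)
  case (Suc h)
  have "(\<Sum>n=1..x. g (n + Suc h)) - (\<Sum>n=1..x. g (n + h)) = g (Suc x + h) - g (Suc h)"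
    by (induction x) auto
  then show ?case using Suc assms[of "Suc x + h"] assms[of "Suc h"] by simp
qed simp

text \<open>Replacing \<open>g\<close> by its window means moves the sum by boundary terms only, at
  most \<open>2 * H\<close>; Cauchy-Schwarz does the rest.\<close>

lemma cesaro_le_window_mean:
  fixes g :: "nat \<Rightarrow> real"
  assumes g: "\<And>n. \<bar>g n\<bar> \<le> 1" and H: "H > 0"
  shows "\<bar>\<Sum>n=1..x. g n\<bar> \<le> sqrt (real x * (\<Sum>n=1..x. (window_mean H g n)\<^sup>2)) + 2 * real H"
proof -
  have "real H * (\<Sum>n=1..x. window_mean H g n) = (\<Sum>h<H. \<Sum>n=1..x. g (n + h))"
    unfolding window_mean_def sum_divide_distrib [symmetric] using H by (subst sum.swap) simp
  then have "real H * ((\<Sum>n=1..x. g n) - (\<Sum>n=1..x. window_mean H g n)) = (\<Sum>h<H. (\<Sum>n=1..x. g n) - (\<Sum>n=1..x. g (n + h)))"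
    by (simp add: sum_subtractf right_diff_distrib)
  also have "\<bar>\<dots>\<bar> \<le> (\<Sum>h<H. 2 * real H)"
  proof (rule order_trans[OF sum_abs sum_mono])
    fix h assume "h \<in> {..<H}"
    then show "\<bar>(\<Sum>n=1..x. g n) - (\<Sum>n=1..x. g (n + h))\<bar> \<le> 2 * real H"
      using sum_shift_diff_le[where g = g and x = x and h = h, OF g] by (simp add: abs_minus_commute)
  qed
  finally have "\<bar>(\<Sum>n=1..x. g n) - (\<Sum>n=1..x. window_mean H g n)\<bar> \<le> 2 * real H"
    using H by (simp add: abs_mult)
  moreover have "\<bar>\<Sum>n=1..x. window_mean H g n\<bar> \<le> sqrt (real x * (\<Sum>n=1..x. (window_mean H g n)\<^sup>2))"
  proof (rule real_le_rsqrt)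
    have "(\<Sum>n=1..x. 1 * window_mean H g n)\<^sup>2 \<le> (\<Sum>n=1..x. 1\<^sup>2) * (\<Sum>n=1..x. (window_mean H g n)\<^sup>2)"
      by (rule Cauchy_Schwarz_ineq_sum)
    then show "\<bar>\<Sum>n=1..x. window_mean H g n\<bar>\<^sup>2 \<le> real x * (\<Sum>n=1..x. (window_mean H g n)\<^sup>2)" by simp
  qed
  ultimately show ?thesis by linarith
qed

text \<open>\<open>B\<close> marks the places with exponent 1, and meeting \<open>A\<close> says
  that not all exponents are 2. Encoding by two finite sets keeps the family countable for the
  diagonal choice.\<close>

definition Chowla_corrs :: "(nat \<Rightarrow> real) set" where
  "Chowla_corrs = {corr A (\<lambda>s. if s \<in> B then 1 else 2) | A B. finite A \<and> finite B \<and> A \<inter> B \<noteq> {}}"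

lemma countable_Chowla_corrs: "countable Chowla_corrs"
proof -
  have "Chowla_corrs \<subseteq> (\<lambda>(A, B). corr A (\<lambda>s. if s \<in> B then 1 else 2)) ` (Collect finite \<times> Collect finite)"
    by (auto simp: Chowla_corrs_def)
  moreover have "countable (Collect (finite :: nat set \<Rightarrow> bool))"
    using countable_Collect_finite by simp
  ultimately show ?thesis by (meson countable_SIGMA countable_image countable_subset)
qed

lemma ex_common_small_mean:
  assumes Sarnak: "Sarnak_conjecture" and J: "finite J" "J \<subseteq> Chowla_corrs" and \<epsilon>: "\<epsilon> > 0"
  shows "\<exists>x>N0. \<forall>g\<in>J. \<bar>(\<Sum>n=1..x. g n) / real x\<bar> \<le> \<epsilon>"
proof -
  \<comment> \<open>With this choice \<open>sqrt (x * (2 * \<eta> * x))\<close> equals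
    \<open>\<epsilon> / 2 * x\<close>; the other half of \<open>\<epsilon>\<close> pays for
    \<open>2 * H g\<close> once \<open>x > M\<close>.\<close>
  define \<eta> where "\<eta> = \<epsilon>\<^sup>2 / 8"
  have \<eta>: "\<eta> > 0" using \<epsilon> by (simp add: \<eta>_def)
  define \<kappa> where "\<kappa> = \<eta> / (real (card J) + 1)"
  have \<kappa>: "\<kappa> > 0" using \<eta> by (simp add: \<kappa>_def)
  have g1: "\<bar>g n\<bar> \<le> 1" if "g \<in> J" for g n using that J(2) abs_corr_le_1 by (auto simp: Chowla_corrs_def)
  have "\<exists>H>0. eventually (\<lambda>N. logmean (\<lambda>n. (window_mean H g n)\<^sup>2) N \<le> \<kappa>) sequentially" if gJ: "g \<in> J" for g
  proof -
    obtain A B where AB: "g = corr A (\<lambda>s. if s \<in> B then 1 else 2)" "finite A" "A \<inter> B \<noteq> {}"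
      using gJ J(2) unfolding Chowla_corrs_def by blast
    then obtain s0 where s0: "s0 \<in> A" "s0 \<in> B" by blast
    show ?thesis unfolding AB(1)
      by (rule logmean_window_mean_square[OF Sarnak AB(2) s0(1) _ _ \<kappa>]) (use s0 in auto)
  qed
  then obtain H where H: "\<And>g. g \<in> J \<Longrightarrow> H g > 0"
    "\<And>g. g \<in> J \<Longrightarrow> eventually (\<lambda>N. logmean (\<lambda>n. (window_mean (H g) g n)\<^sup>2) N \<le> \<kappa>) sequentially" by metis
  \<comment> \<open>Suitable \<open>x\<close> found separately might differ from one
    \<open>g\<close> to another; an \<open>x\<close> found for the sum over \<open>J\<close> serves
    all of them.\<close>
  define \<Phi> where "\<Phi> n = (\<Sum>g\<in>J. (window_mean (H g) g n)\<^sup>2)" for n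
  have "eventually (\<lambda>N. \<forall>g\<in>J. logmean (\<lambda>n. (window_mean (H g) g n)\<^sup>2) N \<le> \<kappa>) sequentially"
    using J(1) H(2) by (intro eventually_ball_finite) auto
  then have ev: "eventually (\<lambda>N. logmean \<Phi> N \<le> \<eta>) sequentially"
  proof eventually_elim
    fix N assume "\<forall>g\<in>J. logmean (\<lambda>n. (window_mean (H g) g n)\<^sup>2) N \<le> \<kappa>"
    then have "logmean \<Phi> N \<le> (\<Sum>g\<in>J. \<kappa>)" unfolding \<Phi>_def logmean_sum by (intro sum_mono) auto
    also have "\<dots> \<le> (real (card J) + 1) * \<kappa>" using \<kappa> by simp
    also have "\<dots> = \<eta>" by (simp add: \<kappa>_def add_nonneg_eq_0_iff)
    finally show "logmean \<Phi> N \<le> \<eta>" .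
  qed
  have \<Phi>0: "\<Phi> n \<ge> 0" for n unfolding \<Phi>_def by (intro sum_nonneg) auto
  define M where "M = N0 + nat \<lceil>\<Sum>g\<in>J. 4 * real (H g) / \<epsilon>\<rceil>"
  obtain x where x: "x > M" "(\<Sum>n=1..x. \<Phi> n) \<le> 2 * \<eta> * real x"
    using ex_small_cesaro_mean[OF \<Phi>0 \<eta> ev, of M] by blast
  have x0: "real x > 0" using x(1) by simp
  have "\<bar>(\<Sum>n=1..x. g n) / real x\<bar> \<le> \<epsilon>" if g: "g \<in> J" for g
  proof -
    have "(\<Sum>n=1..x. (window_mean (H g) g n)\<^sup>2) \<le> (\<Sum>n=1..x. \<Phi> n)"
      unfolding \<Phi>_def using J(1) g by (intro sum_mono member_le_sum) auto
    also have "\<dots> \<le> 2 * \<eta> * real x" by (rule x(2))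
    finally have "real x * (\<Sum>n=1..x. (window_mean (H g) g n)\<^sup>2) \<le> real x * (2 * \<eta> * real x)"
      by (intro mult_left_mono) auto
    also have "\<dots> = (\<epsilon> / 2 * real x)\<^sup>2" by (simp add: \<eta>_def power2_eq_square)
    finally have "sqrt (real x * (\<Sum>n=1..x. (window_mean (H g) g n)\<^sup>2)) \<le> \<epsilon> / 2 * real x"
      using \<epsilon> by (intro real_le_lsqrt) (auto intro!: mult_nonneg_nonneg sum_nonneg)
    moreover have "2 * real (H g) \<le> \<epsilon> / 2 * real x"
    proof -
      have "4 * real (H g) / \<epsilon> \<le> (\<Sum>g\<in>J. 4 * real (H g) / \<epsilon>)"
        using J(1) g \<epsilon> by (intro member_le_sum) auto
      also have "\<dots> \<le> real M" unfolding M_def by linarith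
      also have "\<dots> \<le> real x" using x(1) by simp
      finally show ?thesis using \<epsilon> by (simp add: field_simps)
    qed
    ultimately have "\<bar>\<Sum>n=1..x. g n\<bar> \<le> \<epsilon> * real x"
      using cesaro_le_window_mean[of g "H g" x] g1[OF g] H(1)[OF g] by simp
    then show ?thesis using x0 by (simp add: abs_divide pos_divide_le_eq)
  qed
  moreover have "x > N0" using x(1) by (simp add: M_def)
  ultimately show ?thesis by blast
qed

lemma ex_common_subsequence:
  assumes Sarnak: "Sarnak_conjecture"
  shows "\<exists>N :: nat \<Rightarrow> nat. strict_mono N \<and> (\<forall>i. N i > 0) \<and>
    (\<forall>g\<in>Chowla_corrs. (\<lambda>i. (\<Sum>n=1..N i. g n) / real (N i)) \<longlonglongrightarrow> 0)"
proof -
  have "corr {0} (\<lambda>s. if s \<in> {0} then 1 else 2) \<in> Chowla_corrs"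
    unfolding Chowla_corrs_def by blast
  then have ne: "Chowla_corrs \<noteq> {}" by blast
  define f where "f = from_nat_into Chowla_corrs"
  have f: "f j \<in> Chowla_corrs" for j unfolding f_def by (rule from_nat_into[OF ne])
  have f_surj: "\<exists>j. f j = g" if "g \<in> Chowla_corrs" for g
    using from_nat_into_surj[OF countable_Chowla_corrs that] by (simp add: f_def)
  have step: "\<exists>x>N0. \<forall>j\<le>i. \<bar>(\<Sum>n=1..x. f j n) / real x\<bar> \<le> 1 / real (Suc i)" for N0 i
    using ex_common_small_mean[OF Sarnak, of "f ` {..i}" "1 / real (Suc i)" N0] f by auto
  have step': "\<exists>x'. (x' > 0 \<and> (\<forall>j\<le>i. \<bar>(\<Sum>n=1..x'. f j n) / real x'\<bar> \<le> 1 / real (Suc i))) \<and> x < x'" for x i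
  proof -
    from step[of x i] obtain x' where "x' > x" "\<forall>j\<le>i. \<bar>(\<Sum>n=1..x'. f j n) / real x'\<bar> \<le> 1 / real (Suc i)"
      by (elim exE conjE) (rule that)
    then show ?thesis by (intro exI[of _ x'] conjI) auto
  qed
  have "\<exists>N. \<forall>i. (N i > 0 \<and> (\<forall>j\<le>i. \<bar>(\<Sum>n=1..N i. f j n) / real (N i)\<bar> \<le> 1 / real (Suc i))) \<and> N i < N (Suc i)"
  proof (rule dependent_nat_choice)
    show "\<exists>x>0. \<forall>j\<le>0. \<bar>(\<Sum>n=1..x. f j n) / real x\<bar> \<le> 1 / real (Suc 0)" by (rule step)
    fix x i
    show "\<exists>x'. (x' > 0 \<and> (\<forall>j\<le>Suc i. \<bar>(\<Sum>n=1..x'. f j n) / real x'\<bar> \<le> 1 / real (Suc (Suc i)))) \<and> x < x'"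
      by (rule step')
  qed
  then obtain N where N_all: "\<forall>i. (N i > 0 \<and> (\<forall>j\<le>i. \<bar>(\<Sum>n=1..N i. f j n) / real (N i)\<bar> \<le> 1 / real (Suc i))) \<and> N i < N (Suc i)"
    by (elim exE) (rule that)
  then have N: "\<And>i. N i > 0" "\<And>i. N i < N (Suc i)"
    "\<And>i j. j \<le> i \<Longrightarrow> \<bar>(\<Sum>n=1..N i. f j n) / real (N i)\<bar> \<le> 1 / real (Suc i)" by blast+
  have "(\<lambda>i. (\<Sum>n=1..N i. g n) / real (N i)) \<longlonglongrightarrow> 0" if g: "g \<in> Chowla_corrs" for g
  proof -
    obtain j where j: "f j = g" using f_surj[OF g] by blast
    show ?thesis
    proof (rule Lim_null_comparison)
      show "eventually (\<lambda>i. norm ((\<Sum>n=1..N i. g n) / real (N i)) \<le> 1 / real (Suc i)) sequentially"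
        using N(3)[of j] j by (auto simp: eventually_sequentially)
      show "(\<lambda>i. 1 / real (Suc i)) \<longlonglongrightarrow> 0" using LIMSEQ_inverse_real_of_nat by (simp add: divide_inverse)
    qed
  qed
  then show ?thesis using N by (intro exI[of _ N]) (simp add: strict_mono_Suc_iff)
qed

theorem theorem1p1:
  assumes "Sarnak_conjecture"
  shows "\<exists>N :: nat \<Rightarrow> nat. strict_mono N \<and> (\<forall>i. N i > 0) \<and>
     (\<forall>(k :: nat) (a :: nat \<Rightarrow> nat) (j :: nat \<Rightarrow> nat).
        (\<forall>l\<in>{1..k}. 1 \<le> a l) \<and> (\<forall>l\<in>{1..<k}. a l < a (Suc l)) \<and>
        (\<forall>l\<in>{0..k}. j l \<in> {1, 2}) \<and> (\<exists>l\<in>{0..k}. j l \<noteq> 2) \<longrightarrow>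
        (\<lambda>i. (\<Sum>n=1..N i. moebius n ^ j 0 * (\<Prod>l=1..k. moebius (n + a l) ^ j l))
               / real (N i)) \<longlonglongrightarrow> 0)"
proof -
  obtain N :: "nat \<Rightarrow> nat" where N: "strict_mono N" "\<forall>i. N i > 0"
    "\<And>g. g \<in> Chowla_corrs \<Longrightarrow> (\<lambda>i. (\<Sum>n=1..N i. g n) / real (N i)) \<longlonglongrightarrow> 0"
    using ex_common_subsequence[OF assms] by blast
  show ?thesis
  proof (rule exI[of _ N], intro conjI N(1,2) allI impI)
    fix k :: nat and a j :: "nat \<Rightarrow> nat"
    assume H: "(\<forall>l\<in>{1..k}. 1 \<le> a l) \<and> (\<forall>l\<in>{1..<k}. a l < a (Suc l)) \<and>
        (\<forall>l\<in>{0..k}. j l \<in> {1, 2}) \<and> (\<exists>l\<in>{0..k}. j l \<noteq> 2)"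
    \<comment> \<open>The unshifted factor becomes the shift 0; since all
      \<open>a l \<ge> 1\<close>, it stays distinct from the others.\<close>
    define b where "b l = (if l = 0 then 0 else a l)" for l
    have step: "b l < b (Suc l)" if "l < k" for l
      using H that by (auto simp: b_def Suc_le_eq)
    have less: "b l < b l'" if "l < l'" "l' \<le> k" for l l'
      using that
    proof (induction l')
      case (Suc m)
      have "b m < b (Suc m)" using Suc.prems by (intro step) simp
      moreover have "b l \<le> b m" using Suc by (cases "l = m") auto
      ultimately show ?case by simp
    qed simp
    have inj: "inj_on b {0..k}"
      by (rule linorder_inj_onI) (use less in force)+
    define A where "A = b ` {0..k}"
    define B where "B = b ` {l\<in>{0..k}. j l = 1}"
    have eq: "corr A (\<lambda>s. if s \<in> B then 1 else 2) n = moebius n ^ j 0 * (\<Prod>l=1..k. moebius (n + a l) ^ j l)" for n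
    proof -
      have mem: "b l \<in> B \<longleftrightarrow> j l = 1" if "l \<in> {0..k}" for l
      proof
        assume "b l \<in> B"
        then obtain l' where "l' \<in> {0..k}" "j l' = 1" "b l = b l'" by (auto simp: B_def)
        then show "j l = 1" using inj_onD[OF inj, of l l'] that by simp
      qed (use that in \<open>auto simp: B_def\<close>)
      have "corr A (\<lambda>s. if s \<in> B then 1 else 2) n = (\<Prod>l\<in>{0..k}. moebius (n + b l) ^ j l)"
        unfolding corr_def A_def using H mem by (subst prod.reindex[OF inj]) (intro prod.cong, auto)
      also have "\<dots> = moebius (n + b 0) ^ j 0 * (\<Prod>l\<in>{Suc 0..k}. moebius (n + b l) ^ j l)"
        by (rule prod.atLeast_Suc_atMost) simp
      also have "\<dots> = moebius n ^ j 0 * (\<Prod>l=1..k. moebius (n + a l) ^ j l)"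
        by (auto simp: b_def intro!: prod.cong)
      finally show ?thesis .
    qed
    have "finite A" "finite B" by (simp_all add: A_def B_def)
    moreover have "A \<inter> B \<noteq> {}"
    proof -
      obtain l where "l \<in> {0..k}" "j l = 1" using H by blast
      then have "b l \<in> A \<inter> B" by (auto simp: A_def B_def)
      then show ?thesis by blast
    qed
    ultimately have mem: "corr A (\<lambda>s. if s \<in> B then 1 else 2) \<in> Chowla_corrs"
      unfolding Chowla_corrs_def mem_Collect_eq by (intro exI[of _ A] exI[of _ B] conjI refl)
    show "(\<lambda>i. (\<Sum>n=1..N i. moebius n ^ j 0 * (\<Prod>l=1..k. moebius (n + a l) ^ j l)) / real (N i)) \<longlonglongrightarrow> 0"
      using N(3)[OF mem] by (simp only: eq)
  qed
qed

end
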